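(* Let $P_1=\bigsqcup_{\lambda\in\Lambda}K_\lambda$ (topological disjoint union), where $\Lambda$ is uncountable and all $K_\lambda$ are $\sigma$-compact locally compact Hausdorff spaces. Let $P$ be a locally compact Hausdorff space which is not $\sigma$-compact and such that $C_0(P)$ has a normalized frame, let $\alpha P=P\cup\{p_\infty\}$ be its one-point compactification, and let $P_2=\alpha P\times[0,\omega_0]\setminus\{(p_\infty,\omega_0)\}$, where $[0,\omega_0]$ is the space of all ordinals $\le\omega_0$ (the first infinite ordinal) with the order topology. Let $K=P_1\sqcup P_2$. Then there is no standard frame in $C_0(K)$, but there exists a non-standard frame in $C_0(K)$.
   Context: A space is $\sigma$-compact if it is a countable union of compact subsets. $C_0(K)$ is the $C^*$-algebra of complex continuous functions on $K$ vanishing at infinity; it is a Hilbert module over itself, and over its unitalization, with inner product $\langle x,y\rangle=\overline{x}\,y$. $\dot{\mathcal A}$ denotes the unitalization of a $C^*$-algebra $\mathcal A$ (equal to $\mathcal A$ if $\mathcal A$ is unital). Frames: let $\mathcal N$ be a Hilbert $C^*$-module over a unital $C^*$-algebra $\mathcal A$. A family $\{x_j\}_{j\in J}$ (any index set) in $\mathcal N$ is a standard frame if there are constants $c_1,c_2>0$ such that for every $x\in\mathcal N$ the series $\sum_j\langle x,x_j\rangle\langle x_j,x\rangle$ converges in norm in $\mathcal A$ and $c_1\langle x,x\rangle\le\sum_j\langle x,x_j\rangle\langle x_j,x\rangle\le c_2\langle x,x\rangle$. It is a non-standard frame if the same holds with norm convergence replaced by convergence, in the ultraweak ($\sigma$-weak)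 topology, of the net of all finite partial sums to an element of the universal enveloping von Neumann algebra $\mathcal A''$ (the inequalities being understood in $\mathcal A''$). "Frame" means at least non-standard, i.e. the series converges at least ultraweakly. A frame is normalized if one can take $c_1=c_2=1$. For a Hilbert module over a non-unital $\mathcal A$, frames are understood by viewing it as a module over $\dot{\mathcal A}$. *)

theory Defs
  imports "HOL-Analysis.Analysis" "HOL-Library.Function_Algebras" "HOL-Library.Product_Plus"
begin

section \<open>Topological spaces\<close>

definition sigma_compact_space :: "'a topology \<Rightarrow> bool" where
  "sigma_compact_space X \<longleftrightarrow>
     (\<exists>\<C>. countable \<C> \<and> (\<forall>C\<in>\<C>. compactin X C) \<and> \<Union>\<C> = topspace X)"

definition disjoint_union_topology :: "'a topology \<Rightarrow> 'b topology \<Rightarrow> ('a + 'b) topology" where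
  "disjoint_union_topology X Y =
     topology (\<lambda>U. openin X (Inl -` U) \<and> openin Y (Inr -` U))"

lemma openin_disjoint_union_topology:
  "openin (disjoint_union_topology X Y) U \<longleftrightarrow> openin X (Inl -` U) \<and> openin Y (Inr -` U)"
proof -
  have "istopology (\<lambda>U. openin X (Inl -` U) \<and> openin Y (Inr -` U))"
    by (auto simp: istopology_def vimage_Union)
  then show ?thesis
    by (simp add: disjoint_union_topology_def topology_inverse')
qed

text \<open>The Alexandroff compactification lives on \<^typ>\<open>'p option\<close>, with \<^const>\<open>None\<close> the point at
  infinity.  The type \<^typ>\<open>enat\<close> with its order topology is the space of ordinals up to the
  first infinite ordinal.\<close>

definition punctured_product :: "'p topology \<Rightarrow> ('p option \<times> enat) topology" where
  "punctured_product P =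
     (let Q = prod_topology (Alexandroff_compactification P) (euclidean :: enat topology)
      in subtopology Q (topspace Q - {(None, \<infinity>)}))"

section \<open>Algebras with involution, unitalization, Hilbert modules\<close>

text \<open>Addition and zero are those of the ambient type, which is of class \<^class>\<open>ab_group_add\<close>
  (for functions: pointwise; for pairs: componentwise).\<close>

record 'a cstar =
  carrier :: "'a set"
  scale :: "complex \<Rightarrow> 'a \<Rightarrow> 'a"
  mul :: "'a \<Rightarrow> 'a \<Rightarrow> 'a"
  adj :: "'a \<Rightarrow> 'a"
  nrm :: "'a \<Rightarrow> real"

definition is_unit_of :: "'a cstar \<Rightarrow> 'a \<Rightarrow> bool" where
  "is_unit_of A e \<longleftrightarrow> e \<in> carrier A \<and> (\<forall>a\<in>carrier A. mul A e a = a \<and> mul A a e = a)"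

definition unital :: "'a cstar \<Rightarrow> bool" where
  "unital A \<longleftrightarrow> (\<exists>e. is_unit_of A e)"

definition unit_of :: "'a cstar \<Rightarrow> 'a" where
  "unit_of A = (THE e. is_unit_of A e)"

definition alg_le :: "('a::ab_group_add) cstar \<Rightarrow> 'a \<Rightarrow> 'a \<Rightarrow> bool" where
  "alg_le A a b \<longleftrightarrow> (\<exists>c\<in>carrier A. b - a = mul A (adj A c) c)"

text \<open>The pair \<open>(a, s)\<close> stands for \<open>a + s 1\<close>, normed as an operator of left multiplication on
  \<open>A\<close>.  A unital \<open>A\<close> is its own unitalization; it appears here as its copy \<open>A \<times> {0}\<close>, on which
  the operator norm is the original norm.\<close>

definition unitalization :: "('a::ab_group_add) cstar \<Rightarrow> ('a \<times> complex) cstar" where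
  "unitalization A =
     \<lparr> carrier = carrier A \<times> (if unital A then {0} else UNIV),
       scale = (\<lambda>c (a, s). (scale A c a, c * s)),
       mul = (\<lambda>(a, s) (b, t). (mul A a b + scale A s b + scale A t a, s * t)),
       adj = (\<lambda>(a, s). (adj A a, cnj s)),
       nrm = (\<lambda>(a, s). SUP b\<in>{b \<in> carrier A. nrm A b \<le> 1}. nrm A (mul A a b + scale A s b)) \<rparr>"

text \<open>Functions are normalized to vanish off the space, so that the supremum over the whole
  type is the supremum norm (also when the space is empty).\<close>

definition C0 :: "'k topology \<Rightarrow> ('k \<Rightarrow> complex) cstar" where
  "C0 K =
     \<lparr> carrier = {f. continuous_map K euclidean f \<and>
                     (\<forall>e>0. compactin K {t \<in> topspace K. e \<le> cmod (f t)}) \<and>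
                     (\<forall>t. t \<notin> topspace K \<longrightarrow> f t = 0)},
       scale = (\<lambda>c f t. c * f t),
       mul = (\<lambda>f g t. f t * g t),
       adj = (\<lambda>f t. cnj (f t)),
       nrm = (\<lambda>f. SUP t. cmod (f t)) \<rparr>"

record ('n, 'a) hilbert_module =
  coeffs :: "'a cstar"
  elems :: "'n set"
  act :: "'n \<Rightarrow> 'a \<Rightarrow> 'n"
  inner_prod :: "'n \<Rightarrow> 'n \<Rightarrow> 'a"

definition self_module :: "('a::ab_group_add) cstar \<Rightarrow> ('a, 'a \<times> complex) hilbert_module" where
  "self_module A =
     \<lparr> coeffs = unitalization A,
       elems = carrier A,
       act = (\<lambda>x (a, s). mul A x a + scale A s x),
       inner_prod = (\<lambda>x y. (mul A (adj A x) y, 0)) \<rparr>"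

section \<open>Hilbert spaces on carrier sets\<close>

text \<open>Inner products are conjugate-linear in the first argument.\<close>

record 'v inner_space =
  vecs :: "'v set"
  smul :: "complex \<Rightarrow> 'v \<Rightarrow> 'v"
  ip :: "'v \<Rightarrow> 'v \<Rightarrow> complex"

definition cauchy_in :: "('v::ab_group_add) inner_space \<Rightarrow> (nat \<Rightarrow> 'v) \<Rightarrow> bool" where
  "cauchy_in V a \<longleftrightarrow> (\<forall>n. a n \<in> vecs V) \<and>
     (\<forall>e>0. \<exists>N. \<forall>m\<ge>N. \<forall>n\<ge>N. Re (ip V (a m - a n) (a m - a n)) < e)"

text \<open>Hausdorff completion of a space with a positive semidefinite inner product, by Cauchy
  sequences modulo null sequences.  The class of a Cauchy sequence \<open>a\<close> is recorded as the functional
  \<open>v \<mapsto> lim\<^sub>n \<langle>v, a\<^sub>n\<rangle>\<close>: two Cauchy sequences differ by a null sequence iff these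
  functionals agree.  In particular the vector space operations on classes are pointwise.\<close>

definition represents :: "('v::ab_group_add) inner_space \<Rightarrow> (nat \<Rightarrow> 'v) \<Rightarrow> ('v \<Rightarrow> complex) \<Rightarrow> bool" where
  "represents V a f \<longleftrightarrow> cauchy_in V a \<and>
     (\<forall>v\<in>vecs V. (\<lambda>n. ip V v (a n)) \<longlonglongrightarrow> f v) \<and> (\<forall>v. v \<notin> vecs V \<longrightarrow> f v = 0)"

definition completion :: "('v::ab_group_add) inner_space \<Rightarrow> ('v \<Rightarrow> complex) inner_space" where
  "completion V =
     \<lparr> vecs = {f. \<exists>a. represents V a f},
       smul = (\<lambda>c f v. c * f v),
       ip = (\<lambda>f g. THE z. \<forall>a b. represents V a f \<longrightarrow> represents V b g \<longrightarrow>
                            (\<lambda>n. ip V (a n) (b n)) \<longlonglongrightarrow> z) \<rparr>"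

definition hilbert_sum :: "'i set \<Rightarrow> ('i \<Rightarrow> ('v::ab_group_add) inner_space) \<Rightarrow> ('i \<Rightarrow> 'v) inner_space" where
  "hilbert_sum I H =
     \<lparr> vecs = {\<xi>. (\<forall>i\<in>I. \<xi> i \<in> vecs (H i)) \<and> (\<forall>i. i \<notin> I \<longrightarrow> \<xi> i = 0) \<and>
                  (\<lambda>i. Re (ip (H i) (\<xi> i) (\<xi> i))) summable_on I},
       smul = (\<lambda>c \<xi> i. if i \<in> I then smul (H i) c (\<xi> i) else 0),
       ip = (\<lambda>\<xi> \<eta>. \<Sum>\<^sub>\<infinity>i\<in>I. ip (H i) (\<xi> i) (\<eta> i)) \<rparr>"

definition bounded_ops :: "('h::ab_group_add) inner_space \<Rightarrow> ('h \<Rightarrow> 'h) set" where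
  "bounded_ops H = {T.
     (\<forall>\<xi>\<in>vecs H. T \<xi> \<in> vecs H) \<and> (\<forall>\<xi>. \<xi> \<notin> vecs H \<longrightarrow> T \<xi> = 0) \<and>
     (\<forall>\<xi>\<in>vecs H. \<forall>\<eta>\<in>vecs H. T (\<xi> + \<eta>) = T \<xi> + T \<eta>) \<and>
     (\<forall>c. \<forall>\<xi>\<in>vecs H. T (smul H c \<xi>) = smul H c (T \<xi>)) \<and>
     (\<exists>C. \<forall>\<xi>\<in>vecs H. sqrt (Re (ip H (T \<xi>) (T \<xi>))) \<le> C * sqrt (Re (ip H \<xi> \<xi>)))}"

definition commutant :: "('h::ab_group_add) inner_space \<Rightarrow> ('h \<Rightarrow> 'h) set \<Rightarrow> ('h \<Rightarrow> 'h) set" where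
  "commutant H S = {T \<in> bounded_ops H. \<forall>U\<in>S. T \<circ> U = U \<circ> T}"

definition op_le :: "('h::ab_group_add) inner_space \<Rightarrow> ('h \<Rightarrow> 'h) \<Rightarrow> ('h \<Rightarrow> 'h) \<Rightarrow> bool" where
  "op_le H S T \<longleftrightarrow> (\<forall>\<xi>\<in>vecs H. ip H \<xi> (T \<xi> - S \<xi>) \<in> \<real>\<^sub>\<ge>\<^sub>0)"

definition square_summable :: "'h inner_space \<Rightarrow> (nat \<Rightarrow> 'h) \<Rightarrow> bool" where
  "square_summable H \<xi> \<longleftrightarrow> (\<forall>n. \<xi> n \<in> vecs H) \<and> summable (\<lambda>n. Re (ip H (\<xi> n) (\<xi> n)))"

text \<open>The coarsest topology on the bounded operators for which all functionals
  \<open>T \<mapsto> \<Sum>\<^sub>n \<langle>\<xi>\<^sub>n, T \<eta>\<^sub>n\<rangle>\<close> with square summable \<open>\<xi>\<close>, \<open>\<eta>\<close> are continuous.\<close>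

definition ultraweak_topology :: "('h::ab_group_add) inner_space \<Rightarrow> ('h \<Rightarrow> 'h) topology" where
  "ultraweak_topology H = topology_generated_by
     {{T \<in> bounded_ops H. (\<Sum>n. ip H (\<xi> n) (T (\<eta> n))) \<in> U} | \<xi> \<eta> U.
        square_summable H \<xi> \<and> square_summable H \<eta> \<and> open U}"

section \<open>Universal representation and enveloping von Neumann algebra of a unital algebra\<close>

definition states :: "('a::ab_group_add) cstar \<Rightarrow> ('a \<Rightarrow> complex) set" where
  "states A = {\<phi>.
     (\<forall>a\<in>carrier A. \<forall>b\<in>carrier A. \<phi> (a + b) = \<phi> a + \<phi> b) \<and>
     (\<forall>c. \<forall>a\<in>carrier A. \<phi> (scale A c a) = c * \<phi> a) \<and>
     (\<forall>a\<in>carrier A. \<phi> (mul A (adj A a) a) \<in> \<real>\<^sub>\<ge>\<^sub>0) \<and>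
     \<phi> (unit_of A) = 1 \<and>
     (\<forall>a. a \<notin> carrier A \<longrightarrow> \<phi> a = 0)}"

definition gns_space :: "('a::ab_group_add) cstar \<Rightarrow> ('a \<Rightarrow> complex) \<Rightarrow> ('a \<Rightarrow> complex) inner_space" where
  "gns_space A \<phi> = completion
     \<lparr> vecs = carrier A, smul = scale A, ip = (\<lambda>a b. \<phi> (mul A (adj A a) b)) \<rparr>"

text \<open>The operator on the completion extending left multiplication by \<open>a\<close>: if the sequence \<open>x\<close>
  represents \<open>f\<close>, then \<open>n \<mapsto> a x\<^sub>n\<close> represents
  \<open>b \<mapsto> lim\<^sub>n \<langle>b, a x\<^sub>n\<rangle> = lim\<^sub>n \<langle>a\<^sup>* b, x\<^sub>n\<rangle> = f (a\<^sup>* b)\<close>.\<close>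

definition gns_rep :: "'a cstar \<Rightarrow> 'a \<Rightarrow> ('a \<Rightarrow> complex) \<Rightarrow> ('a \<Rightarrow> complex)" where
  "gns_rep A a f = (\<lambda>b. if b \<in> carrier A then f (mul A (adj A a) b) else 0)"

definition universal_space :: "('a::ab_group_add) cstar \<Rightarrow> (('a \<Rightarrow> complex) \<Rightarrow> 'a \<Rightarrow> complex) inner_space" where
  "universal_space A = hilbert_sum (states A) (gns_space A)"

definition universal_rep ::
    "('a::ab_group_add) cstar \<Rightarrow> 'a \<Rightarrow> (('a \<Rightarrow> complex) \<Rightarrow> 'a \<Rightarrow> complex) \<Rightarrow> (('a \<Rightarrow> complex) \<Rightarrow> 'a \<Rightarrow> complex)" where
  "universal_rep A a \<xi> =
     (if \<xi> \<in> vecs (universal_space A) then (\<lambda>\<phi>. gns_rep A a (\<xi> \<phi>)) else 0)"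

definition enveloping_vN ::
    "('a::ab_group_add) cstar \<Rightarrow> ((('a \<Rightarrow> complex) \<Rightarrow> 'a \<Rightarrow> complex) \<Rightarrow> (('a \<Rightarrow> complex) \<Rightarrow> 'a \<Rightarrow> complex)) set" where
  "enveloping_vN A =
     commutant (universal_space A) (commutant (universal_space A) (universal_rep A ` carrier A))"

section \<open>Frames\<close>

definition frame_partial_sum ::
    "('n, 'a::ab_group_add) hilbert_module \<Rightarrow> ('j \<Rightarrow> 'n) \<Rightarrow> 'n \<Rightarrow> 'j set \<Rightarrow> 'a" where
  "frame_partial_sum N x y F =
     (\<Sum>j\<in>F. mul (coeffs N) (inner_prod N y (x j)) (inner_prod N (x j) y))"

definition standard_frame ::
    "('n, 'a::ab_group_add) hilbert_module \<Rightarrow> 'j set \<Rightarrow> ('j \<Rightarrow> 'n) \<Rightarrow> bool" where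
  "standard_frame N J x \<longleftrightarrow> (\<forall>j\<in>J. x j \<in> elems N) \<and>
     (\<exists>c1>0. \<exists>c2>0. \<forall>y\<in>elems N. \<exists>s\<in>carrier (coeffs N).
        ((\<lambda>F. nrm (coeffs N) (frame_partial_sum N x y F - s)) \<longlongrightarrow> 0) (finite_subsets_at_top J) \<and>
        alg_le (coeffs N) (scale (coeffs N) (complex_of_real c1) (inner_prod N y y)) s \<and>
        alg_le (coeffs N) s (scale (coeffs N) (complex_of_real c2) (inner_prod N y y)))"

definition nonstandard_frame_bounds ::
    "('n, 'a::ab_group_add) hilbert_module \<Rightarrow> 'j set \<Rightarrow> ('j \<Rightarrow> 'n) \<Rightarrow> real \<Rightarrow> real \<Rightarrow> bool" where
  "nonstandard_frame_bounds N J x c1 c2 \<longleftrightarrow>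
     (let A = coeffs N; H = universal_space A; \<pi> = universal_rep A in
      (\<forall>j\<in>J. x j \<in> elems N) \<and>
      (\<forall>y\<in>elems N. \<exists>T\<in>enveloping_vN A.
         limitin (ultraweak_topology H) (\<lambda>F. \<pi> (frame_partial_sum N x y F)) T
           (finite_subsets_at_top J) \<and>
         op_le H (\<pi> (scale A (complex_of_real c1) (inner_prod N y y))) T \<and>
         op_le H T (\<pi> (scale A (complex_of_real c2) (inner_prod N y y)))))"

definition nonstandard_frame ::
    "('n, 'a::ab_group_add) hilbert_module \<Rightarrow> 'j set \<Rightarrow> ('j \<Rightarrow> 'n) \<Rightarrow> bool" where
  "nonstandard_frame N J x \<longleftrightarrow> (\<exists>c1>0. \<exists>c2>0. nonstandard_frame_bounds N J x c1 c2)"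

text \<open>A frame without further qualification is a non-standard one.\<close>

definition normalized_frame ::
    "('n, 'a::ab_group_add) hilbert_module \<Rightarrow> 'j set \<Rightarrow> ('j \<Rightarrow> 'n) \<Rightarrow> bool" where
  "normalized_frame N J x \<longleftrightarrow> nonstandard_frame_bounds N J x 1 1"

text \<open>Existence of a non-standard frame over some index set.  The index type \<^typ>\<open>'n \<times> nat\<close> is no
  restriction for \<open>C\<^sub>0(K)\<close>: the upper bound forces every nonzero element to occur only finitely often
  in a frame, and zero elements can be dropped.\<close>

definition has_nonstandard_frame :: "('n, 'a::ab_group_add) hilbert_module \<Rightarrow> bool" where
  "has_nonstandard_frame N \<longleftrightarrow> (\<exists>(J :: ('n \<times> nat) set) x. nonstandard_frame N J x)"

end

theory Submission
  imports Defs
begin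

text \<open>A family \<open>x\<^sub>j\<close> in \<open>C\<^sub>0(K)\<close> is a non-standard frame as soon as
  \<open>\<Sum>\<^sub>j \<bar>x\<^sub>j\<bar>\<^sup>2\<close> lies pointwise between two positive constants: the partial sums form a bounded increasing
  net, which converges strongly in the universal representation, and the lower bound survives because, by the
  compactness argument of Dini's theorem, finite partial sums attain it uniformly up to \<open>\<epsilon>\<close>.  Partitions of
  unity on the \<open>\<sigma>\<close>-compact summands, the characteristic functions of the slices \<open>\<alpha>P \<times> {n}\<close>, and the
  functions \<open>(p, k) \<mapsto> x\<^sub>j(p)\<close> for a normalized frame of \<open>C\<^sub>0(P)\<close>
  together have square sums between 1 and 2.

  A standard frame converges uniformly on compact sets.  On the slice \<open>\<alpha>P \<times> {n}\<close> finitely many members carry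
  most of the sum near \<open>(p\<^sub>\<infinity>, n)\<close>, hence off a compact subset of \<open>P\<close>.  For \<open>p\<close> outside the union of these
  subsets, uniform convergence on \<open>{p} \<times> [0, \<omega>\<^sub>0]\<close> makes one of these countably many members nonzero at
  \<open>(p, \<omega>\<^sub>0)\<close>.  As each member vanishes at infinity, \<open>P\<close> would be \<open>\<sigma>\<close>-compact.\<close>

section \<open>Spaces with a positive semidefinite inner product\<close>

text \<open>Ultraweak convergence is proved and used in the concrete universal representation, whose
  Hilbert spaces are carrier sets; hence completions, Hilbert sums and GNS operators have to be
  built before any function appears. Functions and operators meet in two places. Order in the
  unitalization is pointwise positivity on the one-point compactification, which supplies the
  operator bounds; conversely the vector state of a point evaluation turns the ultraweak hypothesis
  on \<open>P\<close> into square sums equal to 1 at every point. Origin of the bounds 1 and 2 on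
  \<open>P2\<close>: the slices contribute 1 off the level \<open>\<infinity>\<close>, the lifted
  frame contributes 1 off the point at infinity of \<open>P\<close>, and the only point where both
  vanish is the removed one. The square sum of this family drops from 2 at \<open>(p, n)\<close> to
  1 at \<open>(p, \<infinity>)\<close>. For a standard frame no such drop can occur, because its
  square sum is continuous on the compact line over \<open>p\<close>; this is what the impossibility
  proof exploits. Since \<open>P\<close> is not \<open>\<sigma>\<close>-compact, it is not compact,
  so the algebras have no unit and the unitalization really adds a point.\<close>

lemma mult_cnj_self: "z * cnj z = of_real ((cmod z)\<^sup>2)"
  using complex_norm_square[of z] by simp

definition ipnorm :: "'v inner_space \<Rightarrow> 'v \<Rightarrow> real" where
  "ipnorm V x = sqrt (Re (ip V x x))"

text \<open>Definiteness is left out because the form that a state induces on the algebra may have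
  null vectors; it only becomes definite on the completion. The laws for \<open>smul\<close> are
  stated through the inner product alone.\<close>

locale semi_inner_space =
  fixes V :: "('v::ab_group_add) inner_space"
  assumes zero_in [simp]: "0 \<in> vecs V"
    and add_in [simp]: "\<And>x y. x \<in> vecs V \<Longrightarrow> y \<in> vecs V \<Longrightarrow> x + y \<in> vecs V"
    and uminus_in [simp]: "\<And>x. x \<in> vecs V \<Longrightarrow> - x \<in> vecs V"
    and smul_in [simp]: "\<And>c x. x \<in> vecs V \<Longrightarrow> smul V c x \<in> vecs V"
    and ip_add_right: "\<And>x y z. x \<in> vecs V \<Longrightarrow> y \<in> vecs V \<Longrightarrow> z \<in> vecs V \<Longrightarrow>
      ip V x (y + z) = ip V x y + ip V x z"
    and ip_smul_right: "\<And>c x y. x \<in> vecs V \<Longrightarrow> y \<in> vecs V \<Longrightarrow> ip V x (smul V c y) = c * ip V x y"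
    and ip_commute: "\<And>x y. x \<in> vecs V \<Longrightarrow> y \<in> vecs V \<Longrightarrow> ip V y x = cnj (ip V x y)"
    and ip_pos: "\<And>x. x \<in> vecs V \<Longrightarrow> 0 \<le> Re (ip V x x)"
begin

abbreviation nm where "nm \<equiv> ipnorm V"

lemma diff_in [simp]: "x \<in> vecs V \<Longrightarrow> y \<in> vecs V \<Longrightarrow> x - y \<in> vecs V"
  using add_in[of x "- y"] by simp

lemma ip_zero_right [simp]: "x \<in> vecs V \<Longrightarrow> ip V x 0 = 0"
  using ip_add_right[of x 0 0] by simp

lemma ip_minus_right: "x \<in> vecs V \<Longrightarrow> y \<in> vecs V \<Longrightarrow> ip V x (- y) = - ip V x y"
  using ip_add_right[of x y "- y"] by (simp add: add_eq_0_iff)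

lemma ip_diff_right:
  "x \<in> vecs V \<Longrightarrow> y \<in> vecs V \<Longrightarrow> z \<in> vecs V \<Longrightarrow> ip V x (y - z) = ip V x y - ip V x z"
  using ip_add_right[of x y "- z"] by (simp add: ip_minus_right)

lemma ip_zero_left [simp]: "x \<in> vecs V \<Longrightarrow> ip V 0 x = 0"
  using ip_commute[of x 0] by simp

lemma ip_add_left:
  "x \<in> vecs V \<Longrightarrow> y \<in> vecs V \<Longrightarrow> z \<in> vecs V \<Longrightarrow> ip V (x + y) z = ip V x z + ip V y z"
  using ip_commute[of z "x + y"] ip_commute[of z x] ip_commute[of z y] by (simp add: ip_add_right)

lemma ip_diff_left:
  "x \<in> vecs V \<Longrightarrow> y \<in> vecs V \<Longrightarrow> z \<in> vecs V \<Longrightarrow> ip V (x - y) z = ip V x z - ip V y z"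
  using ip_commute[of z "x - y"] ip_commute[of z x] ip_commute[of z y] by (simp add: ip_diff_right)

lemma ip_minus_left: "x \<in> vecs V \<Longrightarrow> y \<in> vecs V \<Longrightarrow> ip V (- x) y = - ip V x y"
  using ip_diff_left[of 0 x y] by simp

lemma ip_smul_left: "x \<in> vecs V \<Longrightarrow> y \<in> vecs V \<Longrightarrow> ip V (smul V c x) y = cnj c * ip V x y"
  using ip_commute[of y "smul V c x"] ip_commute[of y x] by (simp add: ip_smul_right)

lemma ipnorm_nonneg [simp]: "x \<in> vecs V \<Longrightarrow> 0 \<le> nm x"
  by (simp add: ipnorm_def ip_pos)

lemma ipnorm_power2: "x \<in> vecs V \<Longrightarrow> (nm x)\<^sup>2 = Re (ip V x x)"
  by (simp add: ipnorm_def ip_pos)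

lemma ip_self: "x \<in> vecs V \<Longrightarrow> ip V x x = of_real ((nm x)\<^sup>2)"
  using ip_commute[of x x] by (simp add: ipnorm_power2 complex_eq_iff)

lemma ipnorm_zero [simp]: "nm 0 = 0"
  by (simp add: ipnorm_def)

lemma ipnorm_minus: "x \<in> vecs V \<Longrightarrow> nm (- x) = nm x"
  by (simp add: ipnorm_def ip_minus_left ip_minus_right)

lemma ipnorm_diff_commute: "x \<in> vecs V \<Longrightarrow> y \<in> vecs V \<Longrightarrow> nm (x - y) = nm (y - x)"
  using ipnorm_minus[of "x - y"] by simp

lemma ipnorm_smul: "x \<in> vecs V \<Longrightarrow> nm (smul V c x) = cmod c * nm x"
proof -
  assume x: "x \<in> vecs V"
  have "ip V (smul V c x) (smul V c x) = (cnj c * c) * ip V x x"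
    using x by (simp add: ip_smul_left ip_smul_right)
  also have "\<dots> = of_real ((cmod c * nm x)\<^sup>2)"
    using x by (simp add: ip_self power_mult_distrib mult_cnj_self mult.commute[of "cnj c"])
  finally show ?thesis
    using x by (simp add: ipnorm_def ip_pos del: of_real_power of_real_mult)
qed

lemma Cauchy_Schwarz:
  assumes x: "x \<in> vecs V" and y: "y \<in> vecs V"
  shows "cmod (ip V x y) \<le> nm x * nm y"
proof -
  define m where "m = cmod (ip V x y)"
  have m0: "0 \<le> m" by (simp add: m_def)
  \<comment> \<open>Expansion of the square of \<open>x - c y\<close>; the factor
    \<open>cnj (ip V x y)\<close> in \<open>c\<close> turns both cross terms into the same real
    number.\<close>
  have key: "2 * t * m\<^sup>2 \<le> (nm x)\<^sup>2 + t\<^sup>2 * m\<^sup>2 * (nm y)\<^sup>2" for t :: real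
  proof -
    define c where "c = of_real t * cnj (ip V x y)"
    have "0 \<le> Re (ip V (x - smul V c y) (x - smul V c y))"
      using x y by (simp add: ip_pos)
    also have "ip V (x - smul V c y) (x - smul V c y)
        = ip V x x - c * ip V x y - cnj c * ip V y x + cnj c * c * ip V y y"
      using x y by (simp add: ip_diff_left ip_diff_right ip_smul_left ip_smul_right algebra_simps)
    also have "ip V y x = cnj (ip V x y)" using x y by (rule ip_commute)
    also have "c * ip V x y = of_real (t * m\<^sup>2)"
      by (simp add: c_def m_def mult_cnj_self mult.commute[of "cnj _"])
    also have "cnj c * cnj (ip V x y) = of_real (t * m\<^sup>2)"
      by (simp add: c_def m_def mult_cnj_self)
    also have "cnj c * c = of_real (t\<^sup>2 * m\<^sup>2)"
      by (simp add: c_def m_def mult_cnj_self power2_eq_square flip: mult.assoc)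
    finally show ?thesis
      using x y by (simp add: ip_self del: of_real_power of_real_mult flip: of_real_power of_real_mult)
  qed
  show ?thesis
  proof (cases "m = 0")
    case True
    then show ?thesis using x y by (simp add: m_def)
  next
    case False
    then have mp: "m\<^sup>2 > 0" using m0 by simp
    have "m\<^sup>2 \<le> (nm x)\<^sup>2 * (nm y)\<^sup>2"
    proof (cases "nm y = 0")
      case True
      \<comment> \<open>Null vectors \<open>y\<close> need their own argument: \<open>key\<close>
        has no quadratic term now, and this \<open>t\<close> makes its left side
        \<open>(nm x)^2 + 1\<close>, so the case is contradictory.\<close>
      have "2 * (((nm x)\<^sup>2 + 1) / (2 * m\<^sup>2)) * m\<^sup>2 \<le> (nm x)\<^sup>2"
        using key[of "((nm x)\<^sup>2 + 1) / (2 * m\<^sup>2)"] True by simp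
      then show ?thesis using mp by simp
    next
      case y0: False
      \<comment> \<open>The minimising parameter of the quadratic inequality
        \<open>key\<close>.\<close>
      have "2 * (1 / (nm y)\<^sup>2) * m\<^sup>2
          \<le> (nm x)\<^sup>2 + (1 / (nm y)\<^sup>2)\<^sup>2 * m\<^sup>2 * (nm y)\<^sup>2"
        by (rule key)
      also have "(1 / (nm y)\<^sup>2)\<^sup>2 * m\<^sup>2 * (nm y)\<^sup>2 = m\<^sup>2 / (nm y)\<^sup>2"
        using y0 by (simp add: power2_eq_square field_simps)
      finally have "m\<^sup>2 / (nm y)\<^sup>2 \<le> (nm x)\<^sup>2" by simp
      then show ?thesis using y0 by (simp add: divide_le_eq)
    qed
    then have "m\<^sup>2 \<le> (nm x * nm y)\<^sup>2" by (simp add: power_mult_distrib)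
    then show ?thesis using x y by (auto simp: m_def intro: power2_le_imp_le)
  qed
qed

lemma ipnorm_triangle:
  assumes x: "x \<in> vecs V" and y: "y \<in> vecs V"
  shows "nm (x + y) \<le> nm x + nm y"
proof -
  have "(nm (x + y))\<^sup>2 = Re (ip V x x) + Re (ip V x y) + Re (ip V y x) + Re (ip V y y)"
    using x y by (simp add: ipnorm_power2 ip_add_left ip_add_right)
  also have "\<dots> \<le> (nm x)\<^sup>2 + 2 * (nm x * nm y) + (nm y)\<^sup>2"
    using Cauchy_Schwarz[OF x y] complex_Re_le_cmod[of "ip V x y"] ip_commute[OF x y] x y
    by (simp add: ipnorm_power2)
  also have "\<dots> = (nm x + nm y)\<^sup>2" by (simp add: power2_sum)
  finally show ?thesis using x y by (auto intro: power2_le_imp_le)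
qed

lemma ipnorm_triangle_diff:
  assumes "x \<in> vecs V" "y \<in> vecs V" "z \<in> vecs V"
  shows "nm (x - z) \<le> nm (x - y) + nm (y - z)"
  using ipnorm_triangle[of "x - y" "y - z"] assms by simp

lemma ipnorm_reverse_triangle:
  assumes "x \<in> vecs V" "y \<in> vecs V"
  shows "\<bar>nm x - nm y\<bar> \<le> nm (x - y)"
  using ipnorm_triangle[of "x - y" y] ipnorm_triangle[of "y - x" x] ipnorm_diff_commute[of x y] assms
  by simp

lemma ip_diff_bound:
  assumes "x \<in> vecs V" "x' \<in> vecs V" "y \<in> vecs V" "y' \<in> vecs V"
  shows "cmod (ip V x y - ip V x' y') \<le> nm (x - x') * nm y + nm x' * nm (y - y')"
proof -
  have "ip V x y - ip V x' y' = ip V (x - x') y + ip V x' (y - y')"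
    using assms by (simp add: ip_diff_left ip_diff_right)
  then show ?thesis
    using Cauchy_Schwarz[of "x - x'" y] Cauchy_Schwarz[of x' "y - y'"] assms
    by (smt (verit) diff_in norm_triangle_ineq)
qed

lemma cauchy_in_iff:
  "cauchy_in V a \<longleftrightarrow> (\<forall>n. a n \<in> vecs V) \<and>
     (\<forall>e>0. \<exists>N. \<forall>m\<ge>N. \<forall>n\<ge>N. nm (a m - a n) < e)"
proof (cases "\<forall>n. a n \<in> vecs V")
  case True
  have sq: "Re (ip V (a m - a n) (a m - a n)) < e\<^sup>2 \<longleftrightarrow> nm (a m - a n) < e" if "e > 0" for m n e
    using True that
    by (metis diff_in ipnorm_nonneg ipnorm_power2 less_imp_le pos2 power_less_imp_less_base power_strict_mono)
  show ?thesis
  proof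
    assume L: "cauchy_in V a"
    have "\<exists>N. \<forall>m\<ge>N. \<forall>n\<ge>N. nm (a m - a n) < e" if "e > 0" for e :: real
      using L that sq[OF that] unfolding cauchy_in_def by (metis zero_less_power)
    then show "(\<forall>n. a n \<in> vecs V) \<and> (\<forall>e>0. \<exists>N. \<forall>m\<ge>N. \<forall>n\<ge>N. nm (a m - a n) < e)"
      using True by blast
  next
    assume R: "(\<forall>n. a n \<in> vecs V) \<and> (\<forall>e>0. \<exists>N. \<forall>m\<ge>N. \<forall>n\<ge>N. nm (a m - a n) < e)"
    have "\<exists>N. \<forall>m\<ge>N. \<forall>n\<ge>N. Re (ip V (a m - a n) (a m - a n)) < e" if "e > 0" for e :: real
      using R that sq[of "sqrt e"] by (metis less_imp_le real_sqrt_gt_zero real_sqrt_pow2)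
    then show "cauchy_in V a" using True by (simp add: cauchy_in_def)
  qed
qed (auto simp: cauchy_in_def)

lemma cauchy_in_bounded:
  assumes "cauchy_in V a"
  obtains B where "0 < B" "\<And>n. nm (a n) \<le> B"
proof -
  have a: "\<And>n. a n \<in> vecs V" using assms by (simp add: cauchy_in_def)
  obtain N where N: "\<And>m n. m \<ge> N \<Longrightarrow> n \<ge> N \<Longrightarrow> nm (a m - a n) < 1"
    using assms unfolding cauchy_in_iff by (meson zero_less_one)
  define B where "B = 1 + nm (a N) + (\<Sum>n<N. nm (a n))"
  have s0: "0 \<le> (\<Sum>n<N. nm (a n))" by (intro sum_nonneg) (simp add: a)
  show thesis
  proof
    show "0 < B" using s0 ipnorm_nonneg[OF a[of N]] by (simp add: B_def)
    show "nm (a n) \<le> B" for n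
    proof (cases "n < N")
      case True
      then have "nm (a n) \<le> (\<Sum>n<N. nm (a n))"
        by (intro member_le_sum) (auto simp: a)
      then show ?thesis using ipnorm_nonneg[OF a[of N]] by (simp add: B_def)
    next
      case False
      then show ?thesis
        using N[of n N] ipnorm_reverse_triangle[OF a a, of n N] s0 by (simp add: B_def)
    qed
  qed
qed

lemma ip_tendsto_0:
  assumes a: "\<And>n. a n \<in> vecs V" and b: "\<And>n. b n \<in> vecs V"
    and B: "\<And>n. nm (a n) \<le> B" and lim: "((\<lambda>n. nm (b n)) \<longlongrightarrow> 0) F"
  shows "((\<lambda>n. ip V (a n) (b n)) \<longlongrightarrow> 0) F"
proof (rule Lim_null_comparison)
  show "\<forall>\<^sub>F n in F. norm (ip V (a n) (b n)) \<le> B * nm (b n)"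
    using order.trans[OF Cauchy_Schwarz[OF a b] mult_right_mono[OF B ipnorm_nonneg[OF b]]]
    by (auto intro!: always_eventually)
  show "((\<lambda>n. B * nm (b n)) \<longlongrightarrow> 0) F"
    using tendsto_mult_right_zero[OF lim] by simp
qed

lemma cauchy_in_diff:
  assumes "cauchy_in V a" "cauchy_in V b"
  shows "cauchy_in V (\<lambda>n. a n - b n)"
  unfolding cauchy_in_iff
proof (intro conjI allI impI)
  show in_V: "a n - b n \<in> vecs V" for n using assms by (simp add: cauchy_in_def)
  fix e :: real assume "e > 0"
  then obtain N M where N: "\<And>m n. m \<ge> N \<Longrightarrow> n \<ge> N \<Longrightarrow> nm (a m - a n) < e / 2"
    and M: "\<And>m n. m \<ge> M \<Longrightarrow> n \<ge> M \<Longrightarrow> nm (b m - b n) < e / 2"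
    using assms unfolding cauchy_in_iff by (meson half_gt_zero)
  have "nm (a m - b m - (a n - b n)) < e" if "m \<ge> max N M" "n \<ge> max N M" for m n
  proof -
    have "a m - b m - (a n - b n) = (a m - a n) + (b n - b m)" by simp
    then have "nm (a m - b m - (a n - b n)) \<le> nm (a m - a n) + nm (b n - b m)"
      using assms by (metis cauchy_in_def diff_in ipnorm_triangle)
    then show ?thesis using N[of m n] M[of n m] that by simp
  qed
  then show "\<exists>N. \<forall>m\<ge>N. \<forall>n\<ge>N. nm (a m - b m - (a n - b n)) < e" by blast
qed

lemma cauchy_in_const: "v \<in> vecs V \<Longrightarrow> cauchy_in V (\<lambda>n. v)"
  by (simp add: cauchy_in_iff)

lemma cauchy_in_add:
  assumes "cauchy_in V a" "cauchy_in V b"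
  shows "cauchy_in V (\<lambda>n. a n + b n)"
  using cauchy_in_diff[OF assms(1) cauchy_in_diff[OF cauchy_in_const[OF zero_in] assms(2)]] by simp

lemma cauchy_in_image:
  assumes a: "cauchy_in V a" and T: "\<And>x. x \<in> vecs V \<Longrightarrow> T x \<in> vecs V"
    and C: "\<And>x y. x \<in> vecs V \<Longrightarrow> y \<in> vecs V \<Longrightarrow> nm (T x - T y) \<le> C * nm (x - y)"
  shows "cauchy_in V (\<lambda>n. T (a n))"
  unfolding cauchy_in_iff
proof (intro conjI allI impI)
  have in_V: "a n \<in> vecs V" for n using a by (simp add: cauchy_in_def)
  then show "T (a n) \<in> vecs V" for n by (rule T)
  fix e :: real assume e: "e > 0"
  \<comment> \<open>The sign of \<open>C\<close> is not known, so \<open>\<bar>C\<bar> + 1\<close>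
    serves as a positive Lipschitz constant.\<close>
  then have "0 < e / (\<bar>C\<bar> + 1)" by simp
  then obtain N where N: "\<And>m n. m \<ge> N \<Longrightarrow> n \<ge> N \<Longrightarrow> nm (a m - a n) < e / (\<bar>C\<bar> + 1)"
    using a unfolding cauchy_in_iff by meson
  have "nm (T (a m) - T (a n)) < e" if "m \<ge> N" "n \<ge> N" for m n
  proof -
    have "nm (T (a m) - T (a n)) \<le> C * nm (a m - a n)" by (rule C[OF in_V in_V])
    also have "\<dots> \<le> (\<bar>C\<bar> + 1) * nm (a m - a n)" by (intro mult_right_mono) (auto simp: in_V)
    also have "\<dots> < e" using N[OF that] by (simp add: pos_less_divide_eq mult.commute)
    finally show ?thesis .
  qed
  then show "\<exists>N. \<forall>m\<ge>N. \<forall>n\<ge>N. nm (T (a m) - T (a n)) < e" by blast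
qed

end

locale hilbert_space = semi_inner_space H for H :: "('h::ab_group_add) inner_space" +
  assumes definite: "\<And>x. x \<in> vecs H \<Longrightarrow> ipnorm H x = 0 \<Longrightarrow> x = 0"
    and complete: "\<And>a. cauchy_in H a \<Longrightarrow> \<exists>x\<in>vecs H. (\<lambda>n. ipnorm H (a n - x)) \<longlonglongrightarrow> 0"

section \<open>Completion\<close>

context semi_inner_space
begin

lemma representsD:
  assumes "represents V a f"
  shows "cauchy_in V a" "a n \<in> vecs V" "v \<in> vecs V \<Longrightarrow> (\<lambda>n. ip V v (a n)) \<longlonglongrightarrow> f v"
    "v \<notin> vecs V \<Longrightarrow> f v = 0"
  using assms by (auto simp: represents_def cauchy_in_def)

lemma ip_cauchy_convergent:
  assumes a: "cauchy_in V a" and b: "cauchy_in V b"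
  shows "convergent (\<lambda>n. ip V (a n) (b n))"
proof -
  have av: "\<And>n. a n \<in> vecs V" and bv: "\<And>n. b n \<in> vecs V" using a b by (auto simp: cauchy_in_def)
  obtain A B where A: "0 < A" "\<And>n. nm (a n) \<le> A" and B: "0 < B" "\<And>n. nm (b n) \<le> B"
    using a b by (metis cauchy_in_bounded)
  have "Cauchy (\<lambda>n. ip V (a n) (b n))"
    unfolding Cauchy_def dist_norm
  proof (intro allI impI)
    fix e :: real assume e: "e > 0"
    then have "0 < e / (2 * B)" "0 < e / (2 * A)" using A B by auto
    then obtain N M where N: "\<And>m n. m \<ge> N \<Longrightarrow> n \<ge> N \<Longrightarrow> nm (a m - a n) < e / (2 * B)"
      and M: "\<And>m n. m \<ge> M \<Longrightarrow> n \<ge> M \<Longrightarrow> nm (b m - b n) < e / (2 * A)"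
      using a b unfolding cauchy_in_iff by meson
    have "cmod (ip V (a m) (b m) - ip V (a n) (b n)) < e" if "m \<ge> max N M" "n \<ge> max N M" for m n
    proof -
      have "cmod (ip V (a m) (b m) - ip V (a n) (b n))
          \<le> nm (a m - a n) * nm (b m) + nm (a n) * nm (b m - b n)"
        by (rule ip_diff_bound) (auto simp: av bv)
      also have "\<dots> \<le> nm (a m - a n) * B + A * nm (b m - b n)"
        by (intro add_mono mult_left_mono mult_right_mono A B ipnorm_nonneg) (auto simp: av bv)
      also have "\<dots> < e / (2 * B) * B + A * (e / (2 * A))"
        using N[of m n] M[of m n] that A B
        by (intro add_strict_mono mult_strict_right_mono mult_strict_left_mono) auto
      also have "\<dots> = e" using A B by simp
      finally show ?thesis .
    qed
    then show "\<exists>M. \<forall>m\<ge>M. \<forall>n\<ge>M. cmod (ip V (a m) (b m) - ip V (a n) (b n)) < e" by blast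
  qed
  then show ?thesis by (simp add: Cauchy_convergent)
qed

text \<open>The difference is the limit over \<open>m\<close> of
  \<open>ip V (a n) (b n - b m)\<close>, which is small uniformly because \<open>a\<close> is
  bounded and \<open>b\<close> is Cauchy. Hence the pairing depends on \<open>b\<close> only through
  its functional \<open>g\<close>.\<close>

lemma represents_pairing:
  assumes a: "represents V a f" and b: "represents V b g"
  shows "(\<lambda>n. ip V (a n) (b n) - g (a n)) \<longlonglongrightarrow> 0"
proof (rule LIMSEQ_I)
  note av = representsD(2)[OF a] and bv = representsD(2)[OF b]
  fix e :: real assume e: "e > 0"
  obtain A where A: "0 < A" "\<And>n. nm (a n) \<le> A"
    using cauchy_in_bounded[OF representsD(1)[OF a]] by metis
  have "0 < e / (2 * A)" using A e by simp
  then obtain N where N: "\<And>m n. m \<ge> N \<Longrightarrow> n \<ge> N \<Longrightarrow> nm (b m - b n) < e / (2 * A)"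
    using representsD(1)[OF b] unfolding cauchy_in_iff by meson
  have "cmod (ip V (a n) (b n) - g (a n)) \<le> e / 2" if n: "n \<ge> N" for n
  proof (rule tendsto_upperbound)
    show "(\<lambda>m. cmod (ip V (a n) (b n) - ip V (a n) (b m))) \<longlonglongrightarrow> cmod (ip V (a n) (b n) - g (a n))"
      by (intro tendsto_intros representsD(3)[OF b] av)
    show "\<forall>\<^sub>F m in sequentially. cmod (ip V (a n) (b n) - ip V (a n) (b m)) \<le> e / 2"
      unfolding eventually_sequentially
    proof (intro exI allI impI)
      fix m assume m: "N \<le> m"
      have "cmod (ip V (a n) (b n) - ip V (a n) (b m)) = cmod (ip V (a n) (b n - b m))"
        by (simp add: ip_diff_right av bv)
      also have "\<dots> \<le> nm (a n) * nm (b n - b m)"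
        by (intro Cauchy_Schwarz) (auto simp: av bv)
      also have "\<dots> \<le> A * (e / (2 * A))"
        using N[OF n m] A by (intro mult_mono) (auto simp: av bv)
      also have "\<dots> = e / 2" using A by simp
      finally show "cmod (ip V (a n) (b n) - ip V (a n) (b m)) \<le> e / 2" .
    qed
  qed simp
  then show "\<exists>N. \<forall>n\<ge>N. norm (ip V (a n) (b n) - g (a n) - 0) < e"
    using e by (metis diff_zero field_sum_of_halves less_add_same_cancel1 half_gt_zero order_le_less_trans)
qed

text \<open>This justifies the definite description in \<open>completion\<close>. Representatives
  are exchanged one at a time: \<open>b\<close> by \<open>d\<close> with \<open>a\<close> fixed,
  since both pairings are asymptotic to \<open>g (a n)\<close>, and then, after conjugation,
  \<open>a\<close> by \<open>c\<close>.\<close>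

lemma ip_completion_tendsto:
  assumes a: "represents V a f" and b: "represents V b g"
  shows "(\<lambda>n. ip V (a n) (b n)) \<longlonglongrightarrow> ip (completion V) f g"
proof -
  have change: "(\<lambda>n. ip V (c n) (d n)) \<longlonglongrightarrow> z"
    if z: "(\<lambda>n. ip V (a n) (b n)) \<longlonglongrightarrow> z" and c: "represents V c f" and d: "represents V d g" for c d z
  proof -
    have 1: "(\<lambda>n. ip V (a n) (d n)) \<longlonglongrightarrow> z"
      using tendsto_add[OF tendsto_diff[OF represents_pairing[OF a d] represents_pairing[OF a b]] z]
      by simp
    have "(\<lambda>n. cnj (ip V (a n) (d n))) \<longlonglongrightarrow> cnj z" by (intro tendsto_intros 1)
    then have 2: "(\<lambda>n. ip V (d n) (a n)) \<longlonglongrightarrow> cnj z"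
      by (simp add: ip_commute[OF representsD(2)[OF a] representsD(2)[OF d]])
    have "(\<lambda>n. ip V (d n) (c n)) \<longlonglongrightarrow> cnj z"
      using tendsto_add[OF tendsto_diff[OF represents_pairing[OF d c] represents_pairing[OF d a]] 2]
      by simp
    then have "(\<lambda>n. cnj (ip V (d n) (c n))) \<longlonglongrightarrow> cnj (cnj z)" by (intro tendsto_intros)
    then show ?thesis
      by (simp add: ip_commute[OF representsD(2)[OF d] representsD(2)[OF c]])
  qed
  obtain z where z: "(\<lambda>n. ip V (a n) (b n)) \<longlonglongrightarrow> z"
    using ip_cauchy_convergent[OF representsD(1)[OF a] representsD(1)[OF b]]
    by (auto simp: convergent_def)
  have "ip (completion V) f g = z"
    unfolding completion_def inner_space.simps
    by (rule the_equality) (use change[OF z] z a b LIMSEQ_unique in blast)+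
  then show ?thesis using z by simp
qed

lemma ipnorm_completion_tendsto:
  assumes "represents V a f"
  shows "(\<lambda>n. nm (a n)) \<longlonglongrightarrow> ipnorm (completion V) f"
  unfolding ipnorm_def by (intro tendsto_intros ip_completion_tendsto assms)

lemma in_completion_iff: "f \<in> vecs (completion V) \<longleftrightarrow> (\<exists>a. represents V a f)"
  by (simp add: completion_def)

lemma represents_add:
  assumes "represents V a f" "represents V b g"
  shows "represents V (\<lambda>n. a n + b n) (f + g)"
  using representsD[OF assms(1)] representsD[OF assms(2)] unfolding represents_def
  by (auto simp: cauchy_in_add ip_add_right intro: tendsto_add)

lemma represents_diff:
  assumes "represents V a f" "represents V b g"
  shows "represents V (\<lambda>n. a n - b n) (f - g)"
  using representsD[OF assms(1)] representsD[OF assms(2)] unfolding represents_def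
  by (auto simp: cauchy_in_diff ip_diff_right intro: tendsto_diff)

text \<open>The class of a constant sequence, that is, the canonical isometric map into the
  completion.\<close>

definition embed :: "'v \<Rightarrow> 'v \<Rightarrow> complex" where
  "embed v = (\<lambda>b. if b \<in> vecs V then ip V b v else 0)"

lemma represents_embed: "v \<in> vecs V \<Longrightarrow> represents V (\<lambda>n. v) (embed v)"
  by (auto simp: represents_def embed_def cauchy_in_const)

lemma represents_zero: "represents V (\<lambda>n. 0) 0"
  by (auto simp: represents_def cauchy_in_const)

text \<open>An operator with adjoint \<open>S\<close> moves to the completion by composing
  functionals with \<open>S\<close>; \<open>gns_rep\<close> has exactly this form.\<close>

lemma represents_image:
  assumes a: "represents V a f" and T: "\<And>x. x \<in> vecs V \<Longrightarrow> T x \<in> vecs V"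
    and S: "\<And>x. x \<in> vecs V \<Longrightarrow> S x \<in> vecs V"
    and adj: "\<And>x y. x \<in> vecs V \<Longrightarrow> y \<in> vecs V \<Longrightarrow> ip V y (T x) = ip V (S y) x"
    and C: "\<And>x y. x \<in> vecs V \<Longrightarrow> y \<in> vecs V \<Longrightarrow> nm (T x - T y) \<le> C * nm (x - y)"
  shows "represents V (\<lambda>n. T (a n)) (\<lambda>b. if b \<in> vecs V then f (S b) else 0)"
proof -
  have "cauchy_in V (\<lambda>n. T (a n))" using representsD(1)[OF a] T C by (rule cauchy_in_image)
  moreover have "(\<lambda>n. ip V v (T (a n))) \<longlonglongrightarrow> f (S v)" if "v \<in> vecs V" for v
    using representsD(3)[OF a S[OF that]] by (simp add: adj[OF representsD(2)[OF a] that])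
  ultimately show ?thesis by (simp add: represents_def)
qed

lemma represents_smul:
  assumes a: "represents V a f"
  shows "represents V (\<lambda>n. smul V c (a n)) (smul (completion V) c f)"
proof -
  have "cauchy_in V (\<lambda>n. smul V c (a n))"
  proof (rule cauchy_in_image[OF representsD(1)[OF a]])
    fix x y assume xy: "x \<in> vecs V" "y \<in> vecs V"
    \<comment> \<open>No distributive law for \<open>smul\<close> is available, so the norm of this
      difference is computed from inner products.\<close>
    define u where "u = smul V c x - smul V c y"
    have "u \<in> vecs V" using xy by (simp add: u_def)
    have "ip V u u = cnj c * c * ip V (x - y) (x - y)"
      using xy by (simp add: u_def ip_diff_left ip_diff_right ip_smul_left ip_smul_right algebra_simps)
    also have "\<dots> = of_real ((cmod c)\<^sup>2) * ip V (x - y) (x - y)"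
      by (metis mult.commute mult_cnj_self)
    finally have "nm u = cmod c * nm (x - y)"
      by (simp add: ipnorm_def real_sqrt_mult del: of_real_power)
    then show "nm (smul V c x - smul V c y) \<le> cmod c * nm (x - y)" by (simp add: u_def)
  qed simp
  then show ?thesis
    using representsD[OF a] unfolding represents_def completion_def
    by (auto simp: ip_smul_right intro: tendsto_mult_left)
qed

lemma ipnorm_embed: "v \<in> vecs V \<Longrightarrow> ipnorm (completion V) (embed v) = nm v"
  using ipnorm_completion_tendsto[OF represents_embed] LIMSEQ_unique tendsto_const by blast

lemma ip_completion_embed:
  "v \<in> vecs V \<Longrightarrow> w \<in> vecs V \<Longrightarrow> ip (completion V) (embed v) (embed w) = ip V v w"
  using ip_completion_tendsto[OF represents_embed represents_embed] LIMSEQ_unique tendsto_const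
  by blast

lemma embed_in: "v \<in> vecs V \<Longrightarrow> embed v \<in> vecs (completion V)"
  using represents_embed in_completion_iff by blast

lemma embed_diff: "v \<in> vecs V \<Longrightarrow> w \<in> vecs V \<Longrightarrow> embed (v - w) = embed v - embed w"
  by (auto simp: embed_def ip_diff_right)

text \<open>The distance from \<open>f\<close> to \<open>embed (a n)\<close> is the limit over
  \<open>m\<close> of the norm of \<open>a m - a n\<close>. This is density of \<open>V\<close> in
  its completion.\<close>

lemma represents_approx:
  assumes a: "represents V a f"
  shows "(\<lambda>n. ipnorm (completion V) (f - embed (a n))) \<longlonglongrightarrow> 0"
proof (rule LIMSEQ_I)
  note av = representsD(2)[OF a]
  fix e :: real assume e: "e > 0"
  then obtain N where N: "\<And>m n. m \<ge> N \<Longrightarrow> n \<ge> N \<Longrightarrow> nm (a m - a n) < e / 2"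
    using representsD(1)[OF a] unfolding cauchy_in_iff by (meson half_gt_zero)
  have "ipnorm (completion V) (f - embed (a n)) \<in> {0..e / 2}" if n: "n \<ge> N" for n
  proof -
    have "(\<lambda>m. nm (a m - a n)) \<longlonglongrightarrow> ipnorm (completion V) (f - embed (a n))"
      by (intro ipnorm_completion_tendsto represents_diff a represents_embed av)
    moreover have "\<forall>\<^sub>F m in sequentially. nm (a m - a n) \<in> {0..e / 2}"
      unfolding eventually_sequentially using N[OF _ n] by (intro exI[of _ N]) (auto simp: av less_imp_le)
    ultimately show ?thesis
      by (rule Lim_in_closed_set[OF closed_atLeastAtMost, rotated 2]) simp
  qed
  then show "\<exists>N. \<forall>n\<ge>N. norm (ipnorm (completion V) (f - embed (a n)) - 0) < e"
    using e by (fastforce intro!: exI[of _ N])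
qed

lemma semi_inner_space_completion: "semi_inner_space (completion V)"
proof
  show "0 \<in> vecs (completion V)" using represents_zero in_completion_iff by blast
  show "f + g \<in> vecs (completion V)" if "f \<in> vecs (completion V)" "g \<in> vecs (completion V)" for f g
    using that represents_add unfolding in_completion_iff by blast
  show "- f \<in> vecs (completion V)" if "f \<in> vecs (completion V)" for f
    using that represents_diff[OF represents_zero] unfolding in_completion_iff by fastforce
  show "smul (completion V) c f \<in> vecs (completion V)" if "f \<in> vecs (completion V)" for c f
    using that represents_smul unfolding in_completion_iff by blast
  show "ip (completion V) f (g + h) = ip (completion V) f g + ip (completion V) f h"
    if fgh: "f \<in> vecs (completion V)" "g \<in> vecs (completion V)" "h \<in> vecs (completion V)" for f g h
  proof -
    obtain a b c where r: "represents V a f" "represents V b g" "represents V c h"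
      using fgh unfolding in_completion_iff by blast
    note rv = representsD(2)[OF r(1)] representsD(2)[OF r(2)] representsD(2)[OF r(3)]
    have "(\<lambda>n. ip V (a n) (b n) + ip V (a n) (c n)) \<longlonglongrightarrow> ip (completion V) f (g + h)"
      using ip_completion_tendsto[OF r(1) represents_add[OF r(2,3)]] by (simp add: ip_add_right rv)
    moreover have "(\<lambda>n. ip V (a n) (b n) + ip V (a n) (c n)) \<longlonglongrightarrow> ip (completion V) f g + ip (completion V) f h"
      by (intro tendsto_intros ip_completion_tendsto r)
    ultimately show ?thesis by (rule LIMSEQ_unique)
  qed
  show "ip (completion V) f (smul (completion V) c g) = c * ip (completion V) f g"
    if fg: "f \<in> vecs (completion V)" "g \<in> vecs (completion V)" for c f g
  proof -
    obtain a b where r: "represents V a f" "represents V b g"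
      using fg unfolding in_completion_iff by blast
    note rv = representsD(2)[OF r(1)] representsD(2)[OF r(2)]
    have "(\<lambda>n. c * ip V (a n) (b n)) \<longlonglongrightarrow> ip (completion V) f (smul (completion V) c g)"
      using ip_completion_tendsto[OF r(1) represents_smul[OF r(2)]] by (simp add: ip_smul_right rv)
    moreover have "(\<lambda>n. c * ip V (a n) (b n)) \<longlonglongrightarrow> c * ip (completion V) f g"
      by (intro tendsto_intros ip_completion_tendsto r)
    ultimately show ?thesis by (rule LIMSEQ_unique)
  qed
  show "ip (completion V) g f = cnj (ip (completion V) f g)"
    if fg: "f \<in> vecs (completion V)" "g \<in> vecs (completion V)" for f g
  proof -
    obtain a b where r: "represents V a f" "represents V b g"
      using fg unfolding in_completion_iff by blast
    have "(\<lambda>n. ip V (b n) (a n)) \<longlonglongrightarrow> cnj (ip (completion V) f g)"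
      using tendsto_cnj[OF ip_completion_tendsto[OF r]]
      by (simp add: ip_commute[OF representsD(2)[OF r(1)] representsD(2)[OF r(2)]])
    then show ?thesis using ip_completion_tendsto[OF r(2,1)] LIMSEQ_unique by blast
  qed
  show "0 \<le> Re (ip (completion V) f f)" if "f \<in> vecs (completion V)" for f
  proof -
    obtain a where r: "represents V a f" using \<open>f \<in> vecs (completion V)\<close> unfolding in_completion_iff by blast
    show ?thesis
      using tendsto_Re[OF ip_completion_tendsto[OF r r]] ip_pos[OF representsD(2)[OF r]]
      by (intro tendsto_lowerbound[where F = sequentially]) auto
  qed
qed

lemma hilbert_space_completion: "hilbert_space (completion V)"
proof -
  interpret C: semi_inner_space "completion V" by (rule semi_inner_space_completion)
  show ?thesis
  proof
    fix f assume f: "f \<in> vecs (completion V)" and 0: "ipnorm (completion V) f = 0"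
    then obtain a where r: "represents V a f" unfolding in_completion_iff by blast
    have "(\<lambda>n. nm (a n)) \<longlonglongrightarrow> 0" using ipnorm_completion_tendsto[OF r] 0 by simp
    then have "(\<lambda>n. ip V v (a n)) \<longlonglongrightarrow> 0" if "v \<in> vecs V" for v
      using ip_tendsto_0[of "\<lambda>n. v" a "nm v"] that representsD(2)[OF r] by simp
    then have "f v = 0" for v
      using representsD(3,4)[OF r] LIMSEQ_unique by (cases "v \<in> vecs V") blast+
    then show "f = 0" by auto
  next
    fix F assume F: "cauchy_in (completion V) F"
    then have Fv: "F k \<in> vecs (completion V)" for k by (simp add: cauchy_in_def)
    \<comment> \<open>Diagonal choice: each \<open>F k\<close> is replaced by a vector of
      \<open>V\<close> at distance less than \<open>1 / (k + 1)\<close>; the functional of that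
      sequence will be the limit.\<close>
    have "\<exists>v\<in>vecs V. ipnorm (completion V) (F k - embed v) < inverse (Suc k)" for k
    proof -
      obtain a where r: "represents V a (F k)" using Fv[of k] unfolding in_completion_iff by blast
      have "\<forall>\<^sub>F n in sequentially. ipnorm (completion V) (F k - embed (a n)) < inverse (Suc k)"
        using order_tendstoD(2)[OF represents_approx[OF r], of "inverse (Suc k)"] by simp
      then show ?thesis
        unfolding eventually_sequentially using representsD(2)[OF r] by blast
    qed
    then obtain v where v: "v k \<in> vecs V"
      and vF: "ipnorm (completion V) (F k - embed (v k)) < inverse (Suc k)" for k
      by metis
    have lim: "(\<lambda>k. ipnorm (completion V) (F k - embed (v k))) \<longlonglongrightarrow> 0"
      by (rule tendsto_sandwich[OF _ _ tendsto_const LIMSEQ_inverse_real_of_nat])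
        (use less_imp_le[OF vF] in \<open>auto intro!: always_eventually simp: Fv v embed_in\<close>)
    \<comment> \<open>The sequence is \<open>embed (v k)\<close>, written as the difference of a
      Cauchy sequence and a null sequence; as \<open>embed\<close> is isometric, \<open>v\<close> is
      Cauchy in \<open>V\<close>.\<close>
    have "cauchy_in (completion V) (\<lambda>k. F k - (F k - embed (v k)))"
    proof (rule C.cauchy_in_diff[OF F])
      show "cauchy_in (completion V) (\<lambda>k. F k - embed (v k))"
        unfolding C.cauchy_in_iff
      proof (intro conjI allI impI)
        show in_C: "F k - embed (v k) \<in> vecs (completion V)" for k by (simp add: Fv v embed_in)
        fix e :: real assume "e > 0"
        then obtain N where N: "\<And>n. n \<ge> N \<Longrightarrow> ipnorm (completion V) (F n - embed (v n)) < e / 2"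
          using order_tendstoD(2)[OF lim, of "e / 2"] unfolding eventually_sequentially by auto
        have "ipnorm (completion V) (F m - embed (v m) - (F n - embed (v n))) < e"
          if "m \<ge> N" "n \<ge> N" for m n
          using C.ipnorm_triangle_diff[OF in_C[of m] C.zero_in in_C[of n]] C.ipnorm_minus[OF in_C[of n]]
            N[OF that(1)] N[OF that(2)] by simp
        then show "\<exists>N. \<forall>m\<ge>N. \<forall>n\<ge>N. ipnorm (completion V) (F m - embed (v m) - (F n - embed (v n))) < e"
          by blast
      qed
    qed
    then have "cauchy_in V v"
      unfolding C.cauchy_in_iff cauchy_in_iff by (simp add: v flip: embed_diff ipnorm_embed)
    then have "convergent (\<lambda>n. ip V b (v n))" if "b \<in> vecs V" for b
      using that ip_cauchy_convergent cauchy_in_const by blast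
    then obtain g where g: "\<And>b. b \<in> vecs V \<Longrightarrow> (\<lambda>n. ip V b (v n)) \<longlonglongrightarrow> g b"
      unfolding convergent_def by metis
    define f where "f = (\<lambda>b. if b \<in> vecs V then g b else 0)"
    have r: "represents V v f" using \<open>cauchy_in V v\<close> g by (simp add: represents_def f_def)
    then have fv: "f \<in> vecs (completion V)" using in_completion_iff by blast
    have "(\<lambda>k. ipnorm (completion V) (F k - embed (v k)) + ipnorm (completion V) (f - embed (v k))) \<longlonglongrightarrow> 0"
      using tendsto_add[OF lim represents_approx[OF r]] by simp
    then have "(\<lambda>k. ipnorm (completion V) (F k - f)) \<longlonglongrightarrow> 0"
    proof (rule tendsto_sandwich[OF _ _ tendsto_const, rotated 2])
      show "\<forall>\<^sub>F k in sequentially. ipnorm (completion V) (F k - f)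
          \<le> ipnorm (completion V) (F k - embed (v k)) + ipnorm (completion V) (f - embed (v k))"
        using C.ipnorm_triangle_diff[OF Fv embed_in[OF v] fv] C.ipnorm_diff_commute[OF fv embed_in[OF v]]
        by (intro always_eventually allI) simp
    qed (auto intro!: always_eventually simp: Fv fv)
    then show "\<exists>f\<in>vecs (completion V). (\<lambda>k. ipnorm (completion V) (F k - f)) \<longlonglongrightarrow> 0"
      using fv by blast
  qed
qed

end

section \<open>Hilbert sums\<close>

locale hilbert_family =
  fixes I :: "'i set" and H :: "'i \<Rightarrow> ('v::ab_group_add) inner_space"
  assumes hilbert: "\<And>i. i \<in> I \<Longrightarrow> hilbert_space (H i)"
begin

abbreviation S where "S \<equiv> hilbert_sum I H"

lemma semi: "i \<in> I \<Longrightarrow> semi_inner_space (H i)"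
  using hilbert by (simp add: hilbert_space_def)

lemmas comp_in = semi_inner_space.zero_in[OF semi] semi_inner_space.add_in[OF semi]
  semi_inner_space.uminus_in[OF semi] semi_inner_space.diff_in[OF semi] semi_inner_space.smul_in[OF semi]

lemma in_sum_iff:
  "\<xi> \<in> vecs S \<longleftrightarrow> (\<forall>i\<in>I. \<xi> i \<in> vecs (H i)) \<and> (\<forall>i. i \<notin> I \<longrightarrow> \<xi> i = 0) \<and>
     (\<lambda>i. (ipnorm (H i) (\<xi> i))\<^sup>2) summable_on I"
proof -
  have "(\<lambda>i. (ipnorm (H i) (\<xi> i))\<^sup>2) summable_on I \<longleftrightarrow> (\<lambda>i. Re (ip (H i) (\<xi> i) (\<xi> i))) summable_on I"
    if "\<forall>i\<in>I. \<xi> i \<in> vecs (H i)"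
    using that by (intro summable_on_cong) (simp add: semi_inner_space.ipnorm_power2[OF semi])
  then show ?thesis by (auto simp: hilbert_sum_def)
qed

lemma in_sumD:
  assumes "\<xi> \<in> vecs S"
  shows "i \<in> I \<Longrightarrow> \<xi> i \<in> vecs (H i)" "i \<notin> I \<Longrightarrow> \<xi> i = 0"
    "(\<lambda>i. (ipnorm (H i) (\<xi> i))\<^sup>2) summable_on I"
  using assms by (auto simp: in_sum_iff)

lemma in_sum_bound:
  assumes "\<And>i. i \<in> I \<Longrightarrow> \<xi> i \<in> vecs (H i)" "\<And>i. i \<notin> I \<Longrightarrow> \<xi> i = 0"
    and "f summable_on I" and "\<And>i. i \<in> I \<Longrightarrow> (ipnorm (H i) (\<xi> i))\<^sup>2 \<le> f i"
  shows "\<xi> \<in> vecs S"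
  using assms by (auto simp: in_sum_iff intro: summable_on_comparison_test[OF assms(3)])

lemma ip_sum: "ip S \<xi> \<eta> = (\<Sum>\<^sub>\<infinity>i\<in>I. ip (H i) (\<xi> i) (\<eta> i))"
  by (simp add: hilbert_sum_def)

lemma ip_summable:
  assumes "\<xi> \<in> vecs S" "\<eta> \<in> vecs S"
  shows "(\<lambda>i. ip (H i) (\<xi> i) (\<eta> i)) summable_on I"
proof (rule abs_summable_summable, rule Infinite_Sum.abs_summable_on_comparison_test')
  show "(\<lambda>i. (ipnorm (H i) (\<xi> i))\<^sup>2 + (ipnorm (H i) (\<eta> i))\<^sup>2) summable_on I"
    by (intro summable_on_add in_sumD assms)
  fix i assume i: "i \<in> I"
  interpret semi_inner_space "H i" by (rule semi[OF i])
  have "norm (ip (H i) (\<xi> i) (\<eta> i)) \<le> ipnorm (H i) (\<xi> i) * ipnorm (H i) (\<eta> i)"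
    by (intro Cauchy_Schwarz in_sumD assms i)
  also have "\<dots> \<le> (ipnorm (H i) (\<xi> i))\<^sup>2 + (ipnorm (H i) (\<eta> i))\<^sup>2"
    using sum_squares_bound[of "ipnorm (H i) (\<xi> i)" "ipnorm (H i) (\<eta> i)"]
      mult_nonneg_nonneg[OF ipnorm_nonneg ipnorm_nonneg, OF in_sumD(1)[OF assms(1) i] in_sumD(1)[OF assms(2) i]]
    by simp
  finally show "norm (ip (H i) (\<xi> i) (\<eta> i)) \<le> (ipnorm (H i) (\<xi> i))\<^sup>2 + (ipnorm (H i) (\<eta> i))\<^sup>2" .
qed

lemma add_in_sum:
  assumes "\<xi> \<in> vecs S" "\<eta> \<in> vecs S"
  shows "\<xi> + \<eta> \<in> vecs S"
proof (rule in_sum_bound)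
  show "(\<lambda>i. 2 * (ipnorm (H i) (\<xi> i))\<^sup>2 + 2 * (ipnorm (H i) (\<eta> i))\<^sup>2) summable_on I"
    by (intro summable_on_add summable_on_cmult_right in_sumD assms)
  fix i assume i: "i \<in> I"
  interpret semi_inner_space "H i" by (rule semi[OF i])
  note m = in_sumD(1)[OF assms(1) i] in_sumD(1)[OF assms(2) i]
  show "(\<xi> + \<eta>) i \<in> vecs (H i)" using m by simp
  have "(ipnorm (H i) ((\<xi> + \<eta>) i))\<^sup>2 \<le> (ipnorm (H i) (\<xi> i) + ipnorm (H i) (\<eta> i))\<^sup>2"
    using m by (intro power_mono) (auto simp: ipnorm_triangle)
  also have "\<dots> \<le> 2 * (ipnorm (H i) (\<xi> i))\<^sup>2 + 2 * (ipnorm (H i) (\<eta> i))\<^sup>2"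
    using sum_squares_bound[of "ipnorm (H i) (\<xi> i)" "ipnorm (H i) (\<eta> i)"]
    by (simp add: power2_sum)
  finally show "(ipnorm (H i) ((\<xi> + \<eta>) i))\<^sup>2 \<le> 2 * (ipnorm (H i) (\<xi> i))\<^sup>2 + 2 * (ipnorm (H i) (\<eta> i))\<^sup>2" .
qed (simp add: in_sumD(2)[OF assms(1)] in_sumD(2)[OF assms(2)])

lemma semi_inner_space_sum: "semi_inner_space S"
proof
  show "0 \<in> vecs S"
    by (auto simp: in_sum_iff comp_in semi_inner_space.ipnorm_zero[OF semi] intro!: summable_on_0)
  show "\<xi> + \<eta> \<in> vecs S" if "\<xi> \<in> vecs S" "\<eta> \<in> vecs S" for \<xi> \<eta>
    using that by (rule add_in_sum)
  show "- \<xi> \<in> vecs S" if "\<xi> \<in> vecs S" for \<xi>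
    using in_sumD[OF that]
    by (intro in_sum_bound[OF _ _ in_sumD(3)[OF that]]) (auto simp: comp_in semi_inner_space.ipnorm_minus[OF semi])
  show "smul S c \<xi> \<in> vecs S" if "\<xi> \<in> vecs S" for c \<xi>
    using in_sumD[OF that]
    by (intro in_sum_bound[where f = "\<lambda>i. (cmod c)\<^sup>2 * (ipnorm (H i) (\<xi> i))\<^sup>2"] summable_on_cmult_right)
      (auto simp: comp_in hilbert_sum_def semi_inner_space.ipnorm_smul[OF semi] power_mult_distrib)
  show "ip S \<xi> (\<eta> + \<zeta>) = ip S \<xi> \<eta> + ip S \<xi> \<zeta>"
    if m: "\<xi> \<in> vecs S" "\<eta> \<in> vecs S" "\<zeta> \<in> vecs S" for \<xi> \<eta> \<zeta>
  proof -
    have "ip S \<xi> (\<eta> + \<zeta>) = (\<Sum>\<^sub>\<infinity>i\<in>I. ip (H i) (\<xi> i) (\<eta> i) + ip (H i) (\<xi> i) (\<zeta> i))"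
      unfolding ip_sum
      by (rule infsum_cong)
        (simp add: semi_inner_space.ip_add_right[OF semi] in_sumD(1)[OF m(1)] in_sumD(1)[OF m(2)] in_sumD(1)[OF m(3)])
    then show ?thesis by (simp add: ip_sum infsum_add ip_summable m)
  qed
  show "ip S \<xi> (smul S c \<eta>) = c * ip S \<xi> \<eta>" if m: "\<xi> \<in> vecs S" "\<eta> \<in> vecs S" for c \<xi> \<eta>
  proof -
    have "ip S \<xi> (smul S c \<eta>) = (\<Sum>\<^sub>\<infinity>i\<in>I. c * ip (H i) (\<xi> i) (\<eta> i))"
      unfolding ip_sum
      by (rule infsum_cong)
        (simp add: hilbert_sum_def semi_inner_space.ip_smul_right[OF semi] in_sumD(1)[OF m(1)] in_sumD(1)[OF m(2)])
    then show ?thesis by (simp add: ip_sum infsum_cmult_right')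
  qed
  show "ip S \<eta> \<xi> = cnj (ip S \<xi> \<eta>)" if m: "\<xi> \<in> vecs S" "\<eta> \<in> vecs S" for \<xi> \<eta>
    unfolding ip_sum infsum_cnj[symmetric]
    by (rule infsum_cong) (simp add: semi_inner_space.ip_commute[OF semi, symmetric] in_sumD(1)[OF m(1)] in_sumD(1)[OF m(2)])
  show "0 \<le> Re (ip S \<xi> \<xi>)" if m: "\<xi> \<in> vecs S" for \<xi>
    unfolding ip_sum infsum_Re[OF ip_summable[OF m m], symmetric]
    by (rule infsum_nonneg) (simp add: semi_inner_space.ip_pos[OF semi] in_sumD(1)[OF m])
qed

lemma ipnorm_sum:
  assumes m: "\<xi> \<in> vecs S"
  shows "(ipnorm S \<xi>)\<^sup>2 = (\<Sum>\<^sub>\<infinity>i\<in>I. (ipnorm (H i) (\<xi> i))\<^sup>2)"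
  unfolding semi_inner_space.ipnorm_power2[OF semi_inner_space_sum m] ip_sum
    infsum_Re[OF ip_summable[OF m m], symmetric]
  by (rule infsum_cong) (simp add: semi_inner_space.ipnorm_power2[OF semi] in_sumD(1)[OF m])

lemma finite_sum_le_ipnorm_sum:
  assumes m: "\<xi> \<in> vecs S" and "finite F" "F \<subseteq> I"
  shows "(\<Sum>i\<in>F. (ipnorm (H i) (\<xi> i))\<^sup>2) \<le> (ipnorm S \<xi>)\<^sup>2"
  unfolding ipnorm_sum[OF m] by (rule finite_sum_le_infsum[OF in_sumD(3)[OF m]]) (use assms in auto)

lemma ipnorm_comp_le:
  assumes m: "\<xi> \<in> vecs S" and i: "i \<in> I"
  shows "ipnorm (H i) (\<xi> i) \<le> ipnorm S \<xi>"
  using finite_sum_le_ipnorm_sum[OF m, of "{i}"] i semi_inner_space.ipnorm_nonneg[OF semi_inner_space_sum m]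
  by (auto intro: power2_le_imp_le)

lemma hilbert_space_sum: "hilbert_space S"
proof -
  interpret S: semi_inner_space S by (rule semi_inner_space_sum)
  show ?thesis
  proof
    fix \<xi> assume m: "\<xi> \<in> vecs S" and 0: "ipnorm S \<xi> = 0"
    have "\<xi> i = 0" for i
    proof (cases "i \<in> I")
      case True
      then have "ipnorm (H i) (\<xi> i) = 0"
        using ipnorm_comp_le[OF m True] 0 semi_inner_space.ipnorm_nonneg[OF semi[OF True] in_sumD(1)[OF m True]]
        by simp
      then show ?thesis by (rule hilbert_space.definite[OF hilbert[OF True] in_sumD(1)[OF m True]])
    qed (rule in_sumD(2)[OF m])
    then show "\<xi> = 0" by auto
  next
    fix a assume a: "cauchy_in S a"
    then have av: "a n \<in> vecs S" for n by (simp add: cauchy_in_def)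
    have "\<exists>x\<in>vecs (H i). (\<lambda>n. ipnorm (H i) (a n i - x)) \<longlonglongrightarrow> 0" if i: "i \<in> I" for i
    proof (rule hilbert_space.complete[OF hilbert[OF i]])
      have "ipnorm (H i) (a m i - a n i) \<le> ipnorm S (a m - a n)" for m n
        using ipnorm_comp_le[OF S.diff_in[OF av av] i] by simp
      moreover have "\<exists>N. \<forall>m\<ge>N. \<forall>n\<ge>N. ipnorm S (a m - a n) < e" if "e > 0" for e
        using a that unfolding S.cauchy_in_iff by metis
      ultimately have "\<exists>N. \<forall>m\<ge>N. \<forall>n\<ge>N. ipnorm (H i) (a m i - a n i) < e" if "e > 0" for e
        using that by (metis order_le_less_trans)
      then show "cauchy_in (H i) (\<lambda>n. a n i)"
        using in_sumD(1)[OF av i] by (simp add: semi_inner_space.cauchy_in_iff[OF semi[OF i]])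
    qed
    then obtain y where y: "\<And>i. i \<in> I \<Longrightarrow> y i \<in> vecs (H i)"
      "\<And>i. i \<in> I \<Longrightarrow> (\<lambda>n. ipnorm (H i) (a n i - y i)) \<longlonglongrightarrow> 0" by metis
    define x where "x = (\<lambda>i. if i \<in> I then y i else 0)"
    \<comment> \<open>Over finitely many indices the componentwise limits pass through the sum. The
      bound does not depend on \<open>F\<close>, so it will give both summability and the norm
      estimate.\<close>
    have bound: "(\<Sum>i\<in>F. (ipnorm (H i) ((a n - x) i))\<^sup>2) \<le> e\<^sup>2"
      if N: "\<And>m. m \<ge> N \<Longrightarrow> ipnorm S (a n - a m) \<le> e" and F: "finite F" "F \<subseteq> I" for n N e F
    proof (rule tendsto_upperbound)
      show "(\<lambda>m. \<Sum>i\<in>F. (ipnorm (H i) (a n i - a m i))\<^sup>2) \<longlonglongrightarrow> (\<Sum>i\<in>F. (ipnorm (H i) ((a n - x) i))\<^sup>2)"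
      proof (intro tendsto_intros)
        fix i assume "i \<in> F"
        then have i: "i \<in> I" using F by auto
        interpret semi_inner_space "H i" by (rule semi[OF i])
        note m = in_sumD(1)[OF av i] y(1)[OF i]
        have "(\<lambda>m. ipnorm (H i) (a n i - a m i) - ipnorm (H i) (a n i - y i)) \<longlonglongrightarrow> 0"
        proof (rule Lim_null_comparison[OF always_eventually y(2)[OF i]], intro allI)
          fix k
          have "a n i - a k i - (a n i - y i) = - (a k i - y i)" by simp
          then have "ipnorm (H i) (a n i - a k i - (a n i - y i)) = ipnorm (H i) (a k i - y i)"
            using ipnorm_minus[OF diff_in[OF in_sumD(1)[OF av i, of k] y(1)[OF i]]] by (simp only:)
          then show "norm (ipnorm (H i) (a n i - a k i) - ipnorm (H i) (a n i - y i)) \<le> ipnorm (H i) (a k i - y i)"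
            using ipnorm_reverse_triangle[of "a n i - a k i" "a n i - y i"] m by simp
        qed
        then show "(\<lambda>m. ipnorm (H i) (a n i - a m i)) \<longlonglongrightarrow> ipnorm (H i) ((a n - x) i)"
          using i by (simp add: x_def LIM_zero_iff)
      qed
      show "\<forall>\<^sub>F m in sequentially. (\<Sum>i\<in>F. (ipnorm (H i) (a n i - a m i))\<^sup>2) \<le> e\<^sup>2"
        unfolding eventually_sequentially
      proof (intro exI allI impI)
        fix m assume m: "N \<le> m"
        have "(\<Sum>i\<in>F. (ipnorm (H i) (a n i - a m i))\<^sup>2) \<le> (ipnorm S (a n - a m))\<^sup>2"
          using finite_sum_le_ipnorm_sum[OF S.diff_in[OF av av] F] by simp
        also have "\<dots> \<le> e\<^sup>2" using N[OF m] by (intro power_mono) (auto simp: av)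
        finally show "(\<Sum>i\<in>F. (ipnorm (H i) (a n i - a m i))\<^sup>2) \<le> e\<^sup>2" .
      qed
    qed simp
    have near: "a n - x \<in> vecs S \<and> ipnorm S (a n - x) \<le> e"
      if N: "\<And>m. m \<ge> N \<Longrightarrow> ipnorm S (a n - a m) \<le> e" and e: "e > 0" for n N e
    proof
      have sm: "(\<lambda>i. (ipnorm (H i) ((a n - x) i))\<^sup>2) summable_on I"
      proof (rule nonneg_bdd_above_summable_on)
        show "bdd_above (sum (\<lambda>i. (ipnorm (H i) ((a n - x) i))\<^sup>2) ` {F. F \<subseteq> I \<and> finite F})"
          using bound[OF N] by (intro bdd_aboveI2[where M = "e\<^sup>2"]) blast
      qed simp
      show m: "a n - x \<in> vecs S"
        unfolding in_sum_iff
        using sm in_sumD(1,2)[OF av[of n]] y(1) by (auto simp: x_def comp_in)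
      have "(ipnorm S (a n - x))\<^sup>2 \<le> e\<^sup>2"
        unfolding ipnorm_sum[OF m] by (rule infsum_le_finite_sums[OF sm bound[OF N]])
      then show "ipnorm S (a n - x) \<le> e" by (rule power2_le_imp_le) (use e in simp)
    qed
    have ex: "\<exists>N. \<forall>n\<ge>N. a n - x \<in> vecs S \<and> ipnorm S (a n - x) \<le> e" if e: "e > 0" for e
    proof -
      obtain N where N: "\<And>m n. m \<ge> N \<Longrightarrow> n \<ge> N \<Longrightarrow> ipnorm S (a m - a n) < e"
        using a e unfolding S.cauchy_in_iff by meson
      have "a n - x \<in> vecs S \<and> ipnorm S (a n - x) \<le> e" if n: "n \<ge> N" for n
        by (rule near[where N = N, OF _ e]) (rule less_imp_le[OF N[OF n]])
      then show ?thesis by blast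
    qed
    \<comment> \<open>So far only differences are known to be square summable; \<open>x\<close> is
      recovered from one of them and \<open>a n\<close>.\<close>
    obtain n where "a n - x \<in> vecs S" using ex[of 1] by auto
    then have "a n - (a n - x) \<in> vecs S" by (rule S.diff_in[OF av])
    moreover have "a n - (a n - x) = x" by (rule diff_diff_eq2[THEN trans]) simp
    ultimately have x: "x \<in> vecs S" by (simp only:)
    have "(\<lambda>n. ipnorm S (a n - x)) \<longlonglongrightarrow> 0"
    proof (rule LIMSEQ_I)
      fix e :: real assume e: "e > 0"
      then obtain N where "\<forall>n\<ge>N. a n - x \<in> vecs S \<and> ipnorm S (a n - x) \<le> e / 2" using ex[of "e / 2"] by auto
      then show "\<exists>N. \<forall>n\<ge>N. norm (ipnorm S (a n - x) - 0) < e"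
        using e by (fastforce intro!: exI[of _ N])
    qed
    then show "\<exists>x\<in>vecs S. (\<lambda>n. ipnorm S (a n - x)) \<longlonglongrightarrow> 0" using x by blast
  qed
qed

end

section \<open>Strong limits of bounded nets of operators\<close>

abbreviation (input) fsets where "fsets \<equiv> finite_subsets_at_top"

context semi_inner_space
begin

text \<open>Membership is asked only eventually, since the nets in question are controlled only on
  finite subsets of \<open>J\<close>.\<close>

definition tends :: "('i \<Rightarrow> 'v) \<Rightarrow> 'v \<Rightarrow> 'i filter \<Rightarrow> bool" where
  "tends X t F \<longleftrightarrow> t \<in> vecs V \<and> (\<forall>\<^sub>F i in F. X i \<in> vecs V) \<and> ((\<lambda>i. nm (X i - t)) \<longlongrightarrow> 0) F"

lemma tendsI:
  assumes "t \<in> vecs V" "\<forall>\<^sub>F i in F. X i \<in> vecs V"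
    and "\<forall>\<^sub>F i in F. nm (X i - t) \<le> g i" "(g \<longlongrightarrow> 0) F"
  shows "tends X t F"
proof -
  have "((\<lambda>i. nm (X i - t)) \<longlongrightarrow> 0) F"
  proof (rule tendsto_sandwich[OF _ assms(3) tendsto_const assms(4)])
    show "\<forall>\<^sub>F i in F. 0 \<le> nm (X i - t)"
      using assms(2) by eventually_elim (simp add: assms(1))
  qed
  then show ?thesis using assms by (simp add: tends_def)
qed

lemma tends_ip:
  assumes "tends X t F" "v \<in> vecs V"
  shows "((\<lambda>i. ip V v (X i)) \<longlongrightarrow> ip V v t) F"
proof -
  have "((\<lambda>i. ip V v (X i) - ip V v t) \<longlongrightarrow> 0) F"
  proof (rule Lim_null_comparison)
    show "((\<lambda>i. nm v * nm (X i - t)) \<longlongrightarrow> 0) F"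
      using assms tendsto_mult_right_zero unfolding tends_def by blast
    have "\<forall>\<^sub>F i in F. X i \<in> vecs V" using assms by (simp add: tends_def)
    then show "\<forall>\<^sub>F i in F. norm (ip V v (X i) - ip V v t) \<le> nm v * nm (X i - t)"
    proof eventually_elim
      case (elim i)
      then show ?case
        using Cauchy_Schwarz[of v "X i - t"] assms by (simp add: tends_def ip_diff_right)
    qed
  qed
  then show ?thesis by (simp add: LIM_zero_iff)
qed

lemma tends_ipnorm:
  assumes "tends X t F"
  shows "((\<lambda>i. nm (X i)) \<longlongrightarrow> nm t) F"
proof -
  have "((\<lambda>i. nm (X i) - nm t) \<longlongrightarrow> 0) F"
  proof (rule Lim_null_comparison)
    show "((\<lambda>i. nm (X i - t)) \<longlongrightarrow> 0) F" using assms by (simp add: tends_def)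
    have "\<forall>\<^sub>F i in F. X i \<in> vecs V" using assms by (simp add: tends_def)
    then show "\<forall>\<^sub>F i in F. norm (nm (X i) - nm t) \<le> nm (X i - t)"
      by eventually_elim (use assms ipnorm_reverse_triangle in \<open>auto simp: tends_def\<close>)
  qed
  then show ?thesis by (simp add: LIM_zero_iff)
qed

lemma tends_add:
  assumes "tends X s F" "tends Y t F"
  shows "tends (\<lambda>i. X i + Y i) (s + t) F"
proof (rule tendsI)
  show "s + t \<in> vecs V" using assms by (simp add: tends_def)
  have ev: "\<forall>\<^sub>F i in F. X i \<in> vecs V \<and> Y i \<in> vecs V" using assms by (simp add: tends_def eventually_conj)
  then show "\<forall>\<^sub>F i in F. X i + Y i \<in> vecs V" by eventually_elim simp
  show "((\<lambda>i. nm (X i - s) + nm (Y i - t)) \<longlongrightarrow> 0) F"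
    using assms tendsto_add[of "\<lambda>i. nm (X i - s)" 0 F "\<lambda>i. nm (Y i - t)" 0] by (simp add: tends_def)
  show "\<forall>\<^sub>F i in F. nm (X i + Y i - (s + t)) \<le> nm (X i - s) + nm (Y i - t)"
    using ev
  proof eventually_elim
    case (elim i)
    have "X i + Y i - (s + t) = (X i - s) + (Y i - t)" by simp
    also have "nm \<dots> \<le> nm (X i - s) + nm (Y i - t)"
      using elim assms by (intro ipnorm_triangle) (auto simp: tends_def)
    finally show ?case .
  qed
qed

lemma tends_bounded_op:
  assumes X: "tends X t F" and T: "\<And>x. x \<in> vecs V \<Longrightarrow> T x \<in> vecs V"
    and C: "\<And>x y. x \<in> vecs V \<Longrightarrow> y \<in> vecs V \<Longrightarrow> nm (T x - T y) \<le> C * nm (x - y)"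
  shows "tends (\<lambda>i. T (X i)) (T t) F"
proof (rule tendsI)
  have ev: "\<forall>\<^sub>F i in F. X i \<in> vecs V" and t: "t \<in> vecs V" using X by (auto simp: tends_def)
  show "T t \<in> vecs V" using t by (rule T)
  show "\<forall>\<^sub>F i in F. T (X i) \<in> vecs V" using ev by eventually_elim (rule T)
  show "\<forall>\<^sub>F i in F. nm (T (X i) - T t) \<le> C * nm (X i - t)"
    using ev by eventually_elim (intro C t)
  show "((\<lambda>i. C * nm (X i - t)) \<longlongrightarrow> 0) F"
    using X tendsto_mult_right_zero unfolding tends_def by blast
qed

lemma bounded_opsD:
  assumes "T \<in> bounded_ops V"
  shows "\<xi> \<in> vecs V \<Longrightarrow> T \<xi> \<in> vecs V" "\<xi> \<notin> vecs V \<Longrightarrow> T \<xi> = 0"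
    "\<xi> \<in> vecs V \<Longrightarrow> \<eta> \<in> vecs V \<Longrightarrow> T (\<xi> + \<eta>) = T \<xi> + T \<eta>"
    "\<xi> \<in> vecs V \<Longrightarrow> T (smul V c \<xi>) = smul V c (T \<xi>)"
  using assms by (auto simp: bounded_ops_def)

lemma bounded_ops_zero: "T \<in> bounded_ops V \<Longrightarrow> T 0 = 0"
  using bounded_opsD(3)[of T 0 0] by simp

lemma bounded_ops_diff:
  "T \<in> bounded_ops V \<Longrightarrow> \<xi> \<in> vecs V \<Longrightarrow> \<eta> \<in> vecs V \<Longrightarrow> T (\<xi> - \<eta>) = T \<xi> - T \<eta>"
  using bounded_opsD(3)[of T "\<xi> - \<eta>" \<eta>] by (simp add: eq_diff_eq)

lemma bounded_opsI:
  assumes "\<And>\<xi>. \<xi> \<in> vecs V \<Longrightarrow> T \<xi> \<in> vecs V" "\<And>\<xi>. \<xi> \<notin> vecs V \<Longrightarrow> T \<xi> = 0"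
    "\<And>\<xi> \<eta>. \<xi> \<in> vecs V \<Longrightarrow> \<eta> \<in> vecs V \<Longrightarrow> T (\<xi> + \<eta>) = T \<xi> + T \<eta>"
    "\<And>c \<xi>. \<xi> \<in> vecs V \<Longrightarrow> T (smul V c \<xi>) = smul V c (T \<xi>)"
    "\<And>\<xi>. \<xi> \<in> vecs V \<Longrightarrow> nm (T \<xi>) \<le> C * nm \<xi>"
  shows "T \<in> bounded_ops V"
  using assms unfolding bounded_ops_def ipnorm_def by blast

lemma bounded_ops_tends:
  assumes T: "T \<in> bounded_ops V" and X: "tends X t F"
  shows "tends (\<lambda>i. T (X i)) (T t) F"
proof -
  obtain C where C: "\<And>\<xi>. \<xi> \<in> vecs V \<Longrightarrow> nm (T \<xi>) \<le> C * nm \<xi>"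
    using T unfolding bounded_ops_def ipnorm_def by blast
  show ?thesis
    by (rule tends_bounded_op[OF X, where C = C])
      (auto simp: bounded_opsD[OF T] C simp flip: bounded_ops_diff[OF T])
qed

end

text \<open>A subbasis suffices: eventual membership survives finite intersections, and for a union
  it is inherited from the member that contains the limit.\<close>

lemma limitin_topology_generated_by:
  assumes "l \<in> \<Union>\<B>" and "\<And>U. U \<in> \<B> \<Longrightarrow> l \<in> U \<Longrightarrow> \<forall>\<^sub>F i in F. f i \<in> U"
  shows "limitin (topology_generated_by \<B>) f l F"
proof -
  have "\<forall>\<^sub>F i in F. f i \<in> U" if "generate_topology_on \<B> U" "l \<in> U" for U
    using that
  proof (induction rule: generate_topology_on.induct)
    case (Int a b)
    then show ?case by (auto intro: eventually_conj)
  next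
    case (UN K)
    then obtain k where k: "k \<in> K" "l \<in> k" by auto
    then have "\<forall>\<^sub>F i in F. f i \<in> k" using UN by blast
    then show ?case by eventually_elim (use k in auto)
  qed (use assms in auto)
  then show ?thesis
    using assms(1) by (auto simp: limitin_def topology_generated_by_topspace openin_topology_generated_by_iff)
qed

context hilbert_space
begin

lemma tends_unique:
  assumes s: "tends X s F" and t: "tends X t F" and F: "F \<noteq> bot"
  shows "s = t"
proof -
  have st: "s \<in> vecs H" "t \<in> vecs H" using s t by (auto simp: tends_def)
  have "nm (s - t) \<le> 0"
  proof (rule tendsto_lowerbound[OF _ _ F])
    show "((\<lambda>i. nm (X i - s) + nm (X i - t)) \<longlongrightarrow> 0) F"
      using s t tendsto_add[of "\<lambda>i. nm (X i - s)" 0 F "\<lambda>i. nm (X i - t)" 0] by (simp add: tends_def)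
    have "\<forall>\<^sub>F i in F. X i \<in> vecs H" using s by (simp add: tends_def)
    then show "\<forall>\<^sub>F i in F. nm (s - t) \<le> nm (X i - s) + nm (X i - t)"
    proof eventually_elim
      case (elim i)
      then show ?case
        using ipnorm_triangle_diff[of s "X i" t] ipnorm_diff_commute[of s "X i"] st by simp
    qed
  qed
  then have "nm (s - t) = 0" using ipnorm_nonneg[OF diff_in[OF st]] by (rule antisym)
  then show ?thesis using definite[of "s - t"] st by simp
qed

text \<open>Reduction to sequential completeness along sets \<open>G n\<close> with tolerance
  \<open>1 / (n + 1)\<close>. These need not increase, so two of them are compared through their
  union.\<close>

lemma cauchy_net_tends:
  assumes X: "\<And>F. finite F \<Longrightarrow> F \<subseteq> J \<Longrightarrow> X F \<in> vecs H"
    and cauchy: "\<And>e. e > 0 \<Longrightarrow> \<exists>F0. finite F0 \<and> F0 \<subseteq> J \<and>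
      (\<forall>F. finite F \<longrightarrow> F0 \<subseteq> F \<longrightarrow> F \<subseteq> J \<longrightarrow> nm (X F - X F0) \<le> e)"
  shows "\<exists>t. tends X t (fsets J)"
proof -
  have "\<exists>F0. finite F0 \<and> F0 \<subseteq> J \<and>
      (\<forall>F. finite F \<longrightarrow> F0 \<subseteq> F \<longrightarrow> F \<subseteq> J \<longrightarrow> nm (X F - X F0) \<le> inverse (Suc n))" for n
    by (rule cauchy) simp
  then obtain G where G: "finite (G n)" "G n \<subseteq> J"
    and GF: "\<And>F. finite F \<Longrightarrow> G n \<subseteq> F \<Longrightarrow> F \<subseteq> J \<Longrightarrow> nm (X F - X (G n)) \<le> inverse (Suc n)" for n
    by metis
  note XG = X[OF G]
  have "cauchy_in H (\<lambda>n. X (G n))"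
    unfolding cauchy_in_iff
  proof (intro conjI allI impI XG)
    fix e :: real assume "e > 0"
    then obtain N where N: "inverse (real (Suc N)) < e / 2" using reals_Archimedean[of "e / 2"] by auto
    have "nm (X (G m) - X (G n)) < e" if mn: "m \<ge> N" "n \<ge> N" for m n
    proof -
      let ?U = "G m \<union> G n"
      have U: "finite ?U" "?U \<subseteq> J" using G by auto
      have small: "inverse (real (Suc k)) < e / 2" if "k \<ge> N" for k
      proof -
        have "inverse (real (Suc k)) \<le> inverse (real (Suc N))" using that by (intro le_imp_inverse_le) auto
        then show ?thesis using N by (rule order_le_less_trans)
      qed
      have "nm (X (G m) - X (G n)) \<le> nm (X (G m) - X ?U) + nm (X ?U - X (G n))"
        by (intro ipnorm_triangle_diff XG X U)
      also have "nm (X (G m) - X ?U) = nm (X ?U - X (G m))"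
        by (intro ipnorm_diff_commute XG X U)
      finally show ?thesis
        using GF[OF U(1) _ U(2), of m] GF[OF U(1) _ U(2), of n] small[OF mn(1)] small[OF mn(2)] by simp
    qed
    then show "\<exists>N. \<forall>m\<ge>N. \<forall>n\<ge>N. nm (X (G m) - X (G n)) < e" by blast
  qed
  then obtain t where t: "t \<in> vecs H" and lim: "(\<lambda>n. nm (X (G n) - t)) \<longlonglongrightarrow> 0"
    using complete by blast
  have "((\<lambda>F. nm (X F - t)) \<longlongrightarrow> 0) (fsets J)"
  proof (rule tendstoI)
    fix e :: real assume "e > 0"
    then have "\<forall>\<^sub>F n in sequentially. nm (X (G n) - t) < e / 2 \<and> inverse (real (Suc n)) < e / 2"
      using order_tendstoD(2)[OF lim, of "e / 2"] order_tendstoD(2)[OF LIMSEQ_inverse_real_of_nat, of "e / 2"]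
      by (intro eventually_conj) auto
    then obtain n where n: "nm (X (G n) - t) < e / 2" "inverse (real (Suc n)) < e / 2"
      unfolding eventually_sequentially by blast
    have "dist (nm (X F - t)) 0 < e" if F: "finite F" "G n \<subseteq> F" "F \<subseteq> J" for F
    proof -
      have "nm (X F - t) < e"
        using ipnorm_triangle_diff[OF X[OF F(1,3)] XG t, of n] GF[OF F] n by linarith
      then show ?thesis using ipnorm_nonneg[OF diff_in[OF X[OF F(1,3)] t]] by simp
    qed
    then show "\<forall>\<^sub>F F in fsets J. dist (nm (X F - t)) 0 < e"
      unfolding eventually_finite_subsets_at_top using G[of n] by (intro exI[of _ "G n"]) auto
  qed
  then show ?thesis
    using t X by (auto simp: tends_def intro!: exI[of _ t] eventually_finite_subsets_at_top_weakI)
qed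

lemma strong_limit_exists:
  assumes S: "\<And>F. finite F \<Longrightarrow> F \<subseteq> J \<Longrightarrow> S F \<in> bounded_ops H"
    and C: "\<And>F \<xi>. finite F \<Longrightarrow> F \<subseteq> J \<Longrightarrow> \<xi> \<in> vecs H \<Longrightarrow> nm (S F \<xi>) \<le> C * nm \<xi>"
    and lim: "\<And>\<xi>. \<xi> \<in> vecs H \<Longrightarrow> \<exists>t. tends (\<lambda>F. S F \<xi>) t (fsets J)"
  shows "\<exists>T\<in>bounded_ops H. \<forall>\<xi>\<in>vecs H. tends (\<lambda>F. S F \<xi>) (T \<xi>) (fsets J)"
proof -
  let ?\<F> = "fsets J"
  obtain T0 where T0: "\<And>\<xi>. \<xi> \<in> vecs H \<Longrightarrow> tends (\<lambda>F. S F \<xi>) (T0 \<xi>) ?\<F>"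
    using lim by metis
  define T where "T = (\<lambda>\<xi>. if \<xi> \<in> vecs H then T0 \<xi> else 0)"
  have T: "tends (\<lambda>F. S F \<xi>) (T \<xi>) ?\<F>" if "\<xi> \<in> vecs H" for \<xi>
    using T0[OF that] that by (simp add: T_def)
  \<comment> \<open>The algebraic identities for \<open>S F\<close> hold only for finite
    \<open>F\<close> inside \<open>J\<close>; this transfers limits between nets that agree
    there.\<close>
  have cong: "tends X t ?\<F>" if "tends Y t ?\<F>" "\<And>F. finite F \<Longrightarrow> F \<subseteq> J \<Longrightarrow> X F = Y F" for X Y t
  proof -
    have ev: "\<forall>\<^sub>F F in ?\<F>. X F = Y F"
      using that(2) by (rule eventually_finite_subsets_at_top_weakI)
    have "\<forall>\<^sub>F F in ?\<F>. Y F \<in> vecs H" using that(1) by (simp add: tends_def)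
    with ev have "\<forall>\<^sub>F F in ?\<F>. X F \<in> vecs H" by eventually_elim simp
    moreover from ev have "\<forall>\<^sub>F F in ?\<F>. nm (X F - t) \<le> nm (Y F - t)" by eventually_elim simp
    ultimately show ?thesis using that(1) by (intro tendsI[where g = "\<lambda>F. nm (Y F - t)"]) (auto simp: tends_def)
  qed
  have "T \<in> bounded_ops H"
  proof (rule bounded_opsI)
    show T_in: "T \<xi> \<in> vecs H" if "\<xi> \<in> vecs H" for \<xi> using T[OF that] by (simp add: tends_def)
    show "T \<xi> = 0" if "\<xi> \<notin> vecs H" for \<xi> using that by (simp add: T_def)
    show "T (\<xi> + \<eta>) = T \<xi> + T \<eta>" if m: "\<xi> \<in> vecs H" "\<eta> \<in> vecs H" for \<xi> \<eta>
      by (rule tends_unique[OF T[OF add_in[OF m]] cong[OF tends_add[OF T[OF m(1)] T[OF m(2)]]] finite_subsets_at_top_neq_bot])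
        (rule bounded_opsD(3)[OF S m])
    show "T (smul H c \<xi>) = smul H c (T \<xi>)" if m: "\<xi> \<in> vecs H" for c \<xi>
    proof (rule tends_unique[OF T[OF smul_in[OF m]] cong[OF tends_bounded_op[OF T[OF m]]] finite_subsets_at_top_neq_bot])
      fix x y assume xy: "x \<in> vecs H" "y \<in> vecs H"
      have "nm (smul H c x - smul H c y) = cmod c * nm (x - y)"
      proof -
        have "smul H c x - smul H c y = smul H c (x - y)"
        proof -
          \<comment> \<open>Here definiteness is available, so linearity of \<open>smul\<close>
            follows once \<open>d\<close> is seen to have norm 0.\<close>
          define d where "d = smul H c x - smul H c y - smul H c (x - y)"
          have d: "d \<in> vecs H" using xy by (simp add: d_def)
          have sc: "ip H v d = c * ip H v x - c * ip H v y - c * (ip H v x - ip H v y)" if "v \<in> vecs H" for v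
            unfolding d_def using that xy by (simp only: ip_diff_right ip_smul_right diff_in smul_in)
          have "ip H d d = 0" unfolding sc[OF d] by (simp add: right_diff_distrib)
          then have "d = 0" by (intro definite d) (simp add: ipnorm_def)
          then show ?thesis by (simp add: d_def)
        qed
        then show ?thesis using xy by (simp add: ipnorm_smul)
      qed
      then show "nm (smul H c x - smul H c y) \<le> cmod c * nm (x - y)" by simp
    qed (use bounded_opsD(4)[OF S] m in auto)
    show "nm (T \<xi>) \<le> C * nm \<xi>" if m: "\<xi> \<in> vecs H" for \<xi>
      by (rule tendsto_upperbound[OF tends_ipnorm[OF T[OF m]] eventually_finite_subsets_at_top_weakI])
        (auto simp: C m)
  qed
  then show ?thesis using T by blast
qed

text \<open>In the application \<open>r F\<close> is the quadratic form of the operator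
  \<open>a F\<close> at a fixed vector. Once \<open>r F0\<close> lies within \<open>e^2 / C\<close>
  of the supremum, no later increment of \<open>X\<close> exceeds \<open>e\<close>.\<close>

lemma monotone_net_tends:
  assumes X: "\<And>F. finite F \<Longrightarrow> F \<subseteq> J \<Longrightarrow> X F \<in> vecs H" and C: "0 < C"
    and incr: "\<And>F G. finite G \<Longrightarrow> F \<subseteq> G \<Longrightarrow> G \<subseteq> J \<Longrightarrow> (nm (X G - X F))\<^sup>2 \<le> C * (r G - r F)"
    and bound: "\<And>F. finite F \<Longrightarrow> F \<subseteq> J \<Longrightarrow> r F \<le> (B::real)"
  shows "\<exists>t. tends X t (fsets J)"
proof (rule cauchy_net_tends[OF X])
  fix e :: real assume e: "e > 0"
  let ?R = "r ` {F. finite F \<and> F \<subseteq> J}"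
  have bdd: "bdd_above ?R" using bound by (intro bdd_aboveI2[where M = B]) auto
  have "Sup ?R - e\<^sup>2 / C < Sup ?R" using e C by simp
  then obtain F0 where F0: "finite F0" "F0 \<subseteq> J" "Sup ?R - e\<^sup>2 / C < r F0"
    using less_cSup_iff[of ?R "Sup ?R - e\<^sup>2 / C"] bdd by blast
  have "nm (X F - X F0) \<le> e" if F: "finite F" "F0 \<subseteq> F" "F \<subseteq> J" for F
  proof (rule power2_le_imp_le)
    have "(nm (X F - X F0))\<^sup>2 \<le> C * (r F - r F0)" by (rule incr[OF F])
    also have "\<dots> \<le> C * (e\<^sup>2 / C)"
      using F0(3) cSup_upper[OF _ bdd, of "r F"] F C by (intro mult_left_mono) auto
    finally show "(nm (X F - X F0))\<^sup>2 \<le> e\<^sup>2" using C by simp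
  qed (use e in simp)
  then show "\<exists>F0. finite F0 \<and> F0 \<subseteq> J \<and>
      (\<forall>F. finite F \<longrightarrow> F0 \<subseteq> F \<longrightarrow> F \<subseteq> J \<longrightarrow> nm (X F - X F0) \<le> e)"
    using F0 by blast
qed

text \<open>Commutants are strongly closed: \<open>S F (U \<xi>)\<close> tends to
  \<open>T (U \<xi>)\<close> and equals \<open>U (S F \<xi>)\<close>, which tends to
  \<open>U (T \<xi>)\<close>. With \<open>M\<close> the commutant of the represented algebra, this
  places strong limits in the bicommutant.\<close>

lemma strong_limit_in_commutant:
  assumes S: "\<And>F. finite F \<Longrightarrow> F \<subseteq> J \<Longrightarrow> S F \<in> commutant H M" and M: "M \<subseteq> bounded_ops H"
    and T: "T \<in> bounded_ops H" "\<And>\<xi>. \<xi> \<in> vecs H \<Longrightarrow> tends (\<lambda>F. S F \<xi>) (T \<xi>) (fsets J)"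
  shows "T \<in> commutant H M"
proof -
  have "T (U \<xi>) = U (T \<xi>)" if U: "U \<in> M" for U \<xi>
  proof (cases "\<xi> \<in> vecs H")
    case True
    have Ub: "U \<in> bounded_ops H" using U M by blast
    have SU: "S F (U \<xi>) = U (S F \<xi>)" if "finite F" "F \<subseteq> J" for F
      using S[OF that] U by (auto simp: commutant_def fun_eq_iff)
    have "tends (\<lambda>F. S F (U \<xi>)) (U (T \<xi>)) (fsets J)"
    proof (rule tendsI)
      have 1: "tends (\<lambda>F. U (S F \<xi>)) (U (T \<xi>)) (fsets J)"
        by (rule bounded_ops_tends[OF Ub T(2)[OF True]])
      then show "U (T \<xi>) \<in> vecs H"
        "((\<lambda>F. nm (U (S F \<xi>) - U (T \<xi>))) \<longlongrightarrow> 0) (fsets J)"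
        by (auto simp: tends_def)
      show "\<forall>\<^sub>F F in fsets J. S F (U \<xi>) \<in> vecs H"
        using S by (intro eventually_finite_subsets_at_top_weakI)
          (auto simp: commutant_def bounded_opsD bounded_opsD(1)[OF Ub True])
      show "\<forall>\<^sub>F F in fsets J. nm (S F (U \<xi>) - U (T \<xi>)) \<le> nm (U (S F \<xi>) - U (T \<xi>))"
        by (intro eventually_finite_subsets_at_top_weakI) (simp add: SU)
    qed
    then show ?thesis
      using tends_unique[OF T(2)[OF bounded_opsD(1)[OF Ub True]]] by simp
  next
    \<comment> \<open>Commuting means equality of total functions, so vectors outside the space
      count too; there both sides are 0 by the convention in \<open>bounded_ops\<close>.\<close>
    case False
    then show ?thesis using U M T(1) by (simp add: bounded_opsD(2) bounded_ops_zero subset_iff)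
  qed
  then show ?thesis using T(1) by (auto simp: commutant_def)
qed

text \<open>Strong convergence makes every term of the series converge, and the uniform bound
  dominates the terms by a summable multiple of the squared norms of \<open>\<xi>\<close> and
  \<open>\<eta>\<close>; Tannery's theorem then exchanges limit and sum.\<close>

lemma strong_limit_ultraweak:
  assumes S: "\<And>F. finite F \<Longrightarrow> F \<subseteq> J \<Longrightarrow> S F \<in> bounded_ops H"
    and C: "\<And>F \<xi>. finite F \<Longrightarrow> F \<subseteq> J \<Longrightarrow> \<xi> \<in> vecs H \<Longrightarrow> nm (S F \<xi>) \<le> C * nm \<xi>"
    and T: "T \<in> bounded_ops H" "\<And>\<xi>. \<xi> \<in> vecs H \<Longrightarrow> tends (\<lambda>F. S F \<xi>) (T \<xi>) (fsets J)"
  shows "limitin (ultraweak_topology H) S T (fsets J)"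
proof -
  define \<B> where "\<B> = {{T \<in> bounded_ops H. (\<Sum>n. ip H (\<xi> n) (T (\<eta> n))) \<in> U} | \<xi> \<eta> U.
        square_summable H \<xi> \<and> square_summable H \<eta> \<and> open U}"
  have "limitin (topology_generated_by \<B>) S T (fsets J)"
  proof (rule limitin_topology_generated_by)
    have "square_summable H (\<lambda>n. 0)" by (simp add: square_summable_def)
    then have "bounded_ops H \<in> \<B>" unfolding \<B>_def using open_UNIV by blast
    with T(1) show "T \<in> \<Union>\<B>" by blast
  next
    fix W assume "W \<in> \<B>" and TW: "T \<in> W"
    then obtain \<xi> \<eta> U where W: "W = {T \<in> bounded_ops H. (\<Sum>n. ip H (\<xi> n) (T (\<eta> n))) \<in> U}"
      and ss: "square_summable H \<xi>" "square_summable H \<eta>" and U: "open U" unfolding \<B>_def by blast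
    have m: "\<xi> n \<in> vecs H" "\<eta> n \<in> vecs H" for n using ss by (auto simp: square_summable_def)
    have "summable (\<lambda>n. (nm (\<xi> n))\<^sup>2)" "summable (\<lambda>n. (nm (\<eta> n))\<^sup>2)"
      using ss by (auto simp: square_summable_def ipnorm_power2)
    then have sum: "summable (\<lambda>n. \<bar>C\<bar> * ((nm (\<xi> n))\<^sup>2 + (nm (\<eta> n))\<^sup>2))"
      by (intro summable_mult summable_add)
    have "((\<lambda>F. \<Sum>n. ip H (\<xi> n) (S F (\<eta> n))) \<longlongrightarrow> (\<Sum>n. ip H (\<xi> n) (T (\<eta> n)))) (fsets J)"
    proof (rule tannerys_theorem[OF tends_ip[OF T(2)[OF m(2)] m(1)] _ sum, THEN conjunct2, THEN conjunct2])
      have "norm (ip H (\<xi> k) (S F (\<eta> k))) \<le> \<bar>C\<bar> * ((nm (\<xi> k))\<^sup>2 + (nm (\<eta> k))\<^sup>2)"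
        if F: "finite F" "F \<subseteq> J" for k F
      proof -
        let ?x = "nm (\<xi> k)" and ?y = "nm (\<eta> k)"
        have "norm (ip H (\<xi> k) (S F (\<eta> k))) \<le> ?x * nm (S F (\<eta> k))"
          by (intro Cauchy_Schwarz m bounded_opsD(1)[OF S[OF F]])
        also have "\<dots> \<le> ?x * (\<bar>C\<bar> * ?y)"
          by (intro mult_left_mono order_trans[OF C[OF F m(2)]] mult_right_mono) (auto simp: m)
        also have "\<dots> = \<bar>C\<bar> * (?x * ?y)" by simp
        also have "\<dots> \<le> \<bar>C\<bar> * (?x\<^sup>2 + ?y\<^sup>2)"
        proof (intro mult_left_mono)
          show "?x * ?y \<le> ?x\<^sup>2 + ?y\<^sup>2"
            using sum_squares_bound[of ?x ?y] mult_nonneg_nonneg[OF ipnorm_nonneg[OF m(1)[of k]] ipnorm_nonneg[OF m(2)[of k]]]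
            by linarith
        qed simp
        finally show ?thesis .
      qed
      then show "\<forall>\<^sub>F (k, F) in sequentially \<times>\<^sub>F fsets J.
          norm (ip H (\<xi> k) (S F (\<eta> k))) \<le> \<bar>C\<bar> * ((nm (\<xi> k))\<^sup>2 + (nm (\<eta> k))\<^sup>2)"
        unfolding eventually_prod_filter
        by (intro exI[of _ "\<lambda>_. True"] exI[of _ "\<lambda>F. finite F \<and> F \<subseteq> J"])
          (auto intro: eventually_finite_subsets_at_top_weakI)
    qed simp
    then have "\<forall>\<^sub>F F in fsets J. (\<Sum>n. ip H (\<xi> n) (S F (\<eta> n))) \<in> U"
      using U TW W by (auto simp: tendsto_def)
    moreover have "\<forall>\<^sub>F F in fsets J. S F \<in> bounded_ops H"
      using S by (rule eventually_finite_subsets_at_top_weakI)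
    ultimately show "\<forall>\<^sub>F F in fsets J. S F \<in> W"
      by eventually_elim (simp add: W)
  qed
  then show ?thesis by (simp add: ultraweak_topology_def \<B>_def)
qed

end

context hilbert_space
begin

text \<open>A single matrix coefficient is the ultraweak functional of two sequences supported at
  index 0.\<close>

lemma ultraweak_imp_weak:
  assumes lim: "limitin (ultraweak_topology H) S T F" and m: "\<xi> \<in> vecs H" "\<eta> \<in> vecs H"
  shows "((\<lambda>i. ip H \<xi> (S i \<eta>)) \<longlongrightarrow> ip H \<xi> (T \<eta>)) F"
proof (rule topological_tendstoI)
  define \<xi>' \<eta>' where "\<xi>' = (\<lambda>n::nat. if n = 0 then \<xi> else 0)" and "\<eta>' = (\<lambda>n::nat. if n = 0 then \<eta> else 0)"
  have ss: "square_summable H \<xi>'" "square_summable H \<eta>'"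
    unfolding square_summable_def \<xi>'_def \<eta>'_def using m
    by (auto intro!: summable_finite[of "{0}"] split: if_splits)
  have sum: "(\<Sum>n. ip H (\<xi>' n) (R (\<eta>' n))) = ip H \<xi> (R \<eta>)" if "R \<in> bounded_ops H" for R
    using that m by (subst suminf_finite[of "{0}"]) (auto simp: \<xi>'_def \<eta>'_def bounded_ops_zero)
  have T: "T \<in> bounded_ops H"
    using lim unfolding limitin_def ultraweak_topology_def topology_generated_by_topspace by blast
  fix U assume U: "open U" "ip H \<xi> (T \<eta>) \<in> U"
  define W where "W = {T \<in> bounded_ops H. (\<Sum>n. ip H (\<xi>' n) (T (\<eta>' n))) \<in> U}"
  have "openin (ultraweak_topology H) W"
    unfolding W_def ultraweak_topology_def by (rule topology_generated_by_Basis) (use ss U in blast)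
  moreover have "T \<in> W" using T U sum[OF T] by (simp add: W_def)
  ultimately have "\<forall>\<^sub>F i in F. S i \<in> W" using lim unfolding limitin_def by blast
  then show "\<forall>\<^sub>F i in F. ip H \<xi> (S i \<eta>) \<in> U"
    by eventually_elim (use sum in \<open>auto simp: W_def\<close>)
qed

end

section \<open>The universal representation\<close>

text \<open>The assumption \<open>bounded\<close> replaces the C*-norm: an inequality between
  \<open>adj a\<close> times \<open>a\<close> and a multiple of the unit is all that is needed to
  make left multiplication bounded in every GNS space.\<close>

locale star_algebra =
  fixes A :: "('a::ab_group_add) cstar"
  assumes zero_in: "0 \<in> carrier A"
    and add_in: "\<And>a b. a \<in> carrier A \<Longrightarrow> b \<in> carrier A \<Longrightarrow> a + b \<in> carrier A"
    and uminus_in: "\<And>a. a \<in> carrier A \<Longrightarrow> - a \<in> carrier A"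
    and scale_in: "\<And>c a. a \<in> carrier A \<Longrightarrow> scale A c a \<in> carrier A"
    and mul_in: "\<And>a b. a \<in> carrier A \<Longrightarrow> b \<in> carrier A \<Longrightarrow> mul A a b \<in> carrier A"
    and adj_in: "\<And>a. a \<in> carrier A \<Longrightarrow> adj A a \<in> carrier A"
    and mul_assoc: "\<And>a b c. a \<in> carrier A \<Longrightarrow> b \<in> carrier A \<Longrightarrow> c \<in> carrier A \<Longrightarrow>
      mul A (mul A a b) c = mul A a (mul A b c)"
    and mul_add_left: "\<And>a b c. a \<in> carrier A \<Longrightarrow> b \<in> carrier A \<Longrightarrow> c \<in> carrier A \<Longrightarrow>
      mul A (a + b) c = mul A a c + mul A b c"
    and mul_add_right: "\<And>a b c. a \<in> carrier A \<Longrightarrow> b \<in> carrier A \<Longrightarrow> c \<in> carrier A \<Longrightarrow>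
      mul A a (b + c) = mul A a b + mul A a c"
    and mul_scale_left: "\<And>c a b. a \<in> carrier A \<Longrightarrow> b \<in> carrier A \<Longrightarrow>
      mul A (scale A c a) b = scale A c (mul A a b)"
    and mul_scale_right: "\<And>c a b. a \<in> carrier A \<Longrightarrow> b \<in> carrier A \<Longrightarrow>
      mul A a (scale A c b) = scale A c (mul A a b)"
    and adj_add: "\<And>a b. a \<in> carrier A \<Longrightarrow> b \<in> carrier A \<Longrightarrow> adj A (a + b) = adj A a + adj A b"
    and adj_mul: "\<And>a b. a \<in> carrier A \<Longrightarrow> b \<in> carrier A \<Longrightarrow> adj A (mul A a b) = mul A (adj A b) (adj A a)"
    and adj_adj: "\<And>a. a \<in> carrier A \<Longrightarrow> adj A (adj A a) = a"
    and adj_scale: "\<And>c a. a \<in> carrier A \<Longrightarrow> adj A (scale A c a) = scale A (cnj c) (adj A a)"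
    and is_unit: "is_unit_of A (unit_of A)"
    and bounded: "\<And>a. a \<in> carrier A \<Longrightarrow>
      \<exists>C\<ge>0. alg_le A (mul A (adj A a) a) (scale A (of_real C) (unit_of A))"
begin

abbreviation \<u> where "\<u> \<equiv> unit_of A"

lemma unit_in: "\<u> \<in> carrier A" and mul_unit: "a \<in> carrier A \<Longrightarrow> mul A a \<u> = a" "a \<in> carrier A \<Longrightarrow> mul A \<u> a = a"
  using is_unit by (auto simp: is_unit_of_def)

lemma diff_in: "a \<in> carrier A \<Longrightarrow> b \<in> carrier A \<Longrightarrow> a - b \<in> carrier A"
  using add_in[OF _ uminus_in] by fastforce

lemmas closed = zero_in add_in uminus_in diff_in scale_in mul_in adj_in unit_in

lemma mul_diff_right:
  "a \<in> carrier A \<Longrightarrow> b \<in> carrier A \<Longrightarrow> c \<in> carrier A \<Longrightarrow> mul A a (b - c) = mul A a b - mul A a c"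
  using mul_add_right[of a "b - c" c] by (simp add: closed eq_diff_eq)

lemma mul_diff_left:
  "a \<in> carrier A \<Longrightarrow> b \<in> carrier A \<Longrightarrow> c \<in> carrier A \<Longrightarrow> mul A (a - b) c = mul A a c - mul A b c"
  using mul_add_left[of "a - b" b c] by (simp add: closed eq_diff_eq)

lemma adj_unit: "adj A \<u> = \<u>"
proof -
  have "adj A (mul A \<u> (adj A \<u>)) = mul A \<u> (adj A \<u>)"
    by (simp add: adj_mul adj_adj closed)
  then show ?thesis by (simp add: mul_unit adj_adj closed)
qed

lemma adj_diff: "a \<in> carrier A \<Longrightarrow> b \<in> carrier A \<Longrightarrow> adj A (a - b) = adj A a - adj A b"
  using adj_add[of "a - b" b] by (simp add: closed eq_diff_eq)

lemma stateD:
  assumes "\<phi> \<in> states A"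
  shows "a \<in> carrier A \<Longrightarrow> b \<in> carrier A \<Longrightarrow> \<phi> (a + b) = \<phi> a + \<phi> b"
    "a \<in> carrier A \<Longrightarrow> \<phi> (scale A c a) = c * \<phi> a"
    "a \<in> carrier A \<Longrightarrow> \<phi> (mul A (adj A a) a) \<in> \<real>\<^sub>\<ge>\<^sub>0" "\<phi> \<u> = 1" "a \<notin> carrier A \<Longrightarrow> \<phi> a = 0"
  using assms by (auto simp: states_def)

lemma state_diff: "\<phi> \<in> states A \<Longrightarrow> a \<in> carrier A \<Longrightarrow> b \<in> carrier A \<Longrightarrow> \<phi> (a - b) = \<phi> a - \<phi> b"
  using stateD(1)[of \<phi> "a - b" b] by (simp add: closed)

text \<open>Positivity at \<open>\<u> + b\<close> makes \<open>\<phi> b + \<phi> (adj A b)\<close>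
  real. Taking \<open>b = a\<close> compares imaginary parts, and \<open>b = \<i> a\<close> compares
  real parts.\<close>

lemma state_adj:
  assumes \<phi>: "\<phi> \<in> states A" and a: "a \<in> carrier A"
  shows "\<phi> (adj A a) = cnj (\<phi> a)"
proof -
  have Im0: "Im (\<phi> b + \<phi> (adj A b)) = 0" if b: "b \<in> carrier A" for b
  proof -
    have "\<phi> (mul A (adj A (\<u> + b)) (\<u> + b)) = 1 + \<phi> b + \<phi> (adj A b) + \<phi> (mul A (adj A b) b)"
      using b by (simp add: adj_add adj_unit mul_add_left mul_add_right mul_unit closed stateD(1,4)[OF \<phi>])
    moreover have "Im (\<phi> (mul A (adj A (\<u> + b)) (\<u> + b))) = 0" "Im (\<phi> (mul A (adj A b) b)) = 0"
      using stateD(3)[OF \<phi>, of "\<u> + b"] stateD(3)[OF \<phi> b] b by (auto simp: complex_nonneg_Reals_iff closed)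
    ultimately show ?thesis by simp
  qed
  have "Im (\<i> * \<phi> a - \<i> * \<phi> (adj A a)) = 0"
    using Im0[of "scale A \<i> a"] a by (simp add: adj_scale stateD(2)[OF \<phi>] closed)
  then show ?thesis using Im0[OF a] by (auto simp: complex_eq_iff)
qed

section \<open>The GNS space of a single state\<close>

definition pre :: "('a \<Rightarrow> complex) \<Rightarrow> 'a inner_space" where
  "pre \<phi> = \<lparr> vecs = carrier A, smul = scale A, ip = (\<lambda>a b. \<phi> (mul A (adj A a) b)) \<rparr>"

lemma pre_simps: "vecs (pre \<phi>) = carrier A" "smul (pre \<phi>) = scale A" "ip (pre \<phi>) a b = \<phi> (mul A (adj A a) b)"
  by (simp_all add: pre_def)

lemma gns_space_pre: "gns_space A \<phi> = completion (pre \<phi>)"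
  by (simp add: gns_space_def pre_def)

lemma semi_pre:
  assumes \<phi>: "\<phi> \<in> states A"
  shows "semi_inner_space (pre \<phi>)"
proof
  fix x y assume xy: "x \<in> vecs (pre \<phi>)" "y \<in> vecs (pre \<phi>)"
  then have "adj A (mul A (adj A x) y) = mul A (adj A y) x"
    by (simp add: pre_simps adj_mul adj_adj closed)
  then show "ip (pre \<phi>) y x = cnj (ip (pre \<phi>) x y)"
    using xy by (simp add: pre_simps closed flip: state_adj[OF \<phi>])
next
  fix x assume "x \<in> vecs (pre \<phi>)"
  then show "0 \<le> Re (ip (pre \<phi>) x x)"
    using stateD(3)[OF \<phi>] by (simp add: pre_simps complex_nonneg_Reals_iff)
qed (simp_all add: pre_simps closed mul_add_right mul_scale_right stateD(1,2)[OF \<phi>])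

lemma hilbert_gns: "\<phi> \<in> states A \<Longrightarrow> hilbert_space (gns_space A \<phi>)"
  unfolding gns_space_pre by (intro semi_inner_space.hilbert_space_completion semi_pre)

text \<open>If \<open>d\<close> witnesses the order relation \<open>le\<close>, then the squared
  seminorm of \<open>d x\<close> is \<open>C\<close> times that of \<open>x\<close> minus that of
  \<open>a x\<close>, and it is nonnegative.\<close>

lemma pre_mul_bound:
  assumes \<phi>: "\<phi> \<in> states A" and a: "a \<in> carrier A" and x: "x \<in> carrier A" and C: "0 \<le> C"
    and le: "alg_le A (mul A (adj A a) a) (scale A (of_real C) \<u>)"
  shows "ipnorm (pre \<phi>) (mul A a x) \<le> sqrt C * ipnorm (pre \<phi>) x"
proof -
  obtain d where d: "d \<in> carrier A" "scale A (of_real C) \<u> - mul A (adj A a) a = mul A (adj A d) d"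
    using le by (auto simp: alg_le_def)
  have "mul A (adj A (mul A d x)) (mul A d x) = mul A (adj A x) (mul A (mul A (adj A d) d) x)"
    using d x by (simp add: adj_mul mul_assoc closed)
  also have "\<dots> = scale A (of_real C) (mul A (adj A x) x) - mul A (adj A (mul A a x)) (mul A a x)"
    using a x by (simp add: d(2)[symmetric] adj_mul mul_assoc mul_diff_left mul_diff_right
      mul_scale_left mul_scale_right mul_unit closed)
  finally have "0 \<le> Re (C * \<phi> (mul A (adj A x) x) - \<phi> (mul A (adj A (mul A a x)) (mul A a x)))"
    using stateD(3)[OF \<phi>, of "mul A d x"] d a x
    by (simp add: state_diff[OF \<phi>] stateD(2)[OF \<phi>] closed complex_nonneg_Reals_iff)
  then show ?thesis
    by (simp add: ipnorm_def pre_simps flip: real_sqrt_mult)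
qed

lemma gns_rep_represents:
  assumes \<phi>: "\<phi> \<in> states A" and a: "a \<in> carrier A" and r: "represents (pre \<phi>) x f"
  shows "represents (pre \<phi>) (\<lambda>n. mul A a (x n)) (gns_rep A a f)"
proof -
  interpret semi_inner_space "pre \<phi>" by (rule semi_pre[OF \<phi>])
  obtain C where C: "0 \<le> C" "alg_le A (mul A (adj A a) a) (scale A (of_real C) \<u>)" using bounded[OF a] by blast
  have "represents (pre \<phi>) (\<lambda>n. mul A a (x n)) (\<lambda>b. if b \<in> vecs (pre \<phi>) then f (mul A (adj A a) b) else 0)"
  proof (rule represents_image[OF r])
    fix u v assume uv: "u \<in> vecs (pre \<phi>)" "v \<in> vecs (pre \<phi>)"
    show "ip (pre \<phi>) v (mul A a u) = ip (pre \<phi>) (mul A (adj A a) v) u"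
      using uv a by (simp add: pre_simps adj_mul adj_adj mul_assoc closed)
    show "ipnorm (pre \<phi>) (mul A a u - mul A a v) \<le> sqrt C * ipnorm (pre \<phi>) (u - v)"
      using pre_mul_bound[OF \<phi> a _ C, of "u - v"] uv a by (simp add: pre_simps closed mul_diff_right)
  qed (use a in \<open>auto simp: pre_simps closed\<close>)
  then show ?thesis by (simp add: gns_rep_def pre_simps)
qed

lemma gns_obtain:
  assumes "f \<in> vecs (gns_space A \<phi>)" and \<phi>: "\<phi> \<in> states A"
  obtains x where "represents (pre \<phi>) x f"
  using assms semi_inner_space.in_completion_iff[OF semi_pre[OF \<phi>]] unfolding gns_space_pre by blast

lemma gns_rep_in:
  assumes "\<phi> \<in> states A" "a \<in> carrier A" "f \<in> vecs (gns_space A \<phi>)"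
  shows "gns_rep A a f \<in> vecs (gns_space A \<phi>)"
  using gns_rep_represents[OF assms(1,2)] gns_obtain[OF assms(3,1)]
    semi_inner_space.in_completion_iff[OF semi_pre[OF assms(1)]]
  unfolding gns_space_pre by metis

lemma gns_rep_bound:
  assumes \<phi>: "\<phi> \<in> states A" and a: "a \<in> carrier A" and f: "f \<in> vecs (gns_space A \<phi>)" and C: "0 \<le> C"
    and le: "alg_le A (mul A (adj A a) a) (scale A (of_real C) \<u>)"
  shows "ipnorm (gns_space A \<phi>) (gns_rep A a f) \<le> sqrt C * ipnorm (gns_space A \<phi>) f"
proof -
  interpret semi_inner_space "pre \<phi>" by (rule semi_pre[OF \<phi>])
  obtain x where r: "represents (pre \<phi>) x f" using gns_obtain[OF f \<phi>] .
  show ?thesis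
    unfolding gns_space_pre
  proof (rule LIMSEQ_le)
    show "(\<lambda>n. ipnorm (pre \<phi>) (mul A a (x n))) \<longlonglongrightarrow> ipnorm (completion (pre \<phi>)) (gns_rep A a f)"
      by (rule ipnorm_completion_tendsto[OF gns_rep_represents[OF \<phi> a r]])
    show "(\<lambda>n. sqrt C * ipnorm (pre \<phi>) (x n)) \<longlonglongrightarrow> sqrt C * ipnorm (completion (pre \<phi>)) f"
      by (intro tendsto_intros ipnorm_completion_tendsto r)
    show "\<exists>N. \<forall>n\<ge>N. ipnorm (pre \<phi>) (mul A a (x n)) \<le> sqrt C * ipnorm (pre \<phi>) (x n)"
      using pre_mul_bound[OF \<phi> a _ C le] representsD(2)[OF r] by (auto simp: pre_simps)
  qed
qed

lemma gns_rep_adj: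
  assumes \<phi>: "\<phi> \<in> states A" and a: "a \<in> carrier A"
    and f: "f \<in> vecs (gns_space A \<phi>)" and g: "g \<in> vecs (gns_space A \<phi>)"
  shows "ip (gns_space A \<phi>) f (gns_rep A (adj A a) g) = ip (gns_space A \<phi>) (gns_rep A a f) g"
proof -
  interpret semi_inner_space "pre \<phi>" by (rule semi_pre[OF \<phi>])
  obtain x where x: "represents (pre \<phi>) x f" using gns_obtain[OF f \<phi>] .
  obtain y where y: "represents (pre \<phi>) y g" using gns_obtain[OF g \<phi>] .
  have "ip (pre \<phi>) (x n) (mul A (adj A a) (y n)) = ip (pre \<phi>) (mul A a (x n)) (y n)" for n
    using representsD(2)[OF x, of n] representsD(2)[OF y, of n] a
    by (simp add: pre_simps adj_mul mul_assoc closed)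
  then show ?thesis
    using ip_completion_tendsto[OF x gns_rep_represents[OF \<phi> adj_in[OF a] y]]
      ip_completion_tendsto[OF gns_rep_represents[OF \<phi> a x] y] LIMSEQ_unique
    unfolding gns_space_pre by auto
qed

text \<open>Elements of the completion are conjugate-linear functionals. Since
  \<open>gns_rep\<close> places \<open>adj A a\<close> in the argument, linearity of the
  representation in \<open>a\<close> rests on this.\<close>

lemma gns_vector_additive:
  assumes \<phi>: "\<phi> \<in> states A" and f: "f \<in> vecs (gns_space A \<phi>)" and vw: "v \<in> carrier A" "w \<in> carrier A"
  shows "f (v + w) = f v + f w" "f (scale A c v) = cnj c * f v"
proof -
  interpret semi_inner_space "pre \<phi>" by (rule semi_pre[OF \<phi>])
  obtain x where r: "represents (pre \<phi>) x f" using gns_obtain[OF f \<phi>] .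
  note lim = representsD(3)[OF r]
  have V: "v \<in> vecs (pre \<phi>)" "w \<in> vecs (pre \<phi>)" using vw by (simp_all add: pre_simps)
  show "f (v + w) = f v + f w"
    using LIMSEQ_unique[OF lim[OF add_in[OF V]]] tendsto_add[OF lim[OF V(1)] lim[OF V(2)]]
    by (simp add: ip_add_left[OF V representsD(2)[OF r]])
  show "f (scale A c v) = cnj c * f v"
    using LIMSEQ_unique[OF lim[OF smul_in[OF V(1)]]] tendsto_mult_left[OF lim[OF V(1)], of "cnj c"]
    by (simp add: ip_smul_left[OF V(1) representsD(2)[OF r]] flip: pre_simps(2)[of \<phi>])
qed

section \<open>The Hilbert sum over all states\<close>

sublocale gns: hilbert_family "states A" "gns_space A"
  by (rule hilbert_family.intro) (rule hilbert_gns)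

abbreviation HA where "HA \<equiv> universal_space A"
abbreviation \<pi> where "\<pi> \<equiv> universal_rep A"

lemma HA_eq: "HA = hilbert_sum (states A) (gns_space A)"
  by (simp add: universal_space_def)

sublocale HA: hilbert_space HA
  unfolding HA_eq by (rule gns.hilbert_space_sum)

lemma HA_D:
  assumes "\<xi> \<in> vecs HA"
  shows "\<phi> \<in> states A \<Longrightarrow> \<xi> \<phi> \<in> vecs (gns_space A \<phi>)" "\<phi> \<notin> states A \<Longrightarrow> \<xi> \<phi> = 0"
  using gns.in_sumD[of \<xi>] assms unfolding HA_eq by auto

lemma rep_apply: "\<xi> \<in> vecs HA \<Longrightarrow> \<pi> a \<xi> \<phi> = gns_rep A a (\<xi> \<phi>)"
  by (simp add: universal_rep_def)

lemma gns_rep_zero: "gns_rep A a 0 = 0"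
  by (auto simp: gns_rep_def)

lemma rep_in_and_bound:
  assumes a: "a \<in> carrier A" and \<xi>: "\<xi> \<in> vecs HA" and C: "0 \<le> C"
    and le: "alg_le A (mul A (adj A a) a) (scale A (of_real C) \<u>)"
  shows "\<pi> a \<xi> \<in> vecs HA" "ipnorm HA (\<pi> a \<xi>) \<le> sqrt C * ipnorm HA \<xi>"
proof -
  have b: "(ipnorm (gns_space A \<phi>) (\<pi> a \<xi> \<phi>))\<^sup>2 \<le> C * (ipnorm (gns_space A \<phi>) (\<xi> \<phi>))\<^sup>2"
    if \<phi>: "\<phi> \<in> states A" for \<phi>
  proof -
    interpret hilbert_space "gns_space A \<phi>" by (rule hilbert_gns[OF \<phi>])
    have "(ipnorm (gns_space A \<phi>) (\<pi> a \<xi> \<phi>))\<^sup>2 \<le> (sqrt C * ipnorm (gns_space A \<phi>) (\<xi> \<phi>))\<^sup>2"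
      unfolding rep_apply[OF \<xi>]
      using gns_rep_bound[OF \<phi> a HA_D(1)[OF \<xi> \<phi>] C le] gns_rep_in[OF \<phi> a HA_D(1)[OF \<xi> \<phi>]]
      by (intro power_mono) auto
    then show ?thesis using C by (simp add: power_mult_distrib)
  qed
  have s: "(\<lambda>\<phi>. C * (ipnorm (gns_space A \<phi>) (\<xi> \<phi>))\<^sup>2) summable_on states A"
    using gns.in_sumD(3) \<xi> unfolding HA_eq by (intro summable_on_cmult_right)
  show m: "\<pi> a \<xi> \<in> vecs HA"
    unfolding HA_eq
  proof (rule gns.in_sum_bound[OF _ _ s b])
    fix \<phi> assume "\<phi> \<in> states A"
    then show "\<pi> a \<xi> \<phi> \<in> vecs (gns_space A \<phi>)"
      by (simp add: rep_apply[OF \<xi>] gns_rep_in[OF _ a] HA_D(1)[OF \<xi>])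
  next
    fix \<phi> assume "\<phi> \<notin> states A"
    then show "\<pi> a \<xi> \<phi> = 0" by (simp add: rep_apply[OF \<xi>] HA_D(2)[OF \<xi>] gns_rep_zero)
  qed
  have "(ipnorm HA (\<pi> a \<xi>))\<^sup>2 \<le> C * (ipnorm HA \<xi>)\<^sup>2"
    using gns.ipnorm_sum[of \<xi>] gns.ipnorm_sum[of "\<pi> a \<xi>"] gns.in_sumD(3)[of "\<pi> a \<xi>"] m \<xi> b s
    unfolding HA_eq[symmetric] by (simp add: infsum_mono flip: infsum_cmult_right')
  then have "sqrt ((ipnorm HA (\<pi> a \<xi>))\<^sup>2) \<le> sqrt (C * (ipnorm HA \<xi>)\<^sup>2)" by (rule real_sqrt_le_mono)
  then show "ipnorm HA (\<pi> a \<xi>) \<le> sqrt C * ipnorm HA \<xi>"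
    using m \<xi> by (simp add: real_sqrt_mult)
qed

lemma rep_in: "a \<in> carrier A \<Longrightarrow> \<xi> \<in> vecs HA \<Longrightarrow> \<pi> a \<xi> \<in> vecs HA"
  using rep_in_and_bound(1) bounded by blast

lemma rep_add:
  assumes "a \<in> carrier A" "b \<in> carrier A" "\<xi> \<in> vecs HA"
  shows "\<pi> (a + b) \<xi> = \<pi> a \<xi> + \<pi> b \<xi>"
proof -
  have "gns_rep A (a + b) (\<xi> \<phi>) v = gns_rep A a (\<xi> \<phi>) v + gns_rep A b (\<xi> \<phi>) v" for \<phi> v
    using gns_vector_additive(1)[OF _ HA_D(1)[OF assms(3)]] HA_D(2)[OF assms(3), of \<phi>] assms
    by (cases "\<phi> \<in> states A") (auto simp: gns_rep_def adj_add mul_add_left closed)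
  then show ?thesis using assms by (auto simp: rep_apply fun_eq_iff)
qed

lemma rep_diff:
  assumes "a \<in> carrier A" "b \<in> carrier A" "\<xi> \<in> vecs HA"
  shows "\<pi> (a - b) \<xi> = \<pi> a \<xi> - \<pi> b \<xi>"
  using rep_add[of "a - b" b \<xi>] assms by (simp add: closed eq_diff_eq)

lemma rep_scale:
  assumes "a \<in> carrier A" "\<xi> \<in> vecs HA"
  shows "\<pi> (scale A c a) \<xi> = smul HA c (\<pi> a \<xi>)"
proof -
  have "gns_rep A (scale A c a) (\<xi> \<phi>) v = (if \<phi> \<in> states A then c * gns_rep A a (\<xi> \<phi>) v else 0)" for \<phi> v
    using gns_vector_additive(2)[OF _ HA_D(1)[OF assms(2)]] HA_D(2)[OF assms(2), of \<phi>] assms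
    by (cases "\<phi> \<in> states A") (auto simp: gns_rep_def adj_scale mul_scale_left closed)
  then show ?thesis
    using assms
    by (auto simp: rep_apply fun_eq_iff HA_eq hilbert_sum_def gns_space_def completion_def)
qed

lemma rep_mul:
  assumes "a \<in> carrier A" "b \<in> carrier A" "\<xi> \<in> vecs HA"
  shows "\<pi> (mul A a b) \<xi> = \<pi> a (\<pi> b \<xi>)"
  using assms by (auto simp: rep_apply rep_in fun_eq_iff gns_rep_def adj_mul mul_assoc closed)

lemma rep_unit:
  assumes "\<xi> \<in> vecs HA"
  shows "\<pi> \<u> \<xi> = \<xi>"
proof -
  have "gns_rep A \<u> (\<xi> \<phi>) v = \<xi> \<phi> v" for \<phi> v
  proof (cases "\<phi> \<in> states A")
    case True
    interpret semi_inner_space "pre \<phi>" by (rule semi_pre[OF True])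
    obtain x where "represents (pre \<phi>) x (\<xi> \<phi>)" using gns_obtain[OF HA_D(1)[OF assms True] True] .
    then have "v \<notin> carrier A \<Longrightarrow> \<xi> \<phi> v = 0" using representsD(4) by (simp add: pre_simps)
    then show ?thesis by (simp add: gns_rep_def adj_unit mul_unit)
  qed (simp add: gns_rep_zero HA_D(2)[OF assms])
  then show ?thesis using assms by (auto simp: rep_apply fun_eq_iff)
qed

lemma rep_adj:
  assumes a: "a \<in> carrier A" and m: "\<xi> \<in> vecs HA" "\<eta> \<in> vecs HA"
  shows "ip HA \<xi> (\<pi> (adj A a) \<eta>) = ip HA (\<pi> a \<xi>) \<eta>"
  unfolding HA_eq gns.ip_sum
  by (rule infsum_cong) (simp add: rep_apply m gns_rep_adj a HA_D)

lemma rep_bounded_ops: "a \<in> carrier A \<Longrightarrow> \<pi> a \<in> bounded_ops HA"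
proof -
  assume a: "a \<in> carrier A"
  obtain C where C: "0 \<le> C" "alg_le A (mul A (adj A a) a) (scale A (of_real C) \<u>)" using bounded[OF a] by blast
  show ?thesis
  proof (rule HA.bounded_opsI[OF rep_in[OF a]])
    show "\<pi> a \<xi> = 0" if "\<xi> \<notin> vecs HA" for \<xi> using that by (simp add: universal_rep_def)
    show "\<pi> a (\<xi> + \<eta>) = \<pi> a \<xi> + \<pi> a \<eta>" if "\<xi> \<in> vecs HA" "\<eta> \<in> vecs HA" for \<xi> \<eta>
      using that by (auto simp: rep_apply fun_eq_iff gns_rep_def)
    show "\<pi> a (smul HA c \<xi>) = smul HA c (\<pi> a \<xi>)" if "\<xi> \<in> vecs HA" for c \<xi>
    proof -
      have "smul HA c \<xi> \<in> vecs HA" using that by simp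
      then show ?thesis using that
        by (auto simp: rep_apply fun_eq_iff gns_rep_def HA_eq hilbert_sum_def gns_space_def completion_def)
    qed
    show "ipnorm HA (\<pi> a \<xi>) \<le> sqrt C * ipnorm HA \<xi>" if "\<xi> \<in> vecs HA" for \<xi>
      by (rule rep_in_and_bound(2)[OF a that C])
  qed
qed

lemma rep_in_enveloping: "a \<in> carrier A \<Longrightarrow> \<pi> a \<in> enveloping_vN A"
  unfolding enveloping_vN_def by (auto simp: commutant_def rep_bounded_ops)

text \<open>With \<open>b - a\<close> the product of \<open>adj A d\<close> and \<open>d\<close>,
  the quadratic form is the squared norm of \<open>\<pi> d \<xi>\<close>.\<close>

lemma rep_positive:
  assumes le: "alg_le A a b" and ab: "a \<in> carrier A" "b \<in> carrier A" and \<xi>: "\<xi> \<in> vecs HA"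
  shows "ip HA \<xi> (\<pi> b \<xi> - \<pi> a \<xi>) \<in> \<real>\<^sub>\<ge>\<^sub>0"
proof -
  obtain d where d: "d \<in> carrier A" "b - a = mul A (adj A d) d" using le by (auto simp: alg_le_def)
  have "\<pi> b \<xi> - \<pi> a \<xi> = \<pi> (adj A d) (\<pi> d \<xi>)"
    using d ab \<xi> by (simp add: closed flip: rep_diff rep_mul)
  then have "ip HA \<xi> (\<pi> b \<xi> - \<pi> a \<xi>) = ip HA (\<pi> d \<xi>) (\<pi> d \<xi>)"
    using rep_adj[OF d(1) \<xi> rep_in[OF d(1) \<xi>]] by simp
  then show ?thesis
    using HA.ip_self[OF rep_in[OF d(1) \<xi>]] by (simp del: of_real_power)
qed

lemma rep_mono:
  assumes "alg_le A a b" "a \<in> carrier A" "b \<in> carrier A" "\<xi> \<in> vecs HA"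
  shows "Re (ip HA \<xi> (\<pi> a \<xi>)) \<le> Re (ip HA \<xi> (\<pi> b \<xi>))"
  using rep_positive[OF assms] assms by (simp add: HA.ip_diff_right rep_in complex_nonneg_Reals_iff)

text \<open>The cyclic vector of the GNS representation of \<open>\<phi>\<close>, placed in its own
  summand of the universal space.\<close>

definition vector_of :: "('a \<Rightarrow> complex) \<Rightarrow> ('a \<Rightarrow> complex) \<Rightarrow> 'a \<Rightarrow> complex" where
  "vector_of \<phi> = (\<lambda>\<psi>. if \<psi> = \<phi> then semi_inner_space.embed (pre \<phi>) \<u> else 0)"

text \<open>The representation sends the class of the unit to the class of \<open>a\<close>, and
  pairing this with the class of the unit gives \<open>\<phi> a\<close>. Thus scalar values of a
  state can be read off from operators, also after an ultraweak limit.\<close>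

lemma vector_of_state:
  assumes \<phi>: "\<phi> \<in> states A"
  shows "vector_of \<phi> \<in> vecs HA" and "a \<in> carrier A \<Longrightarrow> ip HA (vector_of \<phi>) (\<pi> a (vector_of \<phi>)) = \<phi> a"
proof -
  interpret semi_inner_space "pre \<phi>" by (rule semi_pre[OF \<phi>])
  have e: "embed b \<in> vecs (gns_space A \<phi>)" if "b \<in> carrier A" for b
    unfolding gns_space_pre using that by (intro embed_in) (simp add: pre_simps)
  have "(\<lambda>\<psi>. (ipnorm (gns_space A \<psi>) (vector_of \<phi> \<psi>))\<^sup>2) summable_on states A"
    by (rule finite_nonzero_values_imp_summable_on, rule finite_subset[of _ "{\<phi>}"])
      (auto simp: vector_of_def semi_inner_space.ipnorm_zero[OF gns.semi])
  then show V: "vector_of \<phi> \<in> vecs HA"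
    unfolding HA_eq gns.in_sum_iff using e[OF unit_in] \<phi>
    by (auto simp: vector_of_def gns.comp_in)
  assume a: "a \<in> carrier A"
  have "ip HA (vector_of \<phi>) (\<pi> a (vector_of \<phi>))
      = (\<Sum>\<^sub>\<infinity>\<psi>\<in>{\<phi>}. ip (gns_space A \<psi>) (vector_of \<phi> \<psi>) (\<pi> a (vector_of \<phi>) \<psi>))"
    unfolding HA_eq gns.ip_sum
    by (rule infsum_cong_neutral)
      (use \<phi> HA_D(1)[OF rep_in[OF a V]] in
        \<open>auto simp: vector_of_def semi_inner_space.ip_zero_left[OF gns.semi]\<close>)
  also have "\<dots> = ip (gns_space A \<phi>) (embed \<u>) (gns_rep A a (embed \<u>))"
    by (simp add: rep_apply[OF V]) (simp add: vector_of_def)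
  also have "gns_rep A a (embed \<u>) = embed a"
    using a by (auto simp: gns_rep_def embed_def pre_simps adj_mul adj_adj mul_assoc mul_unit closed fun_eq_iff)
  finally show "ip HA (vector_of \<phi>) (\<pi> a (vector_of \<phi>)) = \<phi> a"
    using a by (simp add: gns_space_pre ip_completion_embed pre_simps closed adj_unit mul_unit)
qed

text \<open>For an increment \<open>d = a G - a F\<close>, assumption \<open>sq\<close> says
  \<open>d^2 \<le> C d\<close>. Hence the squared norm of \<open>\<pi> d \<xi>\<close> is at most
  \<open>C\<close> times the increment of a quadratic form, and these forms are bounded by
  \<open>bound\<close>. So the net is strongly Cauchy, and its limit is both ultraweak and in the
  bicommutant.\<close>

lemma monotone_net_limit:
  assumes a: "\<And>F. finite F \<Longrightarrow> F \<subseteq> J \<Longrightarrow> a F \<in> carrier A"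
    and sa: "\<And>F. finite F \<Longrightarrow> F \<subseteq> J \<Longrightarrow> adj A (a F) = a F" and a0: "a {} = 0"
    and C: "0 < C" and bound: "\<And>F. finite F \<Longrightarrow> F \<subseteq> J \<Longrightarrow> alg_le A (a F) (scale A (of_real C) \<u>)"
    and sq: "\<And>F G. finite G \<Longrightarrow> F \<subseteq> G \<Longrightarrow> G \<subseteq> J \<Longrightarrow>
      alg_le A (mul A (a G - a F) (a G - a F)) (scale A (of_real C) (a G - a F))"
  shows "\<exists>T\<in>enveloping_vN A. limitin (ultraweak_topology HA) (\<lambda>F. \<pi> (a F)) T (fsets J)"
proof -
  have r: "Re (ip HA \<xi> (\<pi> (a F) \<xi>)) \<le> C * (ipnorm HA \<xi>)\<^sup>2"
    if F: "finite F" "F \<subseteq> J" and \<xi>: "\<xi> \<in> vecs HA" for F \<xi>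
    using rep_mono[OF bound[OF F] a[OF F] _ \<xi>] \<xi>
    by (simp add: closed rep_scale rep_unit HA.ip_smul_right HA.ipnorm_power2)
  have incr: "(ipnorm HA (\<pi> (a G) \<xi> - \<pi> (a F) \<xi>))\<^sup>2
      \<le> C * (Re (ip HA \<xi> (\<pi> (a G) \<xi>)) - Re (ip HA \<xi> (\<pi> (a F) \<xi>)))"
    if FG: "finite G" "F \<subseteq> G" "G \<subseteq> J" and \<xi>: "\<xi> \<in> vecs HA" for F G \<xi>
  proof -
    have F: "finite F" "F \<subseteq> J" using FG by (auto intro: finite_subset)
    note aa = a[OF FG(1,3)] a[OF F]
    define d where "d = a G - a F"
    have d: "d \<in> carrier A" "adj A d = d"
      using aa by (simp_all add: d_def closed adj_diff sa FG F)
    have "Re (ip HA \<xi> (\<pi> (mul A d d) \<xi>)) \<le> Re (ip HA \<xi> (\<pi> (scale A (of_real C) d) \<xi>))"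
      using sq[OF FG] d(1) \<xi> by (intro rep_mono) (auto simp: d_def[symmetric] closed)
    also have "\<dots> = C * Re (ip HA \<xi> (\<pi> d \<xi>))"
      using d \<xi> by (simp add: rep_scale HA.ip_smul_right rep_in)
    also have "ip HA \<xi> (\<pi> (mul A d d) \<xi>) = ip HA (\<pi> d \<xi>) (\<pi> d \<xi>)"
      using rep_adj[OF d(1) \<xi> rep_in[OF d(1) \<xi>]] d \<xi> by (simp add: rep_mul)
    finally have "(ipnorm HA (\<pi> d \<xi>))\<^sup>2 \<le> C * Re (ip HA \<xi> (\<pi> d \<xi>))"
      using d \<xi> by (simp add: HA.ipnorm_power2 rep_in)
    moreover have "\<pi> d \<xi> = \<pi> (a G) \<xi> - \<pi> (a F) \<xi>" unfolding d_def by (rule rep_diff[OF aa \<xi>])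
    moreover have "ip HA \<xi> (\<pi> d \<xi>) = ip HA \<xi> (\<pi> (a G) \<xi>) - ip HA \<xi> (\<pi> (a F) \<xi>)"
      unfolding d_def rep_diff[OF aa \<xi>] by (intro HA.ip_diff_right \<xi> rep_in aa)
    ultimately show ?thesis by (simp only: minus_complex.sel)
  qed
  have rep0: "\<pi> 0 \<xi> = 0" if "\<xi> \<in> vecs HA" for \<xi>
    using rep_diff[OF zero_in zero_in that] by simp
  have bnd: "ipnorm HA (\<pi> (a F) \<xi>) \<le> C * ipnorm HA \<xi>"
    if F: "finite F" "F \<subseteq> J" and \<xi>: "\<xi> \<in> vecs HA" for F \<xi>
  proof (rule power2_le_imp_le)
    \<comment> \<open>The increment from the empty set, where the net starts at 0, yields the
      uniform operator bound needed for the strong limit.\<close>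
    have "(ipnorm HA (\<pi> (a F) \<xi>))\<^sup>2 \<le> C * Re (ip HA \<xi> (\<pi> (a F) \<xi>))"
      using incr[of F "{}" \<xi>] F \<xi> by (simp add: a0 rep0)
    also have "\<dots> \<le> C * (C * (ipnorm HA \<xi>)\<^sup>2)" using r[OF F \<xi>] C by (intro mult_left_mono) auto
    also have "\<dots> = (C * ipnorm HA \<xi>)\<^sup>2" by (simp add: power2_eq_square)
    finally show "(ipnorm HA (\<pi> (a F) \<xi>))\<^sup>2 \<le> (C * ipnorm HA \<xi>)\<^sup>2" .
  qed (use C \<xi> in simp)
  have lim: "\<exists>t. HA.tends (\<lambda>F. \<pi> (a F) \<xi>) t (fsets J)" if \<xi>: "\<xi> \<in> vecs HA" for \<xi>
    by (rule HA.monotone_net_tends[OF _ C incr r]) (auto simp: rep_in a \<xi>)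
  obtain T where T: "T \<in> bounded_ops HA"
    "\<And>\<xi>. \<xi> \<in> vecs HA \<Longrightarrow> HA.tends (\<lambda>F. \<pi> (a F) \<xi>) (T \<xi>) (fsets J)"
    using HA.strong_limit_exists[OF rep_bounded_ops[OF a] bnd lim] by blast
  have "T \<in> enveloping_vN A"
    unfolding enveloping_vN_def
    by (rule HA.strong_limit_in_commutant[OF _ _ T])
      (use rep_in_enveloping[OF a] in \<open>auto simp: enveloping_vN_def commutant_def\<close>)
  moreover have "limitin (ultraweak_topology HA) (\<lambda>F. \<pi> (a F)) T (fsets J)"
    by (rule HA.strong_limit_ultraweak[OF rep_bounded_ops[OF a] bnd T])
  ultimately show ?thesis by blast
qed

text \<open>The lower bound need only hold eventually and up to \<open>e\<close>, which is the form
  that a compactness argument delivers; the error disappears after the limit has been taken.\<close>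

lemma op_le_limitI:
  assumes lim: "limitin (ultraweak_topology HA) (\<lambda>F. \<pi> (a F)) T (fsets J)"
    and T: "T \<in> bounded_ops HA"
    and a: "\<And>F. finite F \<Longrightarrow> F \<subseteq> J \<Longrightarrow> a F \<in> carrier A" and b: "b \<in> carrier A"
    and ev: "\<And>e. e > 0 \<Longrightarrow> \<forall>\<^sub>F F in fsets J. alg_le A b (a F + scale A (of_real e) \<u>)"
  shows "op_le HA (\<pi> b) T"
  unfolding op_le_def
proof
  fix \<xi> assume \<xi>: "\<xi> \<in> vecs HA"
  define z where "z = ip HA \<xi> (T \<xi> - \<pi> b \<xi>)"
  have lim_z: "((\<lambda>F. ip HA \<xi> (\<pi> (a F) \<xi>) - ip HA \<xi> (\<pi> b \<xi>)) \<longlongrightarrow> z) (fsets J)"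
    using tendsto_diff[OF HA.ultraweak_imp_weak[OF lim \<xi> \<xi>] tendsto_const] \<xi> T b
    by (simp add: z_def HA.ip_diff_right HA.bounded_opsD rep_in)
  have e: "z + of_real (e * (ipnorm HA \<xi>)\<^sup>2) \<in> \<real>\<^sub>\<ge>\<^sub>0" if "e > 0" for e
  proof (rule Lim_in_closed_set[OF closed_nonneg_Reals_complex _ _ tendsto_add[OF lim_z tendsto_const]])
    have "\<forall>\<^sub>F F in fsets J. finite F \<and> F \<subseteq> J"
      by (intro eventually_finite_subsets_at_top_weakI) auto
    then show "\<forall>\<^sub>F F in fsets J. ip HA \<xi> (\<pi> (a F) \<xi>) - ip HA \<xi> (\<pi> b \<xi>)
        + of_real (e * (ipnorm HA \<xi>)\<^sup>2) \<in> \<real>\<^sub>\<ge>\<^sub>0"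
      using ev[OF that]
    proof eventually_elim
      case (elim F)
      then show ?case
        using rep_positive[OF elim(2) b _ \<xi>] a[of F] \<xi> b
        by (simp add: closed rep_add rep_scale rep_unit rep_in HA.ip_diff_right HA.ip_add_right
          HA.ip_smul_right HA.ip_self algebra_simps)
    qed
  qed simp
  have "Im z = 0" using e[of 1] by (simp add: complex_nonneg_Reals_iff)
  moreover have "0 \<le> Re z + e" if "e > 0" for e
  proof -
    \<comment> \<open>Rescaling so that the error, which carries the squared norm of
      \<open>\<xi>\<close>, stays below \<open>e\<close>; the added 1 covers
      \<open>\<xi> = 0\<close>.\<close>
    have "e / ((ipnorm HA \<xi>)\<^sup>2 + 1) > 0" using that by (simp add: add_nonneg_pos)
    then have "0 \<le> Re z + e / ((ipnorm HA \<xi>)\<^sup>2 + 1) * (ipnorm HA \<xi>)\<^sup>2"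
      using e[of "e / ((ipnorm HA \<xi>)\<^sup>2 + 1)"] by (simp add: complex_nonneg_Reals_iff)
    also have "e / ((ipnorm HA \<xi>)\<^sup>2 + 1) * (ipnorm HA \<xi>)\<^sup>2 \<le> e"
      using that by (simp add: divide_le_eq add_nonneg_pos)
    finally show ?thesis by simp
  qed
  then have "0 \<le> Re z" by (rule field_le_epsilon)
  ultimately show "ip HA \<xi> (T \<xi> - \<pi> b \<xi>) \<in> \<real>\<^sub>\<ge>\<^sub>0"
    by (simp add: complex_nonneg_Reals_iff flip: z_def)
qed

lemma limit_op_leI:
  assumes lim: "limitin (ultraweak_topology HA) (\<lambda>F. \<pi> (a F)) T (fsets J)"
    and T: "T \<in> bounded_ops HA"
    and a: "\<And>F. finite F \<Longrightarrow> F \<subseteq> J \<Longrightarrow> a F \<in> carrier A" and b: "b \<in> carrier A"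
    and le: "\<And>F. finite F \<Longrightarrow> F \<subseteq> J \<Longrightarrow> alg_le A (a F) b"
  shows "op_le HA T (\<pi> b)"
  unfolding op_le_def
proof
  fix \<xi> assume \<xi>: "\<xi> \<in> vecs HA"
  have z: "((\<lambda>F. ip HA \<xi> (\<pi> b \<xi>) - ip HA \<xi> (\<pi> (a F) \<xi>)) \<longlongrightarrow> ip HA \<xi> (\<pi> b \<xi> - T \<xi>)) (fsets J)"
    using tendsto_diff[OF tendsto_const HA.ultraweak_imp_weak[OF lim \<xi> \<xi>]] \<xi> T b
    by (simp add: HA.ip_diff_right HA.bounded_opsD rep_in)
  show "ip HA \<xi> (\<pi> b \<xi> - T \<xi>) \<in> \<real>\<^sub>\<ge>\<^sub>0"
  proof (rule Lim_in_closed_set[OF closed_nonneg_Reals_complex _ _ z])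
    show "\<forall>\<^sub>F F in fsets J. ip HA \<xi> (\<pi> b \<xi>) - ip HA \<xi> (\<pi> (a F) \<xi>) \<in> \<real>\<^sub>\<ge>\<^sub>0"
    proof (rule eventually_finite_subsets_at_top_weakI)
      fix F assume F: "finite F" "F \<subseteq> J"
      show "ip HA \<xi> (\<pi> b \<xi>) - ip HA \<xi> (\<pi> (a F) \<xi>) \<in> \<real>\<^sub>\<ge>\<^sub>0"
        using rep_positive[OF le[OF F] a[OF F] b \<xi>] a[OF F] b \<xi> by (simp add: HA.ip_diff_right rep_in)
    qed
  qed simp
qed

end

section \<open>Continuous functions vanishing at infinity\<close>

abbreviation abs2 :: "complex \<Rightarrow> real" where "abs2 z \<equiv> (cmod z)\<^sup>2"

lemma C0_iff:
  "f \<in> carrier (C0 K) \<longleftrightarrow> continuous_map K euclidean f \<and>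
     (\<forall>e>0. compactin K {t \<in> topspace K. e \<le> cmod (f t)}) \<and> (\<forall>t. t \<notin> topspace K \<longrightarrow> f t = 0)"
  by (simp add: C0_def)

lemma C0_simps:
  "scale (C0 K) c f = (\<lambda>t. c * f t)" "mul (C0 K) f g = (\<lambda>t. f t * g t)" "adj (C0 K) f = (\<lambda>t. cnj (f t))"
  "nrm (C0 K) f = (SUP t. cmod (f t))"
  by (simp_all add: C0_def)

lemma C0D:
  assumes "f \<in> carrier (C0 K)"
  shows "continuous_map K euclidean f" "e > 0 \<Longrightarrow> compactin K {t \<in> topspace K. e \<le> cmod (f t)}"
    "t \<notin> topspace K \<Longrightarrow> f t = 0"
  using assms by (auto simp: C0_iff)

lemma C0_cmod_power2:
  assumes "f \<in> carrier (C0 K)"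
  shows "continuous_map K euclideanreal (\<lambda>t. abs2 (f t))"
proof -
  have "continuous_map euclidean euclideanreal (\<lambda>z::complex. abs2 z)" by (simp add: continuous_intros)
  from continuous_map_compose[OF C0D(1)[OF assms] this] show ?thesis by (simp add: o_def)
qed

text \<open>The superlevel sets are closed by continuity, so lying inside some compact set is
  enough.\<close>

lemma C0I:
  assumes f: "continuous_map K euclidean f" and "\<And>t. t \<notin> topspace K \<Longrightarrow> f t = 0"
    and C: "\<And>e. e > 0 \<Longrightarrow> \<exists>C. compactin K C \<and> {t \<in> topspace K. e \<le> cmod (f t)} \<subseteq> C"
  shows "f \<in> carrier (C0 K)"
proof -
  have "compactin K {t \<in> topspace K. e \<le> cmod (f t)}" if "e > 0" for e
  proof -
    have "closedin euclidean {z::complex. e \<le> cmod z}"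
      by (simp add: closed_Collect_le continuous_intros)
    from closedin_continuous_map_preimage[OF f this]
    have "closedin K {t \<in> topspace K. e \<le> cmod (f t)}" by simp
    then show ?thesis using C[OF that] closed_compactin by blast
  qed
  then show ?thesis using assms by (simp add: C0_iff)
qed

text \<open>Domination is only asked between superlevel sets. This is weaker than a linear bound and
  also covers square roots, where \<open>d = e^2\<close>.\<close>

lemma C0_dominated:
  assumes f: "f \<in> carrier (C0 K)" and g: "continuous_map K euclidean g" "\<And>t. t \<notin> topspace K \<Longrightarrow> g t = 0"
    and dom: "\<And>e. e > 0 \<Longrightarrow> \<exists>d>0. \<forall>t\<in>topspace K. e \<le> cmod (g t) \<longrightarrow> d \<le> cmod (f t)"
  shows "g \<in> carrier (C0 K)"
proof (rule C0I[OF g])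
  fix e :: real assume "e > 0"
  then obtain d where d: "d > 0" "\<forall>t\<in>topspace K. e \<le> cmod (g t) \<longrightarrow> d \<le> cmod (f t)" using dom by blast
  show "\<exists>C. compactin K C \<and> {t \<in> topspace K. e \<le> cmod (g t)} \<subseteq> C"
    using C0D(2)[OF f d(1)] d(2) by (intro exI[of _ "{t \<in> topspace K. d \<le> cmod (f t)}"]) auto
qed

text \<open>On the compact set where the modulus is at least 1, continuity gives a bound; elsewhere
  1 is one.\<close>

lemma C0_bounded:
  assumes f: "f \<in> carrier (C0 K)"
  obtains B where "0 \<le> B" "\<And>t. cmod (f t) \<le> B"
proof -
  have "compactin euclidean (f ` {t \<in> topspace K. 1 \<le> cmod (f t)})"
    by (rule image_compactin[OF C0D(2)[OF f] C0D(1)[OF f]]) simp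
  then have "bounded (f ` {t \<in> topspace K. 1 \<le> cmod (f t)})"
    by (simp add: compact_imp_bounded)
  then obtain B where B: "\<And>t. t \<in> topspace K \<Longrightarrow> 1 \<le> cmod (f t) \<Longrightarrow> cmod (f t) \<le> B"
    unfolding bounded_iff by auto
  have "cmod (f t) \<le> max B 1" for t
    using B[of t] C0D(3)[OF f, of t] by (cases "t \<in> topspace K") fastforce+
  then show thesis using that[of "max B 1"] by simp
qed

lemma C0_zero: "0 \<in> carrier (C0 K)"
  unfolding C0_iff zero_fun_def by (auto simp: not_le)

lemma C0_mult_bounded:
  assumes f: "f \<in> carrier (C0 K)" and g: "continuous_map K euclidean g" and B: "\<And>t. cmod (g t) \<le> B"
  shows "(\<lambda>t. f t * g t) \<in> carrier (C0 K)"
proof (rule C0_dominated[OF f])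
  show "continuous_map K euclidean (\<lambda>t. f t * g t)"
  proof -
    have "continuous_map K (prod_topology euclidean euclidean) (\<lambda>t. (f t, g t))"
      using C0D(1)[OF f] g by (rule continuous_map_pairedI)
    moreover have "continuous_map (prod_topology euclidean euclidean) euclidean (\<lambda>(z, w). z * w :: complex)"
      by (simp add: euclidean_product_topology case_prod_unfold continuous_intros)
    ultimately have "continuous_map K euclidean ((\<lambda>(z, w). z * w :: complex) \<circ> (\<lambda>t. (f t, g t)))"
      by (rule continuous_map_compose)
    then show ?thesis by (simp add: o_def)
  qed
  show "f t * g t = 0" if "t \<notin> topspace K" for t using C0D(3)[OF f that] by simp
  fix e :: real assume e: "e > 0"
  have B0: "0 \<le> B" using B[of undefined] norm_ge_zero order_trans by blast
  have "e / (B + 1) \<le> cmod (f t)" if "e \<le> cmod (f t * g t)" for t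
  proof -
    have "e \<le> cmod (f t) * cmod (g t)" using that by (simp add: norm_mult)
    also have "\<dots> \<le> cmod (f t) * (B + 1)" using B[of t] by (intro mult_left_mono) auto
    finally show ?thesis using B0 by (simp add: pos_divide_le_eq)
  qed
  then show "\<exists>d>0. \<forall>t\<in>topspace K. e \<le> cmod (f t * g t) \<longrightarrow> d \<le> cmod (f t)"
    using e B0 by (intro exI[of _ "e / (B + 1)"]) auto
qed

lemma C0_mult: "f \<in> carrier (C0 K) \<Longrightarrow> g \<in> carrier (C0 K) \<Longrightarrow> (\<lambda>t. f t * g t) \<in> carrier (C0 K)"
  by (metis C0_bounded C0_mult_bounded C0D(1))

lemma C0_scale: "f \<in> carrier (C0 K) \<Longrightarrow> (\<lambda>t. c * f t) \<in> carrier (C0 K)"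
  using C0_mult_bounded[of f K "\<lambda>_. c" "cmod c"] by (simp add: mult.commute)

lemma C0_add:
  assumes f: "f \<in> carrier (C0 K)" and g: "g \<in> carrier (C0 K)"
  shows "f + g \<in> carrier (C0 K)"
proof (rule C0I)
  show "continuous_map K euclidean (f + g)"
    using continuous_map_add[OF C0D(1)[OF f] C0D(1)[OF g]] by (simp add: plus_fun_def)
  show "(f + g) t = 0" if "t \<notin> topspace K" for t using C0D(3)[OF f that] C0D(3)[OF g that] by simp
  fix e :: real assume "e > 0"
  then have "compactin K ({t \<in> topspace K. e / 2 \<le> cmod (f t)} \<union> {t \<in> topspace K. e / 2 \<le> cmod (g t)})"
    by (intro compactin_Un C0D(2) f g) auto
  moreover have "e / 2 \<le> cmod (f t) \<or> e / 2 \<le> cmod (g t)" if "e \<le> cmod (f t + g t)" for t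
    using that norm_triangle_ineq[of "f t" "g t"] by linarith
  ultimately show "\<exists>C. compactin K C \<and> {t \<in> topspace K. e \<le> cmod ((f + g) t)} \<subseteq> C"
    by (intro exI[of _ "{t \<in> topspace K. e / 2 \<le> cmod (f t)} \<union> {t \<in> topspace K. e / 2 \<le> cmod (g t)}"]) auto
qed

lemma C0_uminus: "f \<in> carrier (C0 K) \<Longrightarrow> - f \<in> carrier (C0 K)"
  using C0_scale[of f K "-1"] by (simp add: fun_Compl_def)

lemma C0_cnj:
  assumes f: "f \<in> carrier (C0 K)"
  shows "(\<lambda>t. cnj (f t)) \<in> carrier (C0 K)"
proof (rule C0_dominated[OF f])
  have "continuous_map euclidean euclidean cnj" by (simp add: continuous_on_cnj)
  from continuous_map_compose[OF C0D(1)[OF f] this]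
  show "continuous_map K euclidean (\<lambda>t. cnj (f t))" by (simp add: o_def)
qed (use C0D(3)[OF f] in auto)

text \<open>A pair \<open>(a, s)\<close> of the unitalization is regarded as the function \<open>a + s\<close> on the one-point
  compactification, with value \<open>s\<close> at infinity.\<close>

definition ev :: "('k \<Rightarrow> complex) \<times> complex \<Rightarrow> 'k option \<Rightarrow> complex" where
  "ev x p = (case p of None \<Rightarrow> snd x | Some t \<Rightarrow> fst x t + snd x)"

lemma ev_simps [simp]: "ev x None = snd x" "ev x (Some t) = fst x t + snd x"
  by (simp_all add: ev_def)

lemma ev_eqI: "(\<And>p. ev x p = ev y p) \<Longrightarrow> x = y"
proof -
  assume e: "\<And>p. ev x p = ev y p"
  have "snd x = snd y" using e[of None] by simp
  moreover have "fst x t = fst y t" for t using e[of "Some t"] calculation by simp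
  ultimately show ?thesis by (auto simp: prod_eq_iff)
qed

lemma ev_add: "ev (x + y) p = ev x p + ev y p" and ev_diff: "ev (x - y) p = ev x p - ev y p"
  and ev_zero: "ev 0 p = 0"
  by (cases p; simp)+

lemma ev_sum: "ev (\<Sum>j\<in>F. x j) p = (\<Sum>j\<in>F. ev (x j) p)"
  by (induction F rule: infinite_finite_induct) (simp_all add: ev_add ev_zero)

lemma ev_unitalization:
  "ev (mul (unitalization (C0 K)) x y) p = ev x p * ev y p"
  "ev (adj (unitalization (C0 K)) x) p = cnj (ev x p)"
  "ev (scale (unitalization (C0 K)) c x) p = c * ev x p"
  by (cases p; cases x; cases y; simp add: unitalization_def C0_simps algebra_simps)+

lemma self_module_simps:
  "coeffs (self_module A) = unitalization A" "elems (self_module A) = carrier A"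
  "inner_prod (self_module A) x y = (mul A (adj A x) y, 0)"
  by (simp_all add: self_module_def)

lemma ev_inner_prod:
  "ev (inner_prod (self_module (C0 K)) y y) p = (case p of None \<Rightarrow> 0 | Some t \<Rightarrow> of_real (abs2 (y t)))"
  by (cases p) (simp_all add: self_module_simps C0_simps mult_cnj_self mult.commute[of "cnj _"])

lemma ev_frame_partial_sum:
  "ev (frame_partial_sum (self_module (C0 K)) x y F) p =
     (case p of None \<Rightarrow> 0 | Some t \<Rightarrow> of_real (\<Sum>j\<in>F. abs2 (y t) * abs2 (x j t)))"
proof (cases p)
  case (Some t)
  have "cnj (y t) * x j t * (cnj (x j t) * y t) = of_real (abs2 (y t) * abs2 (x j t))" for j
    unfolding of_real_mult mult_cnj_self[symmetric] by (simp add: mult_ac)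
  then show ?thesis
    using Some unfolding frame_partial_sum_def ev_sum self_module_simps ev_unitalization
    by (simp add: C0_simps)
qed (simp add: frame_partial_sum_def ev_sum self_module_simps ev_unitalization del: ev_simps; simp)

text \<open>In this case the scalar component of the unitalization is unrestricted, so
  \<open>ev\<close> identifies it with functions on the space with one extra point. Algebraic
  identities can then be checked pointwise, by injectivity of \<open>ev\<close>.\<close>

locale nonunital_C0 =
  fixes K :: "'k topology"
  assumes nonunital: "\<not> unital (C0 K)"
begin

abbreviation A where "A \<equiv> unitalization (C0 K)"
abbreviation M where "M \<equiv> self_module (C0 K)"

lemma carrier_A: "carrier A = carrier (C0 K) \<times> UNIV"
  using nonunital by (simp add: unitalization_def)

lemma is_unit: "is_unit_of A (0, 1)"
  unfolding is_unit_of_def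
  by (auto intro!: ev_eqI simp: carrier_A C0_zero ev_unitalization split: option.split simp del: ev_simps)
    (auto simp: ev_def split: option.split)

lemma unit_of_A: "unit_of A = (0, 1)"
  unfolding unit_of_def
proof (rule the_equality[where P = "is_unit_of A", OF is_unit])
  fix e assume "is_unit_of A e"
  then show "e = (0, 1)" using is_unit unfolding is_unit_of_def by metis
qed

lemma ev_unit: "ev (unit_of A) p = 1"
  by (cases p) (simp_all add: unit_of_A)

text \<open>For the nontrivial direction, the pointwise root of a nonnegative function must again
  lie in the unitalization: its value at infinity becomes the scalar part, and the remainder has to
  vanish at infinity.\<close>

lemma alg_le_iff:
  assumes x: "x \<in> carrier A" and y: "y \<in> carrier A"
  shows "alg_le A x y \<longleftrightarrow> (\<forall>p. ev y p - ev x p \<in> \<real>\<^sub>\<ge>\<^sub>0)"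
proof
  assume "alg_le A x y"
  then obtain c where "y - x = mul A (adj A c) c" by (auto simp: alg_le_def)
  then have "ev y p - ev x p = of_real (abs2 (ev c p))" for p
    by (metis ev_diff ev_unitalization(1,2) mult.commute mult_cnj_self)
  then show "\<forall>p. ev y p - ev x p \<in> \<real>\<^sub>\<ge>\<^sub>0" by (metis nonneg_Reals_of_real_iff zero_le_power2)
next
  assume pos: "\<forall>p. ev y p - ev x p \<in> \<real>\<^sub>\<ge>\<^sub>0"
  define a s where "a = fst y - fst x" and "s = snd y - snd x"
  have a: "a \<in> carrier (C0 K)"
    using C0_add[of "fst y" K "- fst x"] C0_uminus[of "fst x" K] x y by (auto simp: a_def carrier_A)
  have s: "s \<in> \<real>\<^sub>\<ge>\<^sub>0" using pos[rule_format, of None] by (simp add: s_def)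
  have as: "a t + s \<in> \<real>\<^sub>\<ge>\<^sub>0" for t
    using pos[rule_format, of "Some t"] by (simp add: a_def s_def algebra_simps)
  \<comment> \<open>The square root minus its value at infinity.\<close>
  define w where "w = (\<lambda>t. sqrt (Re (a t + s)) - sqrt (Re s))"
  \<comment> \<open>This estimate works uniformly down to 0, so it also handles
    \<open>s = 0\<close>, where the root is not Lipschitz.\<close>
  have sqrt_diff: "\<bar>sqrt u - sqrt v\<bar>\<^sup>2 \<le> \<bar>u - v\<bar>" if "u \<ge> 0" "v \<ge> 0" for u v :: real
  proof -
    have "\<bar>sqrt u - sqrt v\<bar> * \<bar>sqrt u - sqrt v\<bar> \<le> \<bar>sqrt u - sqrt v\<bar> * \<bar>sqrt u + sqrt v\<bar>"
      using that by (intro mult_left_mono) (auto simp: abs_le_iff)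
    also have "\<dots> = \<bar>(sqrt u - sqrt v) * (sqrt u + sqrt v)\<bar>" by (simp only: abs_mult)
    also have "(sqrt u - sqrt v) * (sqrt u + sqrt v) = u - v"
      using that by (simp add: algebra_simps)
    finally show ?thesis by (simp add: power2_eq_square)
  qed
  have w: "(\<lambda>t. of_real (w t)) \<in> carrier (C0 K)"
  proof (rule C0_dominated[OF a])
    have "continuous_map euclidean euclidean (\<lambda>z. complex_of_real (sqrt (Re (z + s)) - sqrt (Re s)))"
      by (simp add: continuous_intros)
    from continuous_map_compose[OF C0D(1)[OF a] this]
    show "continuous_map K euclidean (\<lambda>t. complex_of_real (w t))" by (simp add: o_def w_def)
    show "complex_of_real (w t) = 0" if "t \<notin> topspace K" for t
      using C0D(3)[OF a that] by (simp add: w_def)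
    fix e :: real assume e: "e > 0"
    have "e\<^sup>2 \<le> cmod (a t)" if "e \<le> cmod (complex_of_real (w t))" for t
    proof -
      have "e\<^sup>2 \<le> \<bar>w t\<bar>\<^sup>2" using that e by (intro power_mono) auto
      also have "\<dots> \<le> \<bar>Re (a t + s) - Re s\<bar>"
        unfolding w_def using as[of t] s by (intro sqrt_diff) (auto simp: complex_nonneg_Reals_iff)
      also have "\<dots> \<le> cmod (a t)" by (simp add: abs_Re_le_cmod)
      finally show ?thesis .
    qed
    then show "\<exists>d>0. \<forall>t\<in>topspace K. e \<le> cmod (complex_of_real (w t)) \<longrightarrow> d \<le> cmod (a t)"
      using e by (intro exI[of _ "e\<^sup>2"]) auto
  qed
  define d where "d = ((\<lambda>t. complex_of_real (w t)), complex_of_real (sqrt (Re s)))"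
  have "y - x = mul A (adj A d) d"
  proof (rule ev_eqI)
    have sq: "complex_of_real (sqrt (Re z)) * complex_of_real (sqrt (Re z)) = z" if "z \<in> \<real>\<^sub>\<ge>\<^sub>0" for z
      using that by (auto simp: complex_nonneg_Reals_iff complex_eq_iff)
    fix p
    show "ev (y - x) p = ev (mul A (adj A d) d) p"
    proof (cases p)
      case None
      then show ?thesis using sq[OF s]
        by (simp add: ev_diff ev_unitalization d_def del: ev_simps) (simp add: s_def)
    next
      case (Some t)
      then show ?thesis
        using sq[OF as[of t]]
        by (simp add: ev_diff ev_unitalization d_def w_def del: ev_simps) (simp add: a_def s_def algebra_simps)
    qed
  qed
  moreover have "d \<in> carrier A" using w by (simp add: d_def carrier_A)
  ultimately show "alg_le A x y" by (auto simp: alg_le_def)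
qed

lemma A_closed:
  "0 \<in> carrier A" "x \<in> carrier A \<Longrightarrow> y \<in> carrier A \<Longrightarrow> x + y \<in> carrier A"
  "x \<in> carrier A \<Longrightarrow> - x \<in> carrier A" "x \<in> carrier A \<Longrightarrow> scale A c x \<in> carrier A"
  "x \<in> carrier A \<Longrightarrow> y \<in> carrier A \<Longrightarrow> mul A x y \<in> carrier A"
  "x \<in> carrier A \<Longrightarrow> adj A x \<in> carrier A"
  unfolding carrier_A
  by (auto simp: zero_prod_def C0_zero C0_add C0_uminus unitalization_def C0_simps C0_scale C0_cnj
      C0_add[OF C0_add[OF C0_mult C0_scale] C0_scale])

lemma ev_bounded:
  assumes "x \<in> carrier A"
  obtains B where "0 \<le> B" "\<And>p. cmod (ev x p) \<le> B"
proof -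
  obtain B where B: "0 \<le> B" "\<And>t. cmod (fst x t) \<le> B"
    by (rule C0_bounded[of "fst x" K]) (use assms in \<open>auto simp: carrier_A\<close>)
  have "cmod (ev x p) \<le> B + cmod (snd x)" for p
  proof (cases p)
    case (Some t)
    then show ?thesis using B(2)[of t] norm_triangle_ineq[of "fst x t" "snd x"] by simp
  qed (use B in simp)
  then show thesis using that[of "B + cmod (snd x)"] B by auto
qed

sublocale star_algebra A
proof
  show "is_unit_of A (unit_of A)" using is_unit by (simp add: unit_of_A)
  fix a assume a: "a \<in> carrier A"
  obtain B where B: "0 \<le> B" "\<And>p. cmod (ev a p) \<le> B" using ev_bounded[OF a] by metis
  have "complex_of_real (B\<^sup>2) - cnj (ev a p) * ev a p \<in> \<real>\<^sub>\<ge>\<^sub>0" for p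
  proof -
    have "abs2 (ev a p) \<le> B\<^sup>2" using B by (intro power_mono) auto
    then show ?thesis
      by (metis diff_ge_0_iff_ge mult.commute mult_cnj_self nonneg_Reals_of_real_iff of_real_diff)
  qed
  moreover have "unit_of A \<in> carrier A" by (simp add: unit_of_A carrier_A C0_zero)
  ultimately have "alg_le A (mul A (adj A a) a) (scale A (complex_of_real (B\<^sup>2)) (unit_of A))"
    using a by (subst alg_le_iff) (auto simp: A_closed ev_unitalization ev_unit simp del: ev_simps)
  then show "\<exists>C\<ge>0. alg_le A (mul A (adj A a) a) (scale A (complex_of_real C) (unit_of A))"
    using zero_le_power2 by blast
qed ((simp add: A_closed; fail) |
     (rule ev_eqI, simp add: ev_unitalization ev_add algebra_simps del: ev_simps))+

lemma inner_prod_in: "x \<in> carrier (C0 K) \<Longrightarrow> y \<in> carrier (C0 K) \<Longrightarrow> inner_prod M x y \<in> carrier A"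
  by (simp add: self_module_simps carrier_A C0_simps C0_mult C0_cnj)

lemma frame_partial_sum_in:
  assumes "\<And>j. j \<in> F \<Longrightarrow> x j \<in> carrier (C0 K)" "y \<in> carrier (C0 K)"
  shows "frame_partial_sum M x y F \<in> carrier A"
  unfolding frame_partial_sum_def self_module_simps(1) using assms
  by (induction F rule: infinite_finite_induct) (auto simp: A_closed inner_prod_in)

text \<open>The square sum is only lower semicontinuous, so Dini's argument gives a one-sided uniform bound.\<close>

lemma Dini_lower_bound:
  fixes x :: "'j \<Rightarrow> 'k \<Rightarrow> complex"
  assumes x: "\<And>j. j \<in> J \<Longrightarrow> x j \<in> carrier (C0 K)" and y: "y \<in> carrier (C0 K)" and c: "0 < c" and e: "0 < e"
    and low: "\<And>t. t \<in> topspace K \<Longrightarrow> \<exists>s\<ge>c. ((\<lambda>j. abs2 (x j t)) has_sum s) J"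
  shows "\<exists>F0. finite F0 \<and> F0 \<subseteq> J \<and> (\<forall>t. c * abs2 (y t) \<le> (\<Sum>j\<in>F0. abs2 (y t) * abs2 (x j t)) + e)"
proof -
  define h where "h = (\<lambda>F t. (\<Sum>j\<in>F. abs2 (y t) * abs2 (x j t)) + e - c * abs2 (y t))"
  define U where "U = (\<lambda>F. {t \<in> topspace K. h F t \<in> {0<..}})"
  \<comment> \<open>Off \<open>D\<close> the term \<open>c * abs2 (y t)\<close> is itself at most
    \<open>e\<close>, so only this compact set has to be covered.\<close>
  define D where "D = {t \<in> topspace K. sqrt (e / c) \<le> cmod (y t)}"
  have D: "compactin K D" unfolding D_def using e c by (intro C0D(2)[OF y]) auto
  have U: "openin K (U F)" if "finite F" "F \<subseteq> J" for F
    unfolding U_def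
  proof (rule openin_continuous_map_preimage)
    show "continuous_map K euclideanreal (h F)"
      unfolding h_def using that x y
      by (intro continuous_map_diff continuous_map_add continuous_map_sum continuous_map_real_mult C0_cmod_power2)
        (auto simp: C0_cmod_power2)
  qed simp
  have cover: "\<exists>F. finite F \<and> F \<subseteq> J \<and> t \<in> U F" if t: "t \<in> topspace K" for t
  proof -
    obtain s where s: "s \<ge> c" "((\<lambda>j. abs2 (x j t)) has_sum s) J" using low[OF t] by blast
    have "((\<lambda>j. abs2 (y t) * abs2 (x j t)) has_sum (abs2 (y t) * s)) J"
      by (rule has_sum_cmult_right[OF s(2)])
    moreover have "c * abs2 (y t) - e < abs2 (y t) * s"
      using mult_left_mono[OF s(1), of "abs2 (y t)"] e by (simp add: mult.commute)
    ultimately have "\<forall>\<^sub>F F in fsets J. c * abs2 (y t) - e < (\<Sum>j\<in>F. abs2 (y t) * abs2 (x j t))"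
      unfolding has_sum_def by (intro order_tendstoD(1))
    then obtain F where "finite F" "F \<subseteq> J" "c * abs2 (y t) - e < (\<Sum>j\<in>F. abs2 (y t) * abs2 (x j t))"
      unfolding eventually_finite_subsets_at_top by blast
    then show ?thesis using t by (intro exI[of _ F]) (simp add: U_def h_def)
  qed
  have DD: "D \<subseteq> \<Union> (U ` {F. finite F \<and> F \<subseteq> J})" using cover by (auto simp: D_def)
  have "\<exists>\<F>. finite \<F> \<and> \<F> \<subseteq> U ` {F. finite F \<and> F \<subseteq> J} \<and> D \<subseteq> \<Union>\<F>"
    by (rule compactinD[OF D _ DD]) (use U in auto)
  then obtain \<F> where \<F>: "finite \<F>" "\<F> \<subseteq> U ` {F. finite F \<and> F \<subseteq> J}" "D \<subseteq> \<Union>\<F>" by blast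
  from finite_subset_image[OF \<F>(1,2)] obtain \<G>
    where "\<G> \<subseteq> {F. finite F \<and> F \<subseteq> J}" "finite \<G>" "\<F> = U ` \<G>" by metis
  then have \<G>: "finite \<G>" "\<G> \<subseteq> {F. finite F \<and> F \<subseteq> J}" "D \<subseteq> \<Union> (U ` \<G>)"
    using \<F>(3) by simp_all
  have fin: "finite (\<Union>\<G>)" using \<G> by auto
  have "c * abs2 (y t) \<le> (\<Sum>j\<in>\<Union>\<G>. abs2 (y t) * abs2 (x j t)) + e" for t
  proof (cases "t \<in> D")
    case True
    then obtain F where F: "F \<in> \<G>" "t \<in> U F" using \<G> by auto
    have "c * abs2 (y t) \<le> (\<Sum>j\<in>F. abs2 (y t) * abs2 (x j t)) + e"
      using F by (simp add: U_def h_def)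
    also have "(\<Sum>j\<in>F. abs2 (y t) * abs2 (x j t)) \<le> (\<Sum>j\<in>\<Union>\<G>. abs2 (y t) * abs2 (x j t))"
      using F fin by (intro sum_mono2) auto
    finally show ?thesis by simp
  next
    case False
    have "c * abs2 (y t) \<le> e"
    proof (cases "t \<in> topspace K")
      case True
      then have "cmod (y t) \<le> sqrt (e / c)" using False by (simp add: D_def)
      then have "abs2 (y t) \<le> (sqrt (e / c))\<^sup>2" by (intro power_mono) auto
      then show ?thesis using c e by (simp add: pos_le_divide_eq mult.commute)
    qed (use C0D(3)[OF y] e in auto)
    then show ?thesis by (simp add: sum_nonneg add_increasing)
  qed
  then show ?thesis using fin \<G>(2) by (intro exI[of _ "\<Union>\<G>"]) auto
qed

theorem pointwise_bounds_imp_nonstandard_frame_bounds: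
  fixes x :: "'j \<Rightarrow> 'k \<Rightarrow> complex"
  assumes x: "\<And>j. j \<in> J \<Longrightarrow> x j \<in> carrier (C0 K)" and c1: "0 < c1"
    and sums: "\<And>t. t \<in> topspace K \<Longrightarrow> \<exists>s. ((\<lambda>j. abs2 (x j t)) has_sum s) J \<and> c1 \<le> s \<and> s \<le> c2"
  shows "nonstandard_frame_bounds M J x c1 c2"
  unfolding nonstandard_frame_bounds_def Let_def self_module_simps(1,2)
proof (intro conjI ballI x)
  fix y assume y: "y \<in> carrier (C0 K)"
  let ?a = "frame_partial_sum M x y"
  let ?b = "inner_prod M y y"
  have a: "?a F \<in> carrier A" if "finite F" "F \<subseteq> J" for F
    using that x y by (intro frame_partial_sum_in) auto
  have b: "scale A c ?b \<in> carrier A" for c by (intro scale_in inner_prod_in y)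
  define r where "r = (\<lambda>F p. case p of None \<Rightarrow> 0 | Some t \<Rightarrow> \<Sum>j\<in>F. abs2 (y t) * abs2 (x j t))"
  have ev_a: "ev (?a F) p = of_real (r F p)" for F p
    by (cases p) (simp_all add: ev_frame_partial_sum r_def del: ev_simps)
  have r_mono: "r F p \<le> r G p" if "finite G" "F \<subseteq> G" for F G p
    using that by (cases p) (auto simp: r_def intro: sum_mono2)
  have upper: "(\<Sum>j\<in>F. abs2 (y t) * abs2 (x j t)) \<le> c2 * abs2 (y t)"
    if F: "finite F" "F \<subseteq> J" for F t
  proof (cases "t \<in> topspace K")
    case True
    then obtain s where s: "((\<lambda>j. abs2 (x j t)) has_sum s) J" "s \<le> c2" using sums by blast
    have "(\<Sum>j\<in>F. abs2 (x j t)) \<le> c2"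
      using finite_sum_le_has_sum[OF s(1) F] s(2) by simp
    then show ?thesis
      unfolding sum_distrib_left[symmetric] by (subst mult.commute) (intro mult_right_mono, auto)
  qed (simp add: C0D(3)[OF y])
  obtain B where B: "0 \<le> B" "\<And>t. cmod (y t) \<le> B" using C0_bounded[OF y] by metis
  \<comment> \<open>One constant for all \<open>F\<close> and all points, as
    \<open>monotone_net_limit\<close> demands. The absolute value and the added 1 give positivity
    without a sign assumption on \<open>c2\<close>.\<close>
  define C where "C = \<bar>c2\<bar> * B\<^sup>2 + 1"
  have C: "0 < C" by (simp add: C_def add_nonneg_pos)
  have r_le: "r F p \<le> C" if F: "finite F" "F \<subseteq> J" for F p
  proof (cases p)
    case (Some t)
    have "c2 * abs2 (y t) \<le> \<bar>c2\<bar> * B\<^sup>2" using B by (intro mult_mono power_mono) auto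
    then show ?thesis using upper[OF F, of t] Some by (simp add: r_def C_def)
  qed (use C in \<open>simp add: r_def\<close>)
  have "\<exists>T\<in>enveloping_vN A. limitin (ultraweak_topology HA) (\<lambda>F. \<pi> (?a F)) T (fsets J)"
  proof (rule monotone_net_limit[OF a _ _ C])
    fix F assume F: "finite F" "F \<subseteq> J"
    show "adj A (?a F) = ?a F"
      by (rule ev_eqI) (simp add: ev_unitalization ev_a del: ev_simps)
    show "alg_le A (?a F) (scale A (complex_of_real C) \<u>)"
      using r_le[OF F] a[OF F]
      by (simp add: alg_le_iff closed ev_unitalization ev_unit ev_a del: ev_simps flip: of_real_diff)
  next
    fix F G assume FG: "finite G" "F \<subseteq> G" "G \<subseteq> J"
    then have F: "finite F" "F \<subseteq> J" by (auto intro: finite_subset)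
    \<comment> \<open>Both values lie between 0 and \<open>C\<close>, hence the increment does too,
      and squaring it costs at most a factor \<open>C\<close>.\<close>
    have "(r G p - r F p) * (r G p - r F p) \<le> C * (r G p - r F p)" for p
      using r_mono[OF FG(1,2), of p] r_le[OF FG(1,3), of p] r_mono[OF F(1), of "{}" p]
      by (intro mult_right_mono) (auto simp: r_def split: option.splits)
    then show "alg_le A (mul A (?a G - ?a F) (?a G - ?a F)) (scale A (complex_of_real C) (?a G - ?a F))"
      using a[OF F] a[OF FG(1,3)]
      by (simp add: alg_le_iff closed ev_unitalization ev_diff ev_a del: ev_simps flip: of_real_diff of_real_mult)
  qed (simp_all add: frame_partial_sum_def)
  then obtain T where T: "T \<in> enveloping_vN A"
    and lim: "limitin (ultraweak_topology HA) (\<lambda>F. \<pi> (?a F)) T (fsets J)" by blast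
  have Tb: "T \<in> bounded_ops HA" using T by (simp add: enveloping_vN_def commutant_def)
  have "op_le HA (\<pi> (scale A (complex_of_real c1) ?b)) T"
  proof (rule op_le_limitI[OF lim Tb a b])
    fix e :: real assume e: "e > 0"
    obtain F0 where F0: "finite F0" "F0 \<subseteq> J"
      and low: "\<And>t. c1 * abs2 (y t) \<le> (\<Sum>j\<in>F0. abs2 (y t) * abs2 (x j t)) + e"
    proof -
      have "\<exists>s\<ge>c1. ((\<lambda>j. abs2 (x j t)) has_sum s) J" if "t \<in> topspace K" for t
        using sums[OF that] by blast
      from Dini_lower_bound[OF x y c1 e this] show thesis using that by blast
    qed
    have "alg_le A (scale A (complex_of_real c1) ?b) (?a F + scale A (complex_of_real e) \<u>)"
      if F: "finite F" "F0 \<subseteq> F" "F \<subseteq> J" for F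
    proof -
      have "complex_of_real (r F p) + complex_of_real e - complex_of_real c1 * ev ?b p \<in> \<real>\<^sub>\<ge>\<^sub>0" for p
      proof (cases p)
        case (Some t)
        have "c1 * abs2 (y t) \<le> r F (Some t) + e"
          using low[of t] r_mono[OF F(1,2), of "Some t"] by (simp add: r_def)
        moreover have "complex_of_real (r F p) + complex_of_real e - complex_of_real c1 * ev ?b p
            = complex_of_real (r F (Some t) + e - c1 * abs2 (y t))"
          by (simp add: Some ev_inner_prod del: ev_simps)
        ultimately show ?thesis by (simp only: nonneg_Reals_of_real_iff)
      qed (use e in \<open>simp add: r_def ev_inner_prod del: ev_simps\<close>)
      then show ?thesis
        using a[OF F(1,3)] b
        by (simp add: alg_le_iff closed ev_unitalization ev_add ev_unit ev_a del: ev_simps)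
    qed
    then show "\<forall>\<^sub>F F in fsets J. alg_le A (scale A (complex_of_real c1) ?b) (?a F + scale A (complex_of_real e) \<u>)"
      unfolding eventually_finite_subsets_at_top using F0 by blast
  qed
  moreover have "op_le HA T (\<pi> (scale A (complex_of_real c2) ?b))"
  proof (rule limit_op_leI[OF lim Tb a b])
    fix F assume F: "finite F" "F \<subseteq> J"
    have "complex_of_real c2 * ev ?b p - complex_of_real (r F p) \<in> \<real>\<^sub>\<ge>\<^sub>0" for p
    proof (cases p)
      case (Some t)
      have "complex_of_real c2 * ev ?b p - complex_of_real (r F p) = complex_of_real (c2 * abs2 (y t) - r F (Some t))"
        by (simp add: Some ev_inner_prod del: ev_simps)
      moreover have "r F (Some t) \<le> c2 * abs2 (y t)" using upper[OF F, of t] by (simp add: r_def)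
      ultimately show ?thesis by (simp only: nonneg_Reals_of_real_iff)
    qed (simp add: r_def ev_inner_prod del: ev_simps)
    then show "alg_le A (?a F) (scale A (complex_of_real c2) ?b)"
      using a[OF F] b by (simp add: alg_le_iff ev_unitalization ev_a del: ev_simps)
  qed
  ultimately show "\<exists>T\<in>enveloping_vN A. limitin (ultraweak_topology HA) (\<lambda>F. \<pi> (?a F)) T (fsets J) \<and>
      op_le HA (\<pi> (scale A (complex_of_real c1) ?b)) T \<and> op_le HA T (\<pi> (scale A (complex_of_real c2) ?b))"
    using T lim by blast
qed

section \<open>Pointwise consequences of the frame conditions\<close>

definition point_state :: "'k \<Rightarrow> ('k \<Rightarrow> complex) \<times> complex \<Rightarrow> complex" where
  "point_state t x = (if x \<in> carrier A then ev x (Some t) else 0)"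

lemma point_state: "point_state t \<in> states A"
proof -
  have "cnj z * z \<in> \<real>\<^sub>\<ge>\<^sub>0" for z :: complex
    by (metis mult.commute mult_cnj_self nonneg_Reals_of_real_iff zero_le_power2)
  then show ?thesis
    unfolding states_def
    by (auto simp: point_state_def closed ev_add ev_unitalization ev_unit simp del: ev_simps)
qed

text \<open>The vector state of evaluation at \<open>t\<close> turns the ultraweak limit into a
  limit of scalar partial sums. Since both frame bounds are 1, its value is forced.\<close>

lemma normalized_frame_pointwise:
  assumes f: "normalized_frame M J x" and y: "y \<in> carrier (C0 K)"
  shows "((\<lambda>j. abs2 (y t) * abs2 (x j t)) has_sum abs2 (y t)) J"
proof -
  let ?a = "frame_partial_sum M x y"
  let ?b = "inner_prod M y y"
  let ?v = "vector_of (point_state t)"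
  note v = vector_of_state[OF point_state[of t]]
  have x: "\<And>j. j \<in> J \<Longrightarrow> x j \<in> carrier (C0 K)"
    using f by (simp add: normalized_frame_def nonstandard_frame_bounds_def self_module_simps Let_def)
  obtain T where T: "T \<in> enveloping_vN A"
    and lim: "limitin (ultraweak_topology HA) (\<lambda>F. \<pi> (?a F)) T (fsets J)"
    and le: "op_le HA (\<pi> (scale A (complex_of_real 1) ?b)) T" "op_le HA T (\<pi> (scale A (complex_of_real 1) ?b))"
    using f y unfolding normalized_frame_def nonstandard_frame_bounds_def Let_def self_module_simps(1,2) by blast
  have Tb: "T \<in> bounded_ops HA" using T by (simp add: enveloping_vN_def commutant_def)
  have "scale A (complex_of_real 1) ?b = ?b"
    by (rule ev_eqI) (simp add: ev_unitalization del: ev_simps)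
  then have le': "op_le HA (\<pi> ?b) T" "op_le HA T (\<pi> ?b)" using le by simp_all
  have b: "?b \<in> carrier A" by (rule inner_prod_in[OF y y])
  define z where "z = ip HA ?v (T ?v)"
  have Tv: "T ?v \<in> vecs HA" using HA.bounded_opsD(1)[OF Tb v(1)] .
  have ev_b: "ip HA ?v (\<pi> ?b ?v) = of_real (abs2 (y t))"
    using v(2)[OF b] b by (simp add: point_state_def ev_inner_prod del: ev_simps)
  \<comment> \<open>The two operator inequalities, tested on the vector of the point state, leave
    only one possible \<open>z\<close>.\<close>
  have "z - of_real (abs2 (y t)) \<in> \<real>\<^sub>\<ge>\<^sub>0" "of_real (abs2 (y t)) - z \<in> \<real>\<^sub>\<ge>\<^sub>0"
    using le' v(1) HA.ip_diff_right[OF v(1) Tv rep_in[OF b v(1)]] HA.ip_diff_right[OF v(1) rep_in[OF b v(1)] Tv]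
    unfolding op_le_def ev_b z_def by metis+
  then have z: "z = of_real (abs2 (y t))"
    by (auto simp: complex_nonneg_Reals_iff complex_eq_iff)
  have "((\<lambda>F. ip HA ?v (\<pi> (?a F) ?v)) \<longlongrightarrow> of_real (abs2 (y t))) (fsets J)"
    using HA.ultraweak_imp_weak[OF lim v(1) v(1)] z by (simp add: z_def)
  then have "((\<lambda>F. Re (ip HA ?v (\<pi> (?a F) ?v))) \<longlongrightarrow> abs2 (y t)) (fsets J)"
    using tendsto_Re by fastforce
  moreover have "\<forall>\<^sub>F F in fsets J. Re (ip HA ?v (\<pi> (?a F) ?v)) = (\<Sum>j\<in>F. abs2 (y t) * abs2 (x j t))"
  proof (rule eventually_finite_subsets_at_top_weakI)
    fix F assume "finite F" "F \<subseteq> J"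
    then have "?a F \<in> carrier A" using x y by (intro frame_partial_sum_in) auto
    then show "Re (ip HA ?v (\<pi> (?a F) ?v)) = (\<Sum>j\<in>F. abs2 (y t) * abs2 (x j t))"
      by (simp add: v(2) point_state_def ev_frame_partial_sum del: ev_simps of_real_sum)
  qed
  ultimately show ?thesis
    unfolding has_sum_def by (simp add: tendsto_cong)
qed

text \<open>The norm of the unitalization is an operator norm; testing it on \<open>b\<close>, a
  contraction with value 1 at \<open>t\<close>, recovers the value of \<open>x\<close> at
  \<open>t\<close>. Most of the work is boundedness of the nested suprema.\<close>

lemma ev_le_nrm:
  assumes x: "x \<in> carrier A" and b: "b \<in> carrier (C0 K)" "\<And>t. cmod (b t) \<le> 1" and t: "b t = 1"
  shows "cmod (ev x (Some t)) \<le> nrm A x"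
proof -
  obtain B where B: "0 \<le> B" "\<And>p. cmod (ev x p) \<le> B" using ev_bounded[OF x] by metis
  define f where "f = (\<lambda>c t. fst x t * c t + snd x * c t)"
  have f_eq: "cmod (f c u) = cmod (ev x (Some u)) * cmod (c u)" for c u
    by (simp add: f_def norm_mult[symmetric] algebra_simps)
  have nrm: "nrm A x = (SUP c\<in>{c \<in> carrier (C0 K). nrm (C0 K) c \<le> 1}. SUP u. cmod (f c u))"
    by (cases x) (simp add: unitalization_def C0_simps f_def plus_fun_def)
  have unit_ball: "cmod (c u) \<le> 1" if c: "c \<in> carrier (C0 K)" "nrm (C0 K) c \<le> 1" for c u
  proof -
    obtain B' where "\<And>t. cmod (c t) \<le> B'" using C0_bounded[OF c(1)] by metis
    then have "cmod (c u) \<le> (SUP t. cmod (c t))" by (intro cSUP_upper) (auto intro: bdd_aboveI2[where M = B'])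
    then show ?thesis using c(2) by (simp add: C0_simps)
  qed
  have fB: "cmod (f c u) \<le> B" if "c \<in> carrier (C0 K)" "nrm (C0 K) c \<le> 1" for c u
    using mult_mono[OF B(2)[of "Some u"] unit_ball[OF that, of u] B(1)] by (simp add: f_eq del: ev_simps)
  have bb: "nrm (C0 K) b \<le> 1" using b(2) by (auto simp: C0_simps intro: cSUP_least)
  have "cmod (ev x (Some t)) = cmod (f b t)" using t by (simp add: f_eq del: ev_simps)
  also have "\<dots> \<le> (SUP u. cmod (f b u))"
    using fB[OF b(1) bb] by (intro cSUP_upper) (auto intro: bdd_aboveI2[where M = B])
  also have "\<dots> \<le> nrm A x"
    unfolding nrm using fB b(1) bb
    by (intro cSUP_upper) (auto intro!: bdd_aboveI2[where M = B] cSUP_least)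
  finally show ?thesis .
qed

text \<open>Where \<open>y\<close> equals 1, the weight \<open>abs2 (y t)\<close> disappears from
  the frame sum. Norm convergence thus becomes uniform convergence of the plain square sums on that
  set, to a limit \<open>g\<close> that the lower frame bound keeps above \<open>c\<close>.\<close>

lemma standard_frame_uniform:
  assumes f: "standard_frame M J x"
  shows "(\<forall>j\<in>J. x j \<in> carrier (C0 K)) \<and>
    (\<exists>c>0. \<forall>y\<in>carrier (C0 K). (\<forall>t. cmod (y t) \<le> 1) \<longrightarrow>
      (\<exists>g. (\<forall>t. y t = 1 \<longrightarrow> c \<le> g t) \<and>
        (\<forall>e>0. \<exists>F0. finite F0 \<and> F0 \<subseteq> J \<and>
          (\<forall>F t. finite F \<longrightarrow> F0 \<subseteq> F \<longrightarrow> F \<subseteq> J \<longrightarrow> y t = 1 \<longrightarrow> \<bar>(\<Sum>j\<in>F. abs2 (x j t)) - g t\<bar> < e))))"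
proof -
  have x: "\<forall>j\<in>J. x j \<in> carrier (C0 K)" using f by (simp add: standard_frame_def self_module_simps)
  obtain c where c: "c > 0" and sc: "\<And>y. y \<in> carrier (C0 K) \<Longrightarrow> \<exists>s\<in>carrier A.
        ((\<lambda>F. nrm A (frame_partial_sum M x y F - s)) \<longlongrightarrow> 0) (fsets J) \<and>
        alg_le A (scale A (complex_of_real c) (inner_prod M y y)) s"
    using f unfolding standard_frame_def self_module_simps(1,2) by blast
  have "\<exists>g. (\<forall>t. y t = 1 \<longrightarrow> c \<le> g t) \<and>
        (\<forall>e>0. \<exists>F0. finite F0 \<and> F0 \<subseteq> J \<and>
          (\<forall>F t. finite F \<longrightarrow> F0 \<subseteq> F \<longrightarrow> F \<subseteq> J \<longrightarrow> y t = 1 \<longrightarrow> \<bar>(\<Sum>j\<in>F. abs2 (x j t)) - g t\<bar> < e))"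
    if y: "y \<in> carrier (C0 K)" and y1: "\<forall>t. cmod (y t) \<le> 1" for y
  proof -
    let ?a = "frame_partial_sum M x y"
    obtain s where s: "s \<in> carrier A" and lim: "((\<lambda>F. nrm A (?a F - s)) \<longlongrightarrow> 0) (fsets J)"
      and le: "alg_le A (scale A (complex_of_real c) (inner_prod M y y)) s"
      using sc[OF y] by blast
    define g where "g = (\<lambda>t. Re (ev s (Some t)))"
    have "c \<le> g t" if "y t = 1" for t
    proof -
      have "ev s (Some t) - ev (scale A (complex_of_real c) (inner_prod M y y)) (Some t) \<in> \<real>\<^sub>\<ge>\<^sub>0"
        using le alg_le_iff[OF scale_in[OF inner_prod_in[OF y y]] s] by blast
      then show ?thesis
        using that by (simp add: ev_unitalization ev_inner_prod g_def complex_nonneg_Reals_iff del: ev_simps)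
    qed
    moreover have "\<exists>F0. finite F0 \<and> F0 \<subseteq> J \<and>
          (\<forall>F t. finite F \<longrightarrow> F0 \<subseteq> F \<longrightarrow> F \<subseteq> J \<longrightarrow> y t = 1 \<longrightarrow> \<bar>(\<Sum>j\<in>F. abs2 (x j t)) - g t\<bar> < e)"
      if e: "e > 0" for e
    proof -
      obtain F0 where F0: "finite F0" "F0 \<subseteq> J"
        and near: "\<And>F. finite F \<Longrightarrow> F0 \<subseteq> F \<Longrightarrow> F \<subseteq> J \<Longrightarrow> nrm A (?a F - s) < e"
      proof -
        have "\<exists>F0. finite F0 \<and> F0 \<subseteq> J \<and> (\<forall>F. finite F \<and> F0 \<subseteq> F \<and> F \<subseteq> J \<longrightarrow> nrm A (?a F - s) < e)"
          using order_tendstoD(2)[OF lim e] unfolding eventually_finite_subsets_at_top .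
        then show thesis using that by auto
      qed
      have "\<bar>(\<Sum>j\<in>F. abs2 (x j t)) - g t\<bar> < e"
        if F: "finite F" "F0 \<subseteq> F" "F \<subseteq> J" and t: "y t = 1" for F t
      proof -
        have "?a F \<in> carrier A" using F x y by (intro frame_partial_sum_in) auto
        then have "cmod (ev (?a F - s) (Some t)) \<le> nrm A (?a F - s)"
          using s y y1 t by (intro ev_le_nrm[where b = y]) (auto simp: diff_in)
        then have "cmod (ev (?a F - s) (Some t)) < e" using near[OF F] by simp
        moreover have "Re (ev (?a F - s) (Some t)) = (\<Sum>j\<in>F. abs2 (x j t)) - g t"
          unfolding ev_diff ev_frame_partial_sum g_def using t by (simp del: of_real_sum)
        ultimately show ?thesis using abs_Re_le_cmod[of "ev (?a F - s) (Some t)"] by linarith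
      qed
      then show ?thesis using F0 by blast
    qed
    ultimately show ?thesis by blast
  qed
  then show ?thesis using x c by blast
qed

end

section \<open>Constructing functions that vanish at infinity\<close>

lemma C0_Urysohn:
  assumes X: "locally_compact_space X" "Hausdorff_space X" and C: "compactin X C"
  obtains g :: "'a \<Rightarrow> real" where "(\<lambda>t. complex_of_real (g t)) \<in> carrier (C0 X)" "continuous_map X euclideanreal g"
    "\<And>t. 0 \<le> g t \<and> g t \<le> 1" "\<And>t. t \<in> C \<Longrightarrow> g t = 1"
proof -
  \<comment> \<open>The function will vanish off \<open>U\<close>, so all its positive superlevel
    sets lie in the compact set \<open>L\<close>.\<close>
  obtain U L where U: "openin X U" "compactin X L" "closedin X L" "C \<subseteq> U" "U \<subseteq> L"
    using X C locally_compact_space_compact_closed_compact by metis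
  have cr: "completely_regular_space X"
    using X locally_compact_regular_imp_completely_regular_space by blast
  have "closedin X (topspace X - U)" "disjnt C (topspace X - U)"
    using U by (auto simp: disjnt_def)
  then obtain f where f: "continuous_map X (top_of_set {0..1::real}) f" "f ` (topspace X - U) \<subseteq> {0}" "f ` C \<subseteq> {1}"
    using Urysohn_completely_regular_compact_closed[OF zero_le_one cr C] by metis
  define g where "g = (\<lambda>t. if t \<in> topspace X then f t else 0)"
  have fc: "continuous_map X euclideanreal f" and f01: "f ` topspace X \<subseteq> {0..1}"
    using f(1) by (auto simp: continuous_map_in_subtopology)
  have gc: "continuous_map X euclideanreal g"
    by (rule continuous_map_eq[OF fc]) (simp add: g_def)
  have "continuous_map euclideanreal euclidean complex_of_real" by (simp add: continuous_intros)
  from continuous_map_compose[OF gc this]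
  have "continuous_map X euclidean (\<lambda>t. complex_of_real (g t))" by (simp add: o_def)
  then have "(\<lambda>t. complex_of_real (g t)) \<in> carrier (C0 X)"
  proof (rule C0I)
    fix e :: real assume "e > 0"
    then have "{t \<in> topspace X. e \<le> cmod (complex_of_real (g t))} \<subseteq> L"
      using f(2) U by (force simp: g_def)
    then show "\<exists>C. compactin X C \<and> {t \<in> topspace X. e \<le> cmod (complex_of_real (g t))} \<subseteq> C"
      using U by blast
  qed (simp add: g_def)
  moreover have "0 \<le> g t \<and> g t \<le> 1" for t using f01 by (auto simp: g_def)
  moreover have "g t = 1" if "t \<in> C" for t
    using that f(3) compactin_subset_topspace[OF C] by (auto simp: g_def)
  ultimately show thesis using that gc by blast
qed

lemma C0_point_function:
  assumes P: "locally_compact_space P" "Hausdorff_space P" and p: "p \<in> topspace P"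
  obtains y where "y \<in> carrier (C0 P)" "\<And>t. cmod (y t) \<le> 1" "y p = 1"
proof (rule C0_Urysohn[OF P, of "{p}"])
  show "compactin P {p}" using p by simp
next
  fix g :: "'a \<Rightarrow> real"
  assume "(\<lambda>t. complex_of_real (g t)) \<in> carrier (C0 P)" "\<And>t. 0 \<le> g t \<and> g t \<le> 1" "\<And>t. t \<in> {p} \<Longrightarrow> g t = 1"
  then show thesis by (intro that[of "\<lambda>t. complex_of_real (g t)"]) simp_all
qed

text \<open>Multiplying by \<open>f\<close> does not change \<open>f\<close>, so the unit is 1
  wherever some \<open>f\<close> is. Its superlevel set at 1 then catches every such point, which
  forces compactness in the applications.\<close>

lemma C0_unit_eq_one:
  assumes "unital (C0 K)"
  obtains u where "u \<in> carrier (C0 K)" "\<And>f t. f \<in> carrier (C0 K) \<Longrightarrow> f t = 1 \<Longrightarrow> u t = 1"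
proof -
  obtain u where u: "u \<in> carrier (C0 K)" "\<And>f. f \<in> carrier (C0 K) \<Longrightarrow> (\<lambda>t. u t * f t) = f"
    using assms by (auto simp: unital_def is_unit_of_def C0_simps)
  have "u t = 1" if "f \<in> carrier (C0 K)" "f t = 1" for f t
    using fun_cong[OF u(2)[OF that(1)], of t] that(2) by simp
  then show thesis using u(1) that by blast
qed

lemma compact_imp_sigma_compact_space: "compactin X (topspace X) \<Longrightarrow> sigma_compact_space X"
  unfolding sigma_compact_space_def by (intro exI[of _ "{topspace X}"]) auto

text \<open>Each summand is the drop of the product when the factor with index \<open>n\<close> is
  added.\<close>

lemma sum_telescoping_product:
  fixes a :: "nat \<Rightarrow> 'a::comm_ring_1"
  shows "(\<Sum>n<N. a n * (\<Prod>m<n. 1 - a m)) = 1 - (\<Prod>m<N. 1 - a m)"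
  by (induction N) (simp_all add: algebra_simps)

text \<open>The squares are \<open>(g n)^2\<close> times the product of \<open>1 - (g m)^2\<close>
  over \<open>m < n\<close>. They telescope to 1 minus a product that becomes 0 as soon as a compact
  set containing the point has been met; so at each point the sum is finite and equal to 1.\<close>

lemma sigma_compact_square_partition:
  assumes X: "locally_compact_space X" "Hausdorff_space X" "sigma_compact_space X"
  shows "\<exists>h :: nat \<Rightarrow> 'a \<Rightarrow> complex. (\<forall>n. h n \<in> carrier (C0 X)) \<and>
    (\<forall>t\<in>topspace X. ((\<lambda>n. abs2 (h n t)) has_sum 1) UNIV)"
proof -
  obtain \<C> where \<C>: "countable \<C>" "\<forall>C\<in>\<C>. compactin X C" "\<Union>\<C> = topspace X"
    using X(3) by (auto simp: sigma_compact_space_def)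
  \<comment> \<open>The empty set is inserted so that an empty family can be enumerated as
    well.\<close>
  define C where "C = from_nat_into (insert {} \<C>)"
  have "range C = insert {} \<C>" unfolding C_def using \<C>(1) by (intro range_from_nat_into) auto
  then have C: "compactin X (C n)" "topspace X \<subseteq> \<Union> (range C)" for n
    using \<C> by (auto, metis compactin_empty insertE rangeI)
  have "\<exists>g :: 'a \<Rightarrow> real. (\<lambda>t. complex_of_real (g t)) \<in> carrier (C0 X) \<and> continuous_map X euclideanreal g \<and>
      (\<forall>t. 0 \<le> g t \<and> g t \<le> 1) \<and> (\<forall>t\<in>C n. g t = 1)" for n
    by (rule C0_Urysohn[OF X(1,2) C(1)[of n]]) blast
  then obtain g :: "nat \<Rightarrow> 'a \<Rightarrow> real" where g: "\<And>n. (\<lambda>t. complex_of_real (g n t)) \<in> carrier (C0 X)"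
    "\<And>n. continuous_map X euclideanreal (g n)" "\<And>n t. 0 \<le> g n t" "\<And>n t. g n t \<le> 1"
    "\<And>n t. t \<in> C n \<Longrightarrow> g n t = 1" by metis
  define q where "q = (\<lambda>n t. \<Prod>m<n. 1 - (g m t)\<^sup>2)"
  have q01: "0 \<le> q n t" "q n t \<le> 1" for n t
    using g(3,4) by (auto simp: q_def power_le_one intro!: prod_nonneg prod_le_1)
  define h where "h = (\<lambda>n t. complex_of_real (g n t) * complex_of_real (sqrt (q n t)))"
  have "h n \<in> carrier (C0 X)" for n
    unfolding h_def
  proof (rule C0_mult_bounded[OF g(1), where B = 1])
    have "continuous_map X euclideanreal (q n)"
      unfolding q_def by (intro continuous_map_prod continuous_map_diff continuous_map_real_pow g) auto
    moreover have "continuous_map euclideanreal euclidean (\<lambda>r. complex_of_real (sqrt r))" by (simp add: continuous_intros)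
    ultimately have "continuous_map X euclidean ((\<lambda>r. complex_of_real (sqrt r)) \<circ> q n)"
      by (rule continuous_map_compose)
    then show "continuous_map X euclidean (\<lambda>t. complex_of_real (sqrt (q n t)))" by (simp add: o_def)
  qed (use q01 in simp)
  moreover have "((\<lambda>n. abs2 (h n t)) has_sum 1) UNIV" if t: "t \<in> topspace X" for t
  proof -
    have h: "abs2 (h n t) = (g n t)\<^sup>2 * (\<Prod>m<n. 1 - (g m t)\<^sup>2)" for n
      using q01 by (simp add: h_def norm_mult power_mult_distrib q_def)
    obtain k where k: "t \<in> C k" using C(2) t by blast
    have z: "(\<Prod>m<n. 1 - (g m t)\<^sup>2) = 0" if "k < n" for n
      using that g(5)[OF k] by (intro prod_zero bexI[of _ k]) auto
    show ?thesis
    proof (rule has_sum_finite_neutralI)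
      show "1 = (\<Sum>n<Suc k. abs2 (h n t))"
        unfolding h sum_telescoping_product z[OF lessI] by simp
    qed (auto simp: h z not_less)
  qed
  ultimately show ?thesis by blast
qed

text \<open>Extension by zero from an open and closed copy. The preimage of \<open>U\<close> is the
  image of an open set, together with the complement of the copy if \<open>U\<close> contains 0;
  that complement is open because the copy is closed.\<close>

lemma C0_extend:
  assumes f: "f \<in> carrier (C0 X)" and e: "continuous_map X Y e" "open_map X Y e" "closedin Y (e ` topspace X)"
    and Fe: "\<And>x. x \<in> topspace X \<Longrightarrow> F (e x) = f x" and F0: "\<And>y. y \<notin> e ` topspace X \<Longrightarrow> F y = 0"
  shows "F \<in> carrier (C0 Y)"
proof (rule C0I)
  have sub: "e ` topspace X \<subseteq> topspace Y" using e(1) by (rule continuous_map_image_subset_topspace)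
  show "F t = 0" if "t \<notin> topspace Y" for t using that sub F0 by blast
  have "openin Y {y \<in> topspace Y. F y \<in> U}" if U: "open U" for U
  proof -
    have "openin X {x \<in> topspace X. f x \<in> U}"
      using C0D(1)[OF f] U by (intro openin_continuous_map_preimage) auto
    then have 1: "openin Y (e ` {x \<in> topspace X. f x \<in> U})" using e(2) by (simp add: open_map_def)
    have 2: "openin Y (topspace Y - e ` topspace X)" using e(3) by (simp add: closedin_def)
    have "{y \<in> topspace Y. F y \<in> U} = e ` {x \<in> topspace X. f x \<in> U} \<union>
        (if 0 \<in> U then topspace Y - e ` topspace X else {})"
      using Fe F0 sub by (auto simp: image_iff) metis+
    then show ?thesis using 1 2 by auto
  qed
  then show "continuous_map Y euclidean F" by (simp add: continuous_map_def)
  fix r :: real assume r: "r > 0"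
  have "compactin Y (e ` {x \<in> topspace X. r \<le> cmod (f x)})"
    by (rule image_compactin[OF C0D(2)[OF f r] e(1)])
  moreover have "{y \<in> topspace Y. r \<le> cmod (F y)} \<subseteq> e ` {x \<in> topspace X. r \<le> cmod (f x)}"
  proof
    fix y assume y: "y \<in> {y \<in> topspace Y. r \<le> cmod (F y)}"
    then have "y \<in> e ` topspace X" using F0[of y] r by force
    then show "y \<in> e ` {x \<in> topspace X. r \<le> cmod (f x)}" using Fe y by auto
  qed
  ultimately show "\<exists>C. compactin Y C \<and> {y \<in> topspace Y. r \<le> cmod (F y)} \<subseteq> C" by blast
qed

abbreviation (input) disjoint_union (infixr "\<squnion>" 65) where "(\<squnion>) \<equiv> disjoint_union_topology"
abbreviation (input) alpha ("\<alpha>") where "\<alpha> \<equiv> Alexandroff_compactification"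

section \<open>Disjoint unions and the punctured product\<close>

lemma topspace_disjoint_union_topology:
  "topspace (X \<squnion> Y) = Inl ` topspace X \<union> Inr ` topspace Y"
proof
  have "openin (X \<squnion> Y) (topspace (X \<squnion> Y))" by simp
  then have sub: "Inl -` topspace (X \<squnion> Y) \<subseteq> topspace X"
    "Inr -` topspace (X \<squnion> Y) \<subseteq> topspace Y"
    unfolding openin_disjoint_union_topology by (auto dest: openin_subset)
  show "topspace (X \<squnion> Y) \<subseteq> Inl ` topspace X \<union> Inr ` topspace Y"
  proof (intro subsetI)
    fix t assume "t \<in> topspace (X \<squnion> Y)"
    with sub show "t \<in> Inl ` topspace X \<union> Inr ` topspace Y"
      by (cases t) auto
  qed
  have "Inl -` (Inl ` topspace X \<union> Inr ` topspace Y) = topspace X"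
    "Inr -` (Inl ` topspace X \<union> Inr ` topspace Y) = topspace Y" by auto
  then have "openin (X \<squnion> Y) (Inl ` topspace X \<union> Inr ` topspace Y)"
    unfolding openin_disjoint_union_topology by simp
  then show "Inl ` topspace X \<union> Inr ` topspace Y \<subseteq> topspace (X \<squnion> Y)"
    by (rule openin_subset)
qed

lemma disjoint_union_injections:
  "continuous_map X (X \<squnion> Y) Inl" "continuous_map Y (X \<squnion> Y) Inr"
  "open_map X (X \<squnion> Y) Inl" "open_map Y (X \<squnion> Y) Inr"
  "closedin X S \<Longrightarrow> closedin (X \<squnion> Y) (Inl ` S)"
  "closedin Y T \<Longrightarrow> closedin (X \<squnion> Y) (Inr ` T)"
proof -
  note defs = topspace_disjoint_union_topology openin_disjoint_union_topology
  have vi: "Inl -` (Inl ` A) = A" "Inr -` (Inl ` A) = {}" "Inr -` (Inr ` B) = B" "Inl -` (Inr ` B) = {}"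
    for A :: "'a set" and B :: "'b set" by auto
  show "continuous_map X (X \<squnion> Y) Inl"
    unfolding continuous_map_def
  proof (intro conjI allI impI)
    fix U assume "openin (X \<squnion> Y) U"
    then have o: "openin X (Inl -` U)" by (simp add: openin_disjoint_union_topology)
    then have "{x \<in> topspace X. Inl x \<in> U} = Inl -` U" using openin_subset by fastforce
    then show "openin X {x \<in> topspace X. Inl x \<in> U}" using o by simp
  qed (simp add: topspace_disjoint_union_topology)
  show "continuous_map Y (X \<squnion> Y) Inr"
    unfolding continuous_map_def
  proof (intro conjI allI impI)
    fix U assume "openin (X \<squnion> Y) U"
    then have o: "openin Y (Inr -` U)" by (simp add: openin_disjoint_union_topology)
    then have "{x \<in> topspace Y. Inr x \<in> U} = Inr -` U" using openin_subset by fastforce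
    then show "openin Y {x \<in> topspace Y. Inr x \<in> U}" using o by simp
  qed (simp add: topspace_disjoint_union_topology)
  show "open_map X (X \<squnion> Y) Inl" "open_map Y (X \<squnion> Y) Inr"
    unfolding open_map_def defs vi by simp_all
  have "Inl -` (topspace (X \<squnion> Y) - Inl ` S) = topspace X - S"
    "Inr -` (topspace (X \<squnion> Y) - Inl ` S) = topspace Y"
    "Inl -` (topspace (X \<squnion> Y) - Inr ` T) = topspace X"
    "Inr -` (topspace (X \<squnion> Y) - Inr ` T) = topspace Y - T"
    unfolding topspace_disjoint_union_topology by auto
  then show "closedin X S \<Longrightarrow> closedin (X \<squnion> Y) (Inl ` S)"
    "closedin Y T \<Longrightarrow> closedin (X \<squnion> Y) (Inr ` T)"
    unfolding closedin_def openin_disjoint_union_topology topspace_disjoint_union_topology by auto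
qed

lemma continuous_map_disjoint_union:
  assumes f: "continuous_map X Z (f \<circ> Inl)" "continuous_map Y Z (f \<circ> Inr)"
  shows "continuous_map (X \<squnion> Y) Z f"
  unfolding continuous_map_def
proof (intro conjI allI impI)
  show "f \<in> topspace (X \<squnion> Y) \<rightarrow> topspace Z"
    using f by (auto simp: continuous_map_def topspace_disjoint_union_topology)
  fix U assume U: "openin Z U"
  have "Inl -` {t \<in> topspace (X \<squnion> Y). f t \<in> U} = {x \<in> topspace X. (f \<circ> Inl) x \<in> U}"
    "Inr -` {t \<in> topspace (X \<squnion> Y). f t \<in> U} = {y \<in> topspace Y. (f \<circ> Inr) y \<in> U}"
    unfolding topspace_disjoint_union_topology by auto
  then show "openin (X \<squnion> Y) {t \<in> topspace (X \<squnion> Y). f t \<in> U}"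
    unfolding openin_disjoint_union_topology
    using openin_continuous_map_preimage[OF f(1) U] openin_continuous_map_preimage[OF f(2) U] by (simp only:)
qed

text \<open>A member of the cover that contains \<open>\<infinity>\<close> leaves out only finitely
  many points.\<close>

lemma compact_UNIV_enat: "compact (UNIV :: enat set)"
proof (rule compactI)
  fix \<C> :: "enat set set" assume \<C>: "\<forall>t\<in>\<C>. open t" "UNIV \<subseteq> \<Union>\<C>"
  then obtain U where U: "U \<in> \<C>" "\<infinity> \<in> U" by blast
  then obtain n where n: "{enat n<..} \<subseteq> U" using \<C>(1) open_enat_iff by blast
  have "\<forall>k. \<exists>V. V \<in> \<C> \<and> enat k \<in> V" using \<C>(2) by blast
  then obtain V where V: "\<And>k. V k \<in> \<C> \<and> enat k \<in> V k" by metis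
  have "k \<in> \<Union> (insert U (V ` {..n}))" for k
  proof (cases "enat n < k")
    case False
    then obtain m where "k = enat m" "m \<le> n" by (cases k) auto
    then show ?thesis using V by auto
  qed (use n in auto)
  then show "\<exists>\<C>'\<subseteq>\<C>. finite \<C>' \<and> UNIV \<subseteq> \<Union>\<C>'"
    using U V by (intro exI[of _ "insert U (V ` {..n})"]) auto
qed

section \<open>The punctured product and its functions\<close>

lemma topspace_punctured_product:
  "topspace (punctured_product P) = insert None (Some ` topspace P) \<times> UNIV - {(None, \<infinity>)}"
  unfolding punctured_product_def Let_def topspace_subtopology by auto

lemma continuous_map_punctured_product:
  "continuous_map (prod_topology (\<alpha> P) euclidean) Z f \<Longrightarrow>
     continuous_map (punctured_product P) Z f"
  by (simp add: punctured_product_def Let_def continuous_map_from_subtopology)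

lemma compactin_punctured_product:
  "compactin (punctured_product P) S \<longleftrightarrow>
     compactin (prod_topology (\<alpha> P) euclidean) S \<and> (None, \<infinity>) \<notin> S"
  unfolding punctured_product_def Let_def compactin_subtopology
  using compactin_subset_topspace[of "prod_topology (\<alpha> P) euclidean" S] by auto

text \<open>Slices at finite level and lines over points of \<open>P\<close> both miss the puncture,
  so they remain full compact copies of \<open>\<alpha> P\<close> and of
  \<open>enat\<close>.\<close>

lemma slices_continuous:
  "continuous_map (\<alpha> P) (punctured_product P) (\<lambda>q. (q, enat n))"
  "p \<in> topspace P \<Longrightarrow> continuous_map euclidean (punctured_product P) (\<lambda>k. (Some p, k))"
proof -
  show "continuous_map (\<alpha> P) (punctured_product P) (\<lambda>q. (q, enat n))"
    unfolding punctured_product_def Let_def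
    by (rule continuous_map_into_subtopology) (auto intro!: continuous_map_pairedI)
  show "p \<in> topspace P \<Longrightarrow> continuous_map euclidean (punctured_product P) (\<lambda>k. (Some p, k))"
    unfolding punctured_product_def Let_def
    by (rule continuous_map_into_subtopology) (auto intro!: continuous_map_pairedI)
qed

definition level :: "'p topology \<Rightarrow> nat \<Rightarrow> 'p option \<times> enat \<Rightarrow> complex" where
  "level P n = (\<lambda>(q, k). if q \<in> insert None (Some ` topspace P) \<and> k = enat n then 1 else 0)"

definition cylinder :: "('p \<Rightarrow> complex) \<Rightarrow> 'p option \<times> enat \<Rightarrow> complex" where
  "cylinder g = (\<lambda>(q, k). case q of None \<Rightarrow> 0 | Some p \<Rightarrow> g p)"

text \<open>A finite level is isolated in \<open>enat\<close>, which gives continuity; the support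
  is a compact slice that misses the puncture.\<close>

lemma level_in: "level P n \<in> carrier (C0 (punctured_product P))"
proof (rule C0I)
  show "level P n t = 0" if "t \<notin> topspace (punctured_product P)" for t
    using that by (cases t) (auto simp: level_def topspace_punctured_product)
  have "continuous_map (euclidean :: enat topology) euclidean (\<lambda>k. if k = enat n then 1 else 0 :: complex)"
  proof -
    have "{k. (if k = enat n then 1 else 0 :: complex) \<in> U}
        = (if 1 \<in> U then {enat n} else {}) \<union> (if 0 \<in> U then - {enat n} else {})" for U
      by auto
    moreover have "open (- {enat n})" by (simp add: open_Compl)
    ultimately have "open {k. (if k = enat n then 1 else 0 :: complex) \<in> U}" for U
      by (simp add: open_enat open_Un)
    then show ?thesis by (simp add: continuous_map_def)
  qed
  then have "continuous_map (prod_topology (\<alpha> P) euclidean) euclidean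
      ((\<lambda>k. if k = enat n then 1 else 0 :: complex) \<circ> snd)"
    by (rule continuous_map_compose[OF continuous_map_snd])
  then have "continuous_map (prod_topology (\<alpha> P) euclidean) euclidean (level P n)"
    by (rule continuous_map_eq) (auto simp: level_def)
  then show "continuous_map (punctured_product P) euclidean (level P n)"
    by (rule continuous_map_punctured_product)
  fix e :: real assume "e > 0"
  have "compactin (\<alpha> P) (topspace (\<alpha> P))"
    using compact_space_Alexandroff_compactification[of P] unfolding compact_space_def .
  then have "compactin (punctured_product P) (topspace (\<alpha> P) \<times> {enat n})"
    unfolding compactin_punctured_product compactin_Times by simp
  moreover have "{t \<in> topspace (punctured_product P). e \<le> cmod (level P n t)}
      \<subseteq> topspace (\<alpha> P) \<times> {enat n}"
    using \<open>e > 0\<close> by (auto simp: level_def topspace_punctured_product split: if_splits)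
  ultimately show "\<exists>C. compactin (punctured_product P) C \<and>
      {t \<in> topspace (punctured_product P). e \<le> cmod (level P n t)} \<subseteq> C" by blast
qed

text \<open>Removing the puncture costs nothing: a superlevel set is a compact subset of
  \<open>P\<close> times the compact space \<open>enat\<close>, and so stays away from the point at
  infinity of \<open>P\<close>.\<close>

lemma cylinder_in:
  assumes g: "g \<in> carrier (C0 P)"
  shows "cylinder g \<in> carrier (C0 (punctured_product P))"
proof (rule C0I)
  show "cylinder g t = 0" if "t \<notin> topspace (punctured_product P)" for t
    using that C0D(3)[OF g] by (cases t; cases "fst t") (auto simp: cylinder_def topspace_punctured_product)
  let ?g = "\<lambda>q. case q of None \<Rightarrow> 0 | Some p \<Rightarrow> g p"
  have "openin (\<alpha> P) {q \<in> topspace (\<alpha> P). ?g q \<in> U}"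
    if U: "open U" for U
  \<comment> \<open>Exactly when \<open>U\<close> contains 0 does the preimage contain the point at
    infinity; its complement must then be compact, and it is, because it lies in a superlevel set of
    \<open>g\<close>.\<close>
  proof (cases "0 \<in> U")
    case True
    then obtain e where e: "e > 0" "ball 0 e \<subseteq> U" using U open_contains_ball by blast
    let ?C = "{p \<in> topspace P. g p \<in> - U}"
    have C: "closedin P ?C"
      by (rule closedin_continuous_map_preimage[OF C0D(1)[OF g]]) (use U in auto)
    moreover have "e \<le> cmod (g p)" if "g p \<in> - U" for p
    proof -
      have "g p \<notin> ball 0 e" using that e(2) by blast
      then show ?thesis by simp
    qed
    then have "?C \<subseteq> {p \<in> topspace P. e \<le> cmod (g p)}" by blast
    ultimately have "compactin P ?C" using C0D(2)[OF g e(1)] closed_compactin by blast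
    moreover have "{q \<in> topspace (\<alpha> P). ?g q \<in> U} = insert None (Some ` (topspace P - ?C))"
      using True by auto
    ultimately show ?thesis using C unfolding openin_Alexandroff_compactification by blast
  next
    case False
    have "openin P {p \<in> topspace P. g p \<in> U}"
      by (rule openin_continuous_map_preimage[OF C0D(1)[OF g]]) (use U in auto)
    moreover have "{q \<in> topspace (\<alpha> P). ?g q \<in> U} = Some ` {p \<in> topspace P. g p \<in> U}"
      using False by auto
    ultimately show ?thesis by simp
  qed
  then have "continuous_map (\<alpha> P) euclidean ?g" by (simp add: continuous_map_def)
  from continuous_map_compose[OF continuous_map_fst this]
  have "continuous_map (prod_topology (\<alpha> P) euclidean) euclidean (cylinder g)"
    by (simp add: cylinder_def o_def case_prod_unfold)
  then show "continuous_map (punctured_product P) euclidean (cylinder g)"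
    by (rule continuous_map_punctured_product)
  fix e :: real assume e: "e > 0"
  let ?C = "Some ` {p \<in> topspace P. e \<le> cmod (g p)} \<times> (UNIV :: enat set)"
  have "compactin (\<alpha> P) (Some ` {p \<in> topspace P. e \<le> cmod (g p)})"
    by (rule image_compactin[OF C0D(2)[OF g e] continuous_map_Some])
  then have "compactin (punctured_product P) ?C"
    unfolding compactin_punctured_product compactin_Times by (auto simp: compact_UNIV_enat)
  moreover have "{t \<in> topspace (punctured_product P). e \<le> cmod (cylinder g t)} \<subseteq> ?C"
    using e by (auto simp: cylinder_def topspace_punctured_product split: option.splits)
  ultimately show "\<exists>C. compactin (punctured_product P) C \<and>
      {t \<in> topspace (punctured_product P). e \<le> cmod (cylinder g t)} \<subseteq> C" by blast
qed

lemma C0_extend_Inr: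
  assumes "f \<in> carrier (C0 Y)"
  shows "case_sum (\<lambda>_. 0) f \<in> carrier (C0 (X \<squnion> Y))"
  by (rule C0_extend[OF assms disjoint_union_injections(2,4) disjoint_union_injections(6)])
    (use C0D(3)[OF assms] in \<open>auto split: sum.splits\<close>)

lemma C0_extend_component:
  assumes f: "f \<in> carrier (C0 (X l))" and l: "l \<in> \<Lambda>"
  shows "case_sum (\<lambda>(l', a). if l' = l then f a else 0) (\<lambda>_. 0)
    \<in> carrier (C0 (sum_topology X \<Lambda> \<squnion> Y))"
proof (rule C0_extend[OF f, where e = "Inl \<circ> Pair l"])
  show "continuous_map (X l) (sum_topology X \<Lambda> \<squnion> Y) (Inl \<circ> Pair l)"
    by (rule continuous_map_compose[OF continuous_map_component_injection[OF l] disjoint_union_injections(1)])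
  show "open_map (X l) (sum_topology X \<Lambda> \<squnion> Y) (Inl \<circ> Pair l)"
    by (rule open_map_compose[OF open_map_component_injection[OF l] disjoint_union_injections(3)])
  have "closedin (sum_topology X \<Lambda>) (Pair l ` topspace (X l))"
    using closed_map_component_injection[OF l] by (auto simp: closed_map_def)
  then show "closedin (sum_topology X \<Lambda> \<squnion> Y) ((Inl \<circ> Pair l) ` topspace (X l))"
    unfolding image_comp[symmetric] by (rule disjoint_union_injections)
  show "case_sum (\<lambda>(l', a). if l' = l then f a else 0) (\<lambda>_. 0) y = 0" if "y \<notin> (Inl \<circ> Pair l) ` topspace (X l)" for y
    using that C0D(3)[OF f] by (auto split: sum.splits)
qed simp

section \<open>Frames on disjoint unions with a punctured product\<close>

context
  fixes P :: "'p topology" and Z :: "'z topology"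
  assumes P: "locally_compact_space P" "Hausdorff_space P"
begin

abbreviation (input) "Q \<equiv> Z \<squnion> punctured_product P"

text \<open>The superlevel set is cut with the closed level \<open>\<infinity>\<close> and projected
  to the Hausdorff space \<open>\<alpha> P\<close>. The image is closed there and misses the point
  at infinity, hence is compact in \<open>P\<close>.\<close>

lemma compactin_top_slice:
  assumes f: "f \<in> carrier (C0 Q)" and e: "e > 0"
  shows "compactin P {p \<in> topspace P. e \<le> cmod (f (Inr (Some p, \<infinity>)))}"
proof -
  \<comment> \<open>On the summand \<open>Z\<close> the values are dummies; the dummy level 0
    differs from \<open>\<infinity>\<close>, so that summand drops out of \<open>C\<close>.\<close>
  define r where "r = (\<lambda>t :: 'z + 'p option \<times> enat. case t of Inl _ \<Rightarrow> None | Inr (q, k) \<Rightarrow> q)"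
  define lev where "lev = (\<lambda>t :: 'z + 'p option \<times> enat. case t of Inl _ \<Rightarrow> 0 | Inr (q, k) \<Rightarrow> k)"
  have r: "continuous_map Q (\<alpha> P) r"
  proof (rule continuous_map_disjoint_union)
    show "continuous_map (punctured_product P) (\<alpha> P) (r \<circ> Inr)"
      using continuous_map_punctured_product[OF continuous_map_fst]
      by (simp add: r_def o_def case_prod_unfold)
  qed (simp add: r_def o_def)
  have lev: "continuous_map Q euclidean lev"
  proof (rule continuous_map_disjoint_union)
    show "continuous_map (punctured_product P) euclidean (lev \<circ> Inr)"
      using continuous_map_punctured_product[OF continuous_map_snd]
      by (simp add: lev_def o_def case_prod_unfold)
  qed (simp add: lev_def o_def)
  define C where "C = {t \<in> topspace Q. e \<le> cmod (f t)} \<inter> {t \<in> topspace Q. lev t \<in> {\<infinity>}}"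
  have "closedin Q {t \<in> topspace Q. lev t \<in> {\<infinity>}}"
    by (rule closedin_continuous_map_preimage[OF lev]) simp
  then have "compactin Q C" unfolding C_def by (rule compact_Int_closedin[OF C0D(2)[OF f e]])
  then have "compactin (\<alpha> P) (r ` C)" by (rule image_compactin[OF _ r])
  moreover have "r ` C = Some ` {p \<in> topspace P. e \<le> cmod (f (Inr (Some p, \<infinity>)))}"
  proof
    show "r ` C \<subseteq> Some ` {p \<in> topspace P. e \<le> cmod (f (Inr (Some p, \<infinity>)))}"
      by (auto simp: C_def r_def lev_def topspace_disjoint_union_topology topspace_punctured_product)
    show "Some ` {p \<in> topspace P. e \<le> cmod (f (Inr (Some p, \<infinity>)))} \<subseteq> r ` C"
    proof clarify
      fix p assume "p \<in> topspace P" "e \<le> cmod (f (Inr (Some p, \<infinity>)))"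
      then have "Inr (Some p, \<infinity>) \<in> C"
        by (auto simp: C_def lev_def topspace_disjoint_union_topology topspace_punctured_product)
      moreover have "r (Inr (Some p, \<infinity>)) = Some p" by (simp add: r_def)
      ultimately show "Some p \<in> r ` C" by (metis image_eqI)
    qed
  qed
  moreover have "Hausdorff_space (\<alpha> P)"
    using P by (simp add: Hausdorff_space_Alexandroff_compactification)
  ultimately have "closedin (\<alpha> P) (Some ` {p \<in> topspace P. e \<le> cmod (f (Inr (Some p, \<infinity>)))})"
    using compactin_imp_closedin by fastforce
  then show ?thesis unfolding closedin_Alexandroff_compactification_image_Some by blast
qed

text \<open>A unit would be 1 on the whole level \<open>\<infinity>\<close>, a copy of
  \<open>P\<close>, so \<open>compactin_top_slice\<close> would make \<open>P\<close>
  compact.\<close>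

lemma nonunital_disjoint_union:
  assumes "\<not> sigma_compact_space P"
  shows "\<not> unital (C0 Q)"
proof
  assume "unital (C0 Q)"
  then obtain u where u: "u \<in> carrier (C0 Q)" "\<And>f t. f \<in> carrier (C0 Q) \<Longrightarrow> f t = 1 \<Longrightarrow> u t = 1"
    using C0_unit_eq_one by metis
  have "u (Inr (Some p, \<infinity>)) = 1" if p: "p \<in> topspace P" for p
  proof (rule C0_point_function[OF P p])
    fix y assume y: "y \<in> carrier (C0 P)" "y p = 1"
    show ?thesis
      by (rule u(2)[OF C0_extend_Inr[OF cylinder_in[OF y(1)]]]) (simp add: cylinder_def y)
  qed
  then have "compactin P (topspace P)" using compactin_top_slice[OF u(1) zero_less_one] by (simp cong: conj_cong)
  then show False using compact_imp_sigma_compact_space assms by blast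
qed

end

lemma nonunital_of_not_sigma_compact:
  assumes P: "locally_compact_space P" "Hausdorff_space P" "\<not> sigma_compact_space P"
  shows "\<not> unital (C0 P)"
proof
  assume "unital (C0 P)"
  then obtain u where u: "u \<in> carrier (C0 P)" "\<And>f t. f \<in> carrier (C0 P) \<Longrightarrow> f t = 1 \<Longrightarrow> u t = 1"
    using C0_unit_eq_one by metis
  have "u p = 1" if "p \<in> topspace P" for p
    by (rule C0_point_function[OF P(1,2) that]) (rule u(2))
  then have "compactin P (topspace P)" using C0D(2)[OF u(1) zero_less_one] by (simp cong: conj_cong)
  then show False using compact_imp_sigma_compact_space P(3) by blast
qed

theorem no_standard_frame:
  fixes P :: "'p topology" and Z :: "'z topology" and x :: "'i \<Rightarrow> 'z + 'p option \<times> enat \<Rightarrow> complex"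
  assumes P: "locally_compact_space P" "Hausdorff_space P" "\<not> sigma_compact_space P"
  shows "\<not> standard_frame (self_module (C0 (Z \<squnion> punctured_product P))) J x"
proof
  let ?Q = "Z \<squnion> punctured_product P"
  assume "standard_frame (self_module (C0 ?Q)) J x"
  interpret Q: nonunital_C0 ?Q
    by unfold_locales (rule nonunital_disjoint_union[OF P])
  obtain c where x: "\<And>j. j \<in> J \<Longrightarrow> x j \<in> carrier (C0 ?Q)" and c: "c > 0"
    and unif: "\<And>y. y \<in> carrier (C0 ?Q) \<Longrightarrow> (\<And>t. cmod (y t) \<le> 1) \<Longrightarrow>
      \<exists>g. (\<forall>t. y t = 1 \<longrightarrow> c \<le> g t) \<and>
        (\<forall>e>0. \<exists>F0. finite F0 \<and> F0 \<subseteq> J \<and>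
          (\<forall>F t. finite F \<longrightarrow> F0 \<subseteq> F \<longrightarrow> F \<subseteq> J \<longrightarrow> y t = 1 \<longrightarrow> \<bar>(\<Sum>j\<in>F. abs2 (x j t)) - g t\<bar> < e))"
    using Q.standard_frame_uniform[OF \<open>standard_frame _ _ _\<close>] by auto
  define S where "S = (\<lambda>F t. \<Sum>j\<in>F. abs2 (x j t))"
  have S_cont: "continuous_map ?Q euclideanreal (S F)" if "finite F" "F \<subseteq> J" for F
    unfolding S_def using that x by (intro continuous_map_sum C0_cmod_power2) auto
  have S_mono: "S F t \<le> S G t" if "finite G" "F \<subseteq> G" for F G t
    unfolding S_def using that by (intro sum_mono2) auto
  \<comment> \<open>Since \<open>level P n\<close> is 1 at \<open>(None, enat n)\<close>, the limit
    there is at least \<open>c\<close>, and an error below \<open>c / 2\<close> leaves more than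
    \<open>c / 2\<close> for a finite sum.\<close>
  have "\<exists>F. finite F \<and> F \<subseteq> J \<and> c / 2 < S F (Inr (None, enat n))" for n
  proof -
    let ?y = "case_sum (\<lambda>_. 0) (level P n) :: 'z + 'p option \<times> enat \<Rightarrow> complex"
    have y: "?y \<in> carrier (C0 ?Q)" by (rule C0_extend_Inr[OF level_in])
    have "cmod (?y t) \<le> 1" for t by (auto simp: level_def split: sum.splits)
    then obtain g F0 where g: "\<And>t. ?y t = 1 \<Longrightarrow> c \<le> g t" and F0: "finite F0" "F0 \<subseteq> J"
      and near: "\<And>F t. finite F \<Longrightarrow> F0 \<subseteq> F \<Longrightarrow> F \<subseteq> J \<Longrightarrow> ?y t = 1 \<Longrightarrow> \<bar>S F t - g t\<bar> < c / 2"
      using unif[OF y] c half_gt_zero[OF c] unfolding S_def by metis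
    have y1: "?y (Inr (None, enat n)) = 1" by (simp add: level_def)
    have "c / 2 < S F0 (Inr (None, enat n))"
      using near[OF F0(1) subset_refl F0(2) y1] g[OF y1] by linarith
    then show ?thesis using F0 by blast
  qed
  then obtain F where F: "\<And>n. finite (F n)" "\<And>n. F n \<subseteq> J" "\<And>n. c / 2 < S (F n) (Inr (None, enat n))" by metis
  define J0 where "J0 = (\<Union>n. F n)"
  define D where "D = (\<lambda>n. {p \<in> topspace P. S (F n) (Inr (Some p, enat n)) \<le> c / 2})"
  \<comment> \<open>For fixed \<open>j\<close>, these sets exhaust the points over which
    \<open>x j\<close> does not vanish at level \<open>\<infinity>\<close>.\<close>
  define E where "E = (\<lambda>(j, m). {p \<in> topspace P. inverse (real (Suc m)) \<le> cmod (x j (Inr (Some p, \<infinity>)))})"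
  have D: "compactin P (D n)" for n
  proof -
    have "continuous_map (\<alpha> P) euclideanreal (S (F n) \<circ> (Inr \<circ> (\<lambda>q. (q, enat n))))"
      by (rule continuous_map_compose[OF continuous_map_compose[OF slices_continuous(1) disjoint_union_injections(2)]
            S_cont[OF F(1,2)]])
    from closedin_continuous_map_preimage[OF this, of "{..c / 2}"]
    have "closedin (\<alpha> P)
        {q \<in> topspace (\<alpha> P). S (F n) (Inr (q, enat n)) \<le> c / 2}" by simp
    \<comment> \<open>The strict inequality at \<open>None\<close> keeps the point at infinity out
      of this closed set, so what remains is compact in \<open>P\<close>.\<close>
    moreover have "{q \<in> topspace (\<alpha> P). S (F n) (Inr (q, enat n)) \<le> c / 2} = Some ` D n"
      using F(3)[of n] by (auto simp: D_def)
    ultimately show ?thesis by simp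
  qed
  have E: "compactin P (E (j, m))" if "j \<in> J0" for j m
    unfolding E_def using that F(2) x by (auto simp: J0_def intro!: compactin_top_slice[OF P(1,2)])
  have key: "\<exists>j\<in>J0. x j (Inr (Some p, \<infinity>)) \<noteq> 0" if p: "p \<in> topspace P" and nD: "\<And>n. p \<notin> D n" for p
  proof (rule ccontr)
    assume "\<not> ?thesis"
    then have zero: "x j (Inr (Some p, \<infinity>)) = 0" if "j \<in> J0" for j using that by blast
    obtain y0 where y0: "y0 \<in> carrier (C0 P)" "\<And>t. cmod (y0 t) \<le> 1" "y0 p = 1"
      using C0_point_function[OF P(1,2) p] by metis
    let ?y = "case_sum (\<lambda>_. 0) (cylinder y0) :: 'z + 'p option \<times> enat \<Rightarrow> complex"
    have y: "?y \<in> carrier (C0 ?Q)" by (rule C0_extend_Inr[OF cylinder_in[OF y0(1)]])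
    have "cmod (?y t) \<le> 1" for t using y0(2) by (auto simp: cylinder_def split: sum.splits option.splits)
    \<comment> \<open>Two approximations with error \<open>c / 8\<close> bound what
      \<open>F n\<close> contributes outside \<open>F0\<close> by \<open>c / 4\<close>; of the
      \<open>c / 2\<close> carried by \<open>F n\<close>, at least \<open>c / 4\<close> then sits
      inside \<open>F0\<close>.\<close>
    moreover have "c / 8 > 0" using c by simp
    ultimately obtain g F0 where F0: "finite F0" "F0 \<subseteq> J"
      and near: "\<And>F t. finite F \<Longrightarrow> F0 \<subseteq> F \<Longrightarrow> F \<subseteq> J \<Longrightarrow> ?y t = 1 \<Longrightarrow> \<bar>S F t - g t\<bar> < c / 8"
      using unif[OF y] unfolding S_def by metis
    have y1: "?y (Inr (Some p, k)) = 1" for k using y0(3) by (simp add: cylinder_def)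
    \<comment> \<open>The index set is one finite set for all levels; it contains every
      \<open>F n \<inter> F0\<close>, while all its members vanish at
      \<open>(p, \<infinity>)\<close> by assumption.\<close>
    define \<phi> where "\<phi> = (\<lambda>k. S (F0 \<inter> J0) (Inr (Some p, k)))"
    have low: "c / 4 \<le> \<phi> (enat n)" for n
    proof -
      let ?t = "Inr (Some p, enat n)"
      have "S (F0 \<union> F n) ?t = S F0 ?t + S (F n - F0) ?t"
        unfolding S_def using F0(1) F(1)[of n] by (subst sum.union_disjoint[symmetric]) (auto intro: sum.cong)
      moreover have "\<bar>S F0 ?t - g ?t\<bar> < c / 8" by (rule near) (use F0 y1 in auto)
      moreover have "\<bar>S (F0 \<union> F n) ?t - g ?t\<bar> < c / 8" by (rule near) (use F0 F y1 in auto)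
      ultimately have "S (F n - F0) ?t < c / 4" by linarith
      moreover have "S (F n) ?t = S (F n \<inter> F0) ?t + S (F n - F0) ?t"
        unfolding S_def using F(1)[of n] by (subst sum.union_disjoint[symmetric]) (auto intro: sum.cong)
      moreover have "c / 2 < S (F n) ?t" using nD[of n] p by (simp add: D_def)
      moreover have "S (F n \<inter> F0) ?t \<le> \<phi> (enat n)"
        unfolding \<phi>_def using F0(1) by (intro S_mono) (auto simp: J0_def)
      ultimately show ?thesis by linarith
    qed
    have "continuous_map euclidean euclideanreal (S (F0 \<inter> J0) \<circ> (Inr \<circ> (\<lambda>k. (Some p, k))))"
      by (rule continuous_map_compose[OF continuous_map_compose[OF slices_continuous(2)[OF p] disjoint_union_injections(2)]
            S_cont]) (use F0 in auto)
    \<comment> \<open>The finite sum \<open>\<phi>\<close> is continuous on \<open>enat\<close> and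
      0 at \<open>\<infinity>\<close>, so it falls below \<open>c / 4\<close> at some finite level,
      against \<open>low\<close>.\<close>
    from openin_continuous_map_preimage[OF this, of "{..<c / 4}"]
    have "open {k. \<phi> k < c / 4}" by (simp add: \<phi>_def)
    moreover have "\<infinity> \<in> {k. \<phi> k < c / 4}" using zero c by (simp add: \<phi>_def S_def)
    ultimately have "\<exists>n. {enat n<..} \<subseteq> {k. \<phi> k < c / 4}" unfolding open_enat_iff by (rule mp)
    then obtain n where "{enat n<..} \<subseteq> {k. \<phi> k < c / 4}" by (elim exE)
    then have "enat (Suc n) \<in> {k. \<phi> k < c / 4}" by (rule subsetD) simp
    then show False using low[of "Suc n"] by simp
  qed
  have "countable (range D \<union> E ` (J0 \<times> UNIV))"
  proof -
    have "countable J0" unfolding J0_def by (intro countable_UN countable_finite[OF F(1)]) simp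
    then show ?thesis by (intro countable_Un countable_image countable_SIGMA) auto
  qed
  moreover have "\<forall>C \<in> range D \<union> E ` (J0 \<times> UNIV). compactin P C" using D E by auto
  moreover have "\<Union> (range D \<union> E ` (J0 \<times> UNIV)) = topspace P"
  proof
    show "\<Union> (range D \<union> E ` (J0 \<times> UNIV)) \<subseteq> topspace P" by (auto simp: D_def E_def)
    show "topspace P \<subseteq> \<Union> (range D \<union> E ` (J0 \<times> UNIV))"
    proof
      fix p assume p: "p \<in> topspace P"
      show "p \<in> \<Union> (range D \<union> E ` (J0 \<times> UNIV))"
      proof (cases "\<exists>n. p \<in> D n")
        case False
        then obtain j where j: "j \<in> J0" "x j (Inr (Some p, \<infinity>)) \<noteq> 0" using key[OF p] by blast
        then obtain m where "inverse (real (Suc m)) < cmod (x j (Inr (Some p, \<infinity>)))"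
          using reals_Archimedean[of "cmod (x j (Inr (Some p, \<infinity>)))"] by auto
        then have "p \<in> E (j, m)" using p by (simp add: E_def)
        then show ?thesis using j(1) by (intro UnionI[of "E (j, m)"]) auto
      qed auto
    qed
  qed
  ultimately have "sigma_compact_space P" unfolding sigma_compact_space_def by blast
  then show False using P(3) by simp
qed

text \<open>A nonzero function occurs only finitely often in a family with bounded square sums, so the
  occurrences of each value can be numbered.\<close>

lemma has_nonstandard_frame_of_family:
  fixes x :: "'q \<Rightarrow> 'k \<Rightarrow> complex"
  assumes nu: "\<not> unital (C0 K)" and x: "\<And>j. j \<in> J \<Longrightarrow> x j \<in> carrier (C0 K)" and c1: "0 < c1"
    and sums: "\<And>t. t \<in> topspace K \<Longrightarrow> \<exists>s. ((\<lambda>j. abs2 (x j t)) has_sum s) J \<and> c1 \<le> s \<and> s \<le> c2"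
  shows "has_nonstandard_frame (self_module (C0 K))"
proof -
  interpret nonunital_C0 K by (rule nonunital_C0.intro[OF nu])
  have fibre: "finite {j \<in> J. x j = v}" if "v \<noteq> 0" for v
  proof (cases "\<exists>j\<in>J. x j = v")
    case True
    then have v: "v \<in> carrier (C0 K)" using x by blast
    have "\<exists>t. v t \<noteq> 0" using that by (simp add: zero_fun_def fun_eq_iff)
    then obtain t where t: "v t \<noteq> 0" by blast
    have "t \<in> topspace K"
    proof (rule ccontr)
      assume "t \<notin> topspace K"
      from C0D(3)[OF v this] t show False by simp
    qed
    from sums[OF this] obtain s where s: "((\<lambda>j. abs2 (x j t)) has_sum s) J" by blast
    show ?thesis
    proof (rule ccontr)
      assume inf: "infinite {j \<in> J. x j = v}"
      obtain n where n: "s < real n * abs2 (v t)"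
        using reals_Archimedean3[of "abs2 (v t)"] t by auto
      obtain G where G: "G \<subseteq> {j \<in> J. x j = v}" "finite G" "card G = n"
        using infinite_arbitrarily_large[OF inf] by metis
      have "(\<Sum>j\<in>G. abs2 (x j t)) \<le> s"
        by (rule finite_sum_le_has_sum[OF s G(2)]) (use G in auto)
      moreover have "(\<Sum>j\<in>G. abs2 (x j t)) = real n * abs2 (v t)"
        using G by (subst sum.cong[OF refl, of _ _ "\<lambda>_. abs2 (v t)"]) auto
      ultimately show False using n by simp
    qed
  next
    case False
    then have "{j \<in> J. x j = v} = {}" by blast
    then show ?thesis by (simp only: finite.emptyI)
  qed
  have "\<exists>h :: 'q \<Rightarrow> nat. inj_on h {j \<in> J. x j = v}" if "v \<noteq> 0" for v
    using finite_imp_inj_to_nat_seg[OF fibre[OF that]] by blast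
  then obtain h :: "('k \<Rightarrow> complex) \<Rightarrow> 'q \<Rightarrow> nat" where h: "\<And>v. v \<noteq> 0 \<Longrightarrow> inj_on (h v) {j \<in> J. x j = v}" by metis
  define J0 where "J0 = {j \<in> J. x j \<noteq> 0}"
  \<comment> \<open>The second component numbers the indices that share the same function, which
    makes \<open>i\<close> injective into the prescribed index type.\<close>
  define i where "i = (\<lambda>j. (x j, h (x j) j))"
  have inj: "inj_on i J0"
  proof (rule inj_onI)
    fix j k assume jk: "j \<in> J0" "k \<in> J0" "i j = i k"
    then have e: "x j = x k" "h (x j) j = h (x j) k" by (auto simp: i_def)
    then show "j = k"
      using inj_onD[OF h[of "x j"], of j k] jk by (auto simp: J0_def)
  qed
  have "nonstandard_frame_bounds (self_module (C0 K)) (i ` J0) fst c1 c2"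
  proof (rule pointwise_bounds_imp_nonstandard_frame_bounds[OF _ c1])
    show "fst k \<in> carrier (C0 K)" if "k \<in> i ` J0" for k using that x by (auto simp: i_def J0_def)
    fix t assume "t \<in> topspace K"
    then obtain s where s: "((\<lambda>j. abs2 (x j t)) has_sum s) J" "c1 \<le> s" "s \<le> c2" using sums by blast
    have "((\<lambda>k. abs2 (fst k t)) has_sum s) (i ` J0) \<longleftrightarrow> ((\<lambda>j. abs2 (x j t)) has_sum s) J0"
      unfolding has_sum_reindex[OF inj] by (simp add: o_def i_def)
    also have "\<dots> \<longleftrightarrow> ((\<lambda>j. abs2 (x j t)) has_sum s) J"
      by (rule has_sum_cong_neutral) (auto simp: J0_def)
    finally show "\<exists>s. ((\<lambda>k. abs2 (fst k t)) has_sum s) (i ` J0) \<and> c1 \<le> s \<and> s \<le> c2" using s by blast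
  qed
  \<comment> \<open>A frame also needs a positive upper constant, and this follows from
    \<open>sums\<close> only if the space has a point; over an empty space 0 would be a
    unit.\<close>
  moreover have "0 < c2 \<or> topspace K = {}" using sums c1 by fastforce
  moreover have "topspace K \<noteq> {}"
  proof
    assume "topspace K = {}"
    then have "f = (\<lambda>t. 0)" if "f \<in> carrier (C0 K)" for f using C0D(3)[OF that] by blast
    then have "is_unit_of (C0 K) 0"
      unfolding is_unit_of_def C0_simps using C0_zero[of K] by force
    then show False using nu by (auto simp: unital_def)
  qed
  ultimately have "nonstandard_frame (self_module (C0 K)) (i ` J0) fst"
    unfolding nonstandard_frame_def using c1 by blast
  then show ?thesis unfolding has_nonstandard_frame_def by blast
qed

section \<open>The non-standard frame on the whole space\<close>

definition combined_family ::
    "('l \<Rightarrow> nat \<Rightarrow> 'a \<Rightarrow> complex) \<Rightarrow> 'p topology \<Rightarrow> ('j \<Rightarrow> 'p \<Rightarrow> complex) \<Rightarrow>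
     ('l \<times> nat) + (nat + 'j) \<Rightarrow> ('l \<times> 'a) + ('p option \<times> enat) \<Rightarrow> complex" where
  "combined_family h P x i = (case i of
     Inl (l, n) \<Rightarrow> case_sum (\<lambda>(l', a). if l' = l then h l n a else 0) (\<lambda>_. 0)
   | Inr (Inl n) \<Rightarrow> case_sum (\<lambda>_. 0) (level P n)
   | Inr (Inr j) \<Rightarrow> case_sum (\<lambda>_. 0) (cylinder (x j)))"

theorem nonstandard_frame_exists:
  fixes X :: "'l \<Rightarrow> 'a topology" and P :: "'p topology" and x :: "'j \<Rightarrow> 'p \<Rightarrow> complex"
  assumes X: "\<And>l. l \<in> \<Lambda> \<Longrightarrow> locally_compact_space (X l)" "\<And>l. l \<in> \<Lambda> \<Longrightarrow> Hausdorff_space (X l)"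
      "\<And>l. l \<in> \<Lambda> \<Longrightarrow> sigma_compact_space (X l)"
    and P: "locally_compact_space P" "Hausdorff_space P" "\<not> sigma_compact_space P"
    and f: "normalized_frame (self_module (C0 P)) J x"
  shows "has_nonstandard_frame (self_module (C0 (sum_topology X \<Lambda> \<squnion> punctured_product P)))"
    (is "has_nonstandard_frame (self_module (C0 ?K))")
proof -
  interpret P: nonunital_C0 P by (rule nonunital_C0.intro[OF nonunital_of_not_sigma_compact[OF P]])
  have x: "x j \<in> carrier (C0 P)" if "j \<in> J" for j
    using f that by (simp add: normalized_frame_def nonstandard_frame_bounds_def self_module_simps Let_def)
  \<comment> \<open>A function with value 1 at \<open>p\<close> removes the weight from the
    pointwise frame identity.\<close>
  have xsum: "((\<lambda>j. abs2 (x j p)) has_sum 1) J" if p: "p \<in> topspace P" for p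
  proof -
    obtain y where y: "y \<in> carrier (C0 P)" "y p = 1" using C0_point_function[OF P(1,2) p] by metis
    show ?thesis using P.normalized_frame_pointwise[OF f y(1), of p] y(2) by simp
  qed
  have "\<exists>h :: nat \<Rightarrow> 'a \<Rightarrow> complex. (\<forall>n. h n \<in> carrier (C0 (X l))) \<and>
      (\<forall>t\<in>topspace (X l). ((\<lambda>n. abs2 (h n t)) has_sum 1) UNIV)" if "l \<in> \<Lambda>" for l
    by (rule sigma_compact_square_partition) (rule X[OF that])+
  then obtain h :: "'l \<Rightarrow> nat \<Rightarrow> 'a \<Rightarrow> complex" where h: "\<And>l n. l \<in> \<Lambda> \<Longrightarrow> h l n \<in> carrier (C0 (X l))"
    "\<And>l t. l \<in> \<Lambda> \<Longrightarrow> t \<in> topspace (X l) \<Longrightarrow> ((\<lambda>n. abs2 (h l n t)) has_sum 1) UNIV" by metis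
  define z where "z = combined_family h P x"
  have z: "z (Inl (l, n)) = case_sum (\<lambda>(l', a). if l' = l then h l n a else 0) (\<lambda>_. 0)"
    "z (Inr (Inl n)) = case_sum (\<lambda>_. 0) (level P n)" "z (Inr (Inr j)) = case_sum (\<lambda>_. 0) (cylinder (x j))" for l n j
    by (simp_all add: z_def combined_family_def)
  define A B D :: "(('l \<times> nat) + (nat + 'j)) set"
    where "A = Inl ` (\<Lambda> \<times> UNIV)" and "B = range (Inr \<circ> Inl)" and "D = (Inr \<circ> Inr) ` J"
  note ABD = A_def B_def D_def
  have total: "((\<lambda>i. abs2 (z i t)) has_sum (a + (b + d))) (A \<union> (B \<union> D))"
    if "((\<lambda>(l, n). abs2 (z (Inl (l, n)) t)) has_sum a) (\<Lambda> \<times> UNIV)"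
      "((\<lambda>n. abs2 (z (Inr (Inl n)) t)) has_sum b) UNIV" "((\<lambda>j. abs2 (z (Inr (Inr j)) t)) has_sum d) J" for a b d t
  proof (intro has_sum_Un_disjoint)
    show "((\<lambda>i. abs2 (z i t)) has_sum a) A"
      unfolding A_def using that(1) by (subst has_sum_reindex) (auto simp: o_def case_prod_unfold)
    show "((\<lambda>i. abs2 (z i t)) has_sum b) B"
      unfolding B_def using that(2) by (subst has_sum_reindex) (auto simp: o_def inj_on_def)
    show "((\<lambda>i. abs2 (z i t)) has_sum d) D"
      unfolding D_def using that(3) by (subst has_sum_reindex) (auto simp: o_def inj_on_def)
  qed (auto simp: ABD)
  show ?thesis
  proof (rule has_nonstandard_frame_of_family[where J = "A \<union> (B \<union> D)" and x = z and ?c1.0 = 1 and ?c2.0 = 2])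
    show "\<not> unital (C0 ?K)" by (rule nonunital_disjoint_union[OF P])
    show "z i \<in> carrier (C0 ?K)" if "i \<in> A \<union> (B \<union> D)" for i
      using that by (auto simp: ABD z intro!: C0_extend_component C0_extend_Inr level_in cylinder_in h x)
    fix t assume t: "t \<in> topspace ?K"
    show "\<exists>s. ((\<lambda>i. abs2 (z i t)) has_sum s) (A \<union> (B \<union> D)) \<and> 1 \<le> s \<and> s \<le> 2"
    proof (cases t)
      case (Inl la)
      then obtain l a where la: "t = Inl (l, a)" "l \<in> \<Lambda>" "a \<in> topspace (X l)"
        using t by (auto simp: topspace_disjoint_union_topology)
      \<comment> \<open>A point of the summand \<open>l\<close> is seen only by the partition
        functions of \<open>l\<close>, however many other summands there are.\<close>
      have "((\<lambda>(l', n). abs2 (z (Inl (l', n)) t)) has_sum 1) (Pair l ` UNIV)"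
        using h(2)[OF la(2,3)] by (subst has_sum_reindex) (auto simp: inj_on_def o_def z la)
      moreover have "((\<lambda>(l', n). abs2 (z (Inl (l', n)) t)) has_sum 1) (Pair l ` UNIV)
          \<longleftrightarrow> ((\<lambda>(l', n). abs2 (z (Inl (l', n)) t)) has_sum 1) (\<Lambda> \<times> UNIV)"
        by (rule has_sum_cong_neutral) (use la in \<open>auto simp: z\<close>)
      ultimately have "((\<lambda>(l', n). abs2 (z (Inl (l', n)) t)) has_sum 1) (\<Lambda> \<times> UNIV)" by simp
      from total[OF this, of 0 0] show ?thesis by (intro exI[of _ 1]) (simp add: z la)
    next
      case (Inr qk)
      then obtain q k where t_eq: "t = Inr (q, k)" by (cases qk) auto
      then have "(q, k) \<in> topspace (punctured_product P)" using t by (auto simp: topspace_disjoint_union_topology)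
      then have qk: "t = Inr (q, k)" "q \<in> insert None (Some ` topspace P)" "q = None \<longrightarrow> k \<noteq> \<infinity>"
        using t_eq unfolding topspace_punctured_product by (simp_all del: not_infinity_eq) blast
      \<comment> \<open>The contributions of the slices and of the lifted frame. Both would be 0
        only at the removed point, so \<open>b + d\<close> is 1 or 2.\<close>
      define b d where "b = (if k = \<infinity> then 0 else 1 :: real)" and "d = (if q = None then 0 else 1 :: real)"
      have "((\<lambda>n. abs2 (z (Inr (Inl n)) t)) has_sum b) UNIV"
      proof (cases k)
        case (enat m)
        show ?thesis
          by (rule has_sum_finite_neutralI[of "{m}"]) (use qk enat in \<open>auto simp: z level_def b_def\<close>)
      qed (simp add: z level_def b_def qk)
      moreover have "((\<lambda>j. abs2 (z (Inr (Inr j)) t)) has_sum d) J"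
        using qk xsum by (cases q) (auto simp: z cylinder_def d_def)
      moreover have "((\<lambda>(l', n). abs2 (z (Inl (l', n)) t)) has_sum 0) (\<Lambda> \<times> UNIV)"
        by (rule has_sum_0) (auto simp: z qk)
      ultimately show ?thesis
        using total[of t 0 b d] qk(3) by (intro exI[of _ "0 + (b + d)"]) (auto simp: b_def d_def)
    qed
  qed simp
qed

theorem theorem3p6:
  fixes \<Lambda> :: "'l set" and X :: "'l \<Rightarrow> 'a topology" and P :: "'p topology"
    and P1 :: "('l \<times> 'a) topology" and P2 :: "('p option \<times> enat) topology"
    and K :: "('l \<times> 'a + 'p option \<times> enat) topology"
  assumes "uncountable \<Lambda>"
    and "\<And>l. l \<in> \<Lambda> \<Longrightarrow> locally_compact_space (X l)"
    and "\<And>l. l \<in> \<Lambda> \<Longrightarrow> Hausdorff_space (X l)"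
    and "\<And>l. l \<in> \<Lambda> \<Longrightarrow> sigma_compact_space (X l)"
    and "P1 = sum_topology X \<Lambda>"
    and "locally_compact_space P" and "Hausdorff_space P" and "\<not> sigma_compact_space P"
    and "\<exists>(J :: 'j set) x. normalized_frame (self_module (C0 P)) J x"
    and "P2 = punctured_product P"
    and "K = disjoint_union_topology P1 P2"
  shows "(\<nexists>(J :: 'i set) x. standard_frame (self_module (C0 K)) J x) \<and>
         has_nonstandard_frame (self_module (C0 K))"
proof -
  obtain J :: "'j set" and x where f: "normalized_frame (self_module (C0 P)) J x" using assms(9) by blast
  have "has_nonstandard_frame (self_module (C0 K))"
    unfolding assms(5,10,11) by (rule nonstandard_frame_exists[OF assms(2-4) assms(6-8) f])
  moreover have "\<nexists>(J :: 'i set) x. standard_frame (self_module (C0 K)) J x"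
    unfolding assms(10,11) using no_standard_frame[OF assms(6-8)] by blast
  ultimately show ?thesis by blast
qed

end
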